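(* For every fixed integer $k\ge3$, as $n\to\infty$, $$f\left(n,\left\lfloor n^2/4\right\rfloor+1,C_{2k+1}\right)=\left(\frac18+o(1)\right)n^2 .$$
   Context: All graphs are finite and simple. A subgraph of an edge-colored graph is rainbow if its edges have pairwise distinct colors. Colorings need not be proper, and only colors that actually occur on an edge are counted. Copies of a graph $H$ in a host graph are subgraphs, not necessarily induced (so a copy of a cycle has distinct vertices but may have chords). For a finite simple graph $G$, $r_H(G)$ is the minimum number of colors in an edge-coloring of $G$ in which every copy of $H$ is rainbow. Define $$f(n,e,H)=\min\{r_H(G): |V(G)|=n,\ e(G)\ge e\},$$ whenever the family of such graphs is nonempty, where $e(G)$ is the number of edges of $G$. $C_{2k+1}$ is the cycle of length $2k+1$. The $o(1)$ term may depend on $k$. *)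

theory Defs
  imports Complex_Main "HOL-Library.Landau_Symbols"
begin

type_synonym 'a graph = "'a set \<times> 'a set set"

abbreviation verts :: "'a graph \<Rightarrow> 'a set" where
  "verts G \<equiv> fst G"

abbreviation edges :: "'a graph \<Rightarrow> 'a set set" where
  "edges G \<equiv> snd G"

definition finite_simple_graph :: "'a graph \<Rightarrow> bool" where
  "finite_simple_graph G \<longleftrightarrow>
     finite (verts G) \<and> (\<forall>e\<in>edges G. e \<subseteq> verts G \<and> card e = 2)"

definition subgraph :: "'a graph \<Rightarrow> 'a graph \<Rightarrow> bool" where
  "subgraph H G \<longleftrightarrow>
     finite_simple_graph H \<and> verts H \<subseteq> verts G \<and> edges H \<subseteq> edges G"

definition graph_iso :: "'a graph \<Rightarrow> 'b graph \<Rightarrow> bool" where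
  "graph_iso G H \<longleftrightarrow>
     (\<exists>\<phi>. bij_betw \<phi> (verts G) (verts H) \<and> edges H = (\<lambda>e. \<phi> ` e) ` edges G)"

definition is_copy :: "'b graph \<Rightarrow> 'a graph \<Rightarrow> 'a graph \<Rightarrow> bool" where
  "is_copy H G K \<longleftrightarrow> subgraph K G \<and> graph_iso H K"

definition rainbow :: "('a set \<Rightarrow> nat) \<Rightarrow> 'a graph \<Rightarrow> bool" where
  "rainbow c K \<longleftrightarrow> inj_on c (edges K)"

definition copies_rainbow :: "'b graph \<Rightarrow> 'a graph \<Rightarrow> ('a set \<Rightarrow> nat) \<Rightarrow> bool" where
  "copies_rainbow H G c \<longleftrightarrow> (\<forall>K. is_copy H G K \<longrightarrow> rainbow c K)"

text \<open>A colouring is a total function on sets, but only its values on the edges of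
  the host graph are counted.\<close>

definition rainbow_number :: "'b graph \<Rightarrow> 'a graph \<Rightarrow> nat" where
  "rainbow_number H G = (LEAST m. \<exists>c. copies_rainbow H G c \<and> card (c ` edges G) = m)"

lemma ex_copies_rainbow:
  assumes "finite_simple_graph G"
  shows "\<exists>c. copies_rainbow H G c"
proof -
  have "edges G \<subseteq> Pow (verts G)" "finite (verts G)"
    using assms by (auto simp: finite_simple_graph_def)
  then have "finite (edges G)"
    using finite_subset by blast
  then obtain c :: "'a set \<Rightarrow> nat" where "inj_on c (edges G)"
    using finite_imp_inj_to_nat_seg by blast
  then show ?thesis
    unfolding copies_rainbow_def is_copy_def subgraph_def rainbow_def
    by (blast intro: inj_on_subset)
qed

text \<open>Every finite graph is isomorphic to one whose vertices are natural numbers, so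
  the host graphs range over those. The least element is unspecified when there is no
  graph on \<open>n\<close> vertices with at least \<open>e\<close> edges, that is, when \<open>e > n choose 2\<close>.\<close>

definition f_min :: "nat \<Rightarrow> nat \<Rightarrow> 'b graph \<Rightarrow> nat" where
  "f_min n e H = (LEAST m. \<exists>G :: nat graph. finite_simple_graph G \<and>
     card (verts G) = n \<and> card (edges G) \<ge> e \<and> rainbow_number H G = m)"

lemma ex_host_graph:
  assumes "e \<le> n choose 2"
  shows "\<exists>G :: nat graph. finite_simple_graph G \<and> card (verts G) = n \<and> card (edges G) \<ge> e"
proof -
  let ?G = "({..<n}, {s. s \<subseteq> {..<n} \<and> card s = 2})"
  have "card (edges ?G) = n choose 2"
    using n_subsets[of "{..<n}" 2] by simp
  then have "finite_simple_graph ?G \<and> card (verts ?G) = n \<and> card (edges ?G) \<ge> e"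
    using assms by (simp add: finite_simple_graph_def)
  then show ?thesis by blast
qed

text \<open>This is the cycle of length \<open>m\<close> only for \<open>m \<ge> 3\<close>.\<close>

definition cycle_graph :: "nat \<Rightarrow> nat graph" where
  "cycle_graph m = ({..<m}, (\<lambda>i. {i, Suc i mod m}) ` {..<m})"

end

theory Submission
  imports Defs "HOL-Library.Nat_Bijection"
begin

text \<open>
  Lower bound. Deleting \<open>o(n\<^sup>2)\<close> edges leaves a graph in which every walk of three edges is
  accompanied by a positive proportion of all pairs completing such a walk between the same ends,
  hence by paths of any prescribed odd length avoiding a bounded set. Consequently, if two edges
  \<open>ab\<close> and \<open>xy\<close> have the same colour and \<open>a\<close>, \<open>x\<close> have a common neighbour, then no edge joins a neighbour
  of \<open>b\<close> to a neighbour of \<open>y\<close>, because otherwise both edges lie on a cycle of length \<open>2k+1\<close>.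
  On a vertex set maximising \<open>3/2 e(U) - (1/4 + \<mu>) |U|\<^sup>2\<close> all degrees exceed \<open>|U|/3\<close>, so two of any
  three vertices have common neighbours. This yields, for each colour class of at least three edges,
  two disjoint independent sets such that a vertex outside of them sees at most one end of the class.
  Counting walks of three edges, once by convexity and once by comparing the degrees with the degrees
  in the graph of uniquely coloured edges, gives \<open>(1/8 - o(1)) n\<^sup>2\<close> colours unless the graph is nearly
  bipartite. In the latter case there is still an edge inside one of the parts, since there are more
  than \<open>n\<^sup>2/4\<close> edges, and it closes cycles of length \<open>2k+1\<close> through any two of more than \<open>n\<^sup>2/8\<close> cross edges.

  Upper bound. Two disjoint cliques on \<open>n\<close> vertices whose sizes differ by a small multiple of \<open>n\<close> have
  more than \<open>n\<^sup>2/4\<close> edges, and may be coloured injectively with the same colours.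
\<close>

subsection \<open>Two bounds for a quadratic form\<close>

text \<open>The obstacle is the complete bipartite graph: it has no odd cycle and one colour
  suffices for it, so no bound that depends continuously on the number of edges can give
  \<open>n^2 / 8\<close> just above \<open>n^2 / 4\<close> edges. Hence the counting ends in an
  alternative, and in its nearly bipartite branch a single surplus edge has to do the work. The
  potential \<open>3/2 e(U) - 1/4 |U|^2\<close> is the count itself. If \<open>\<rho>\<close> edges
  have a colour of their own, then twice the number of colours is
  \<open>e + \<rho> - \<Sum> (|K| - 2)\<close>, summed over the classes \<open>K\<close> of at least
  three edges. Outside of the bipartite branch the two walk counts give
  \<open>\<rho> - \<Sum> (|K| - 2) \<ge> 2 e - m^2 / 2 - o(m^2)\<close> on \<open>m\<close>
  vertices, hence about \<open>3/2 e - m^2 / 4\<close> colours, which is \<open>m^2 / 8\<close> at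
  \<open>e = m^2 / 4\<close>. Maximising this potential therefore raises the minimum degree without
  weakening the bound that is sought; the small \<open>\<mu>\<close> lifts the degrees above a third
  of the vertices. Classes of two edges have weight 0 in the formula; for them the conflict
  condition is applied directly, without any orientation of the class.\<close>

lemma three_le_prod_inverses:
  fixes u v :: real
  assumes "u > 0" "v > 0"
  shows "3 \<le> u * v + 1 / u + 1 / v"
proof -
  define t where "t = sqrt (u * v)"
  have t: "t > 0" "t ^ 2 = u * v" using assms by (auto simp: t_def)
  have "2 * t \<le> u + v"
    using arith_geo_mean_sqrt[of u v] assms by (simp add: t_def)
  hence "2 * t / (u * v) \<le> (u + v) / (u * v)"
    using assms by (intro divide_right_mono) auto
  also have "\<dots> = 1 / u + 1 / v" using assms by (simp add: field_simps)
  finally have a: "2 / t \<le> 1 / u + 1 / v"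
    using t(1) by (simp add: t(2)[symmetric] power2_eq_square)
  have "0 \<le> (t - 1) ^ 2 * (t + 2) / t" using t by simp
  also have "\<dots> = t ^ 2 + 2 / t - 3" using t by (simp add: field_simps power2_eq_square power3_eq_cube)
  finally show ?thesis using a t by linarith
qed

text \<open>AM-GM for \<open>d p * d q / D^2\<close>, \<open>D / d p\<close> and
  \<open>D / d q\<close>, whose product is 1, is summed over all edges, with \<open>D\<close> the
  mean degree. Each of the two reciprocal terms sums to at most \<open>D\<close> times the number of
  vertices, which is the degree sum, so one third of the left side remains.\<close>

lemma degree_sum_cube_le_walks:
  fixes A :: "'a \<Rightarrow> 'a \<Rightarrow> real"
  assumes fin: "finite U"
    and A: "\<And>p q. 0 \<le> A p q" and sym: "\<And>p q. A p q = A q p"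
    and d: "\<And>p. p \<in> U \<Longrightarrow> d p = (\<Sum>q\<in>U. A p q)"
  shows "(\<Sum>p\<in>U. d p) ^ 3 \<le> real (card U) ^ 2 * (\<Sum>p\<in>U. \<Sum>q\<in>U. A p q * d p * d q)"
proof -
  define S where "S = (\<Sum>p\<in>U. d p)"
  define m where "m = real (card U)"
  define W where "W = (\<Sum>p\<in>U. \<Sum>q\<in>U. A p q * d p * d q)"
  have dnn: "0 \<le> d p" if "p \<in> U" for p using d[OF that] A by (simp add: sum_nonneg)
  have W0: "0 \<le> W" unfolding W_def
    by (intro sum_nonneg mult_nonneg_nonneg) (auto simp: A dnn)
  show ?thesis
  proof (cases "S \<le> 0")
    case True
    have "S \<ge> 0" unfolding S_def by (intro sum_nonneg) (auto simp: dnn)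
    with True have "S = 0" by simp
    thus ?thesis using W0 by (simp add: S_def[symmetric] W_def[symmetric])
  next
    case False
    hence S: "S > 0" by simp
    hence "U \<noteq> {}" by (auto simp: S_def)
    hence m: "m > 0" using fin by (simp add: m_def card_gt_0_iff)
    define D where "D = S / m"
    have D: "D > 0" using S m by (simp add: D_def)
    have pt: "3 * A p q \<le> A p q * d p * d q / D ^ 2 + D * (A p q / d p) + D * (A p q / d q)"
      if pq: "p \<in> U" "q \<in> U" for p q
    proof (cases "A p q = 0")
      case False
      hence Ap: "A p q > 0" using A[of p q] by simp
      have "A p q \<le> d p" unfolding d[OF pq(1)] by (rule member_le_sum) (auto simp: fin A pq)
      moreover have "A q p \<le> d q" unfolding d[OF pq(2)] by (rule member_le_sum) (auto simp: fin A pq)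
      ultimately have dd: "d p > 0" "d q > 0" using Ap sym[of p q] by auto
      have "3 \<le> (d p / D) * (d q / D) + 1 / (d p / D) + 1 / (d q / D)"
        by (rule three_le_prod_inverses) (use dd D in auto)
      hence "A p q * 3 \<le> A p q * ((d p / D) * (d q / D) + 1 / (d p / D) + 1 / (d q / D))"
        using Ap by (intro mult_left_mono) auto
      thus ?thesis by (simp add: algebra_simps power2_eq_square)
    qed simp
    have s1: "(\<Sum>p\<in>U. \<Sum>q\<in>U. A p q) = S" by (simp add: S_def d)
    \<comment> \<open>Only an inequality: by \<open>x / 0 = 0\<close> a vertex of degree 0
      contributes 0 instead of \<open>D\<close>.\<close>
    have s2: "(\<Sum>p\<in>U. \<Sum>q\<in>U. D * (A p q / d p)) \<le> D * m"
    proof -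
      have "(\<Sum>p\<in>U. \<Sum>q\<in>U. D * (A p q / d p)) = (\<Sum>p\<in>U. D * (d p / d p))"
        by (intro sum.cong refl) (simp add: sum_distrib_left[symmetric] sum_divide_distrib[symmetric] d[symmetric])
      also have "\<dots> \<le> (\<Sum>p\<in>U. D)" by (intro sum_mono) (use D in auto)
      finally show ?thesis by (simp add: m_def mult.commute)
    qed
    have s3: "(\<Sum>p\<in>U. \<Sum>q\<in>U. D * (A p q / d q)) \<le> D * m"
    proof -
      have "(\<Sum>p\<in>U. \<Sum>q\<in>U. D * (A p q / d q)) = (\<Sum>q\<in>U. \<Sum>p\<in>U. D * (A q p / d q))"
        by (subst sum.swap) (simp add: sym)
      thus ?thesis using s2 by simp
    qed
    have "(\<Sum>p\<in>U. \<Sum>q\<in>U. 3 * A p q) \<le>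
        (\<Sum>p\<in>U. \<Sum>q\<in>U. A p q * d p * d q / D ^ 2 + D * (A p q / d p) + D * (A p q / d q))"
      by (intro sum_mono pt)
    hence "3 * S \<le> W / D ^ 2 + D * m + D * m"
      using s2 s3 by (simp add: sum.distrib sum_distrib_left[symmetric] s1 W_def sum_divide_distrib[symmetric])
    moreover have "D * m = S" using m by (simp add: D_def)
    ultimately have "S \<le> W / D ^ 2" by simp
    hence "S * D ^ 2 \<le> W" using D by (simp add: pos_le_divide_eq)
    hence "S * (S ^ 2 / m ^ 2) \<le> W" by (simp add: D_def power_divide)
    hence "S ^ 3 \<le> m ^ 2 * W" using m by (simp add: field_simps power2_eq_square power3_eq_cube)
    thus ?thesis by (simp add: S_def m_def W_def)
  qed
qed

text \<open>
  In the application \<open>A\<close> is the adjacency matrix, \<open>d\<close> the degree, \<open>k\<close> the degree in the graph of uniquely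
  coloured edges, and \<open>e\<close>, \<open>r\<close> are the numbers of all and of uniquely coloured edges.
\<close>

lemma unique_form_lower_bound:
  fixes A :: "'a \<Rightarrow> 'a \<Rightarrow> real" and d k D :: "'a \<Rightarrow> real"
  assumes fin: "finite U" and A: "\<And>p q. 0 \<le> A p q" and sym: "\<And>p q. A p q = A q p"
    and d: "\<And>p. p \<in> U \<Longrightarrow> d p = (\<Sum>q\<in>U. A p q)" and dm: "\<And>p. p \<in> U \<Longrightarrow> d p \<le> real (card U)"
    and k: "\<And>p. p \<in> U \<Longrightarrow> 0 \<le> k p" "\<And>p. p \<in> U \<Longrightarrow> k p \<le> d p"
    and e: "(\<Sum>p\<in>U. d p) = 2 * e" and r: "(\<Sum>p\<in>U. k p) = 2 * r"
    and row: "\<And>p. p \<in> U \<Longrightarrow> (\<Sum>q\<in>U. A p q * (d q - k q)) \<le> e - r - D p + d p"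
  shows "8 * e ^ 3 / real (card U) ^ 2 - 2 * e ^ 2 + 2 * r ^ 2 + (\<Sum>p\<in>U. (d p + k p) * D p)
           - 4 * e * real (card U) \<le> (\<Sum>p\<in>U. \<Sum>q\<in>U. A p q * k p * k q)"
proof -
  define m where "m = real (card U)"
  define W where "W = (\<Sum>p\<in>U. \<Sum>q\<in>U. A p q * d p * d q)"
  have dnn: "0 \<le> d p" if "p \<in> U" for p using k[OF that] by linarith
  have W: "8 * e ^ 3 / m ^ 2 \<le> W"
  proof (cases "m = 0")
    case True
    have "0 \<le> W" unfolding W_def by (intro sum_nonneg mult_nonneg_nonneg) (auto simp: A dnn)
    with True show ?thesis by simp
  next
    case False
    have "(2 * e) ^ 3 \<le> m ^ 2 * W"
      using degree_sum_cube_le_walks[OF fin A sym d] by (simp add: e m_def W_def)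
    thus ?thesis using False by (simp add: field_simps power_mult_distrib m_def)
  qed
  \<comment> \<open>The two mixed terms left over from expanding
    \<open>(d p + k p) * (d q - k q)\<close> cancel in the sum because \<open>A\<close> is
    symmetric. What remains contains the left side of \<open>row\<close>, weighted with the
    nonnegative \<open>d p + k p\<close>.\<close>
  have "(\<Sum>p\<in>U. \<Sum>q\<in>U. A p q * k p * k q) = (\<Sum>p\<in>U. \<Sum>q\<in>U. A p q * d p * d q
     - (d p + k p) * (A p q * (d q - k q)) + A p q * k p * d q - A p q * d p * k q)"
    by (intro sum.cong refl) (simp add: algebra_simps)
  also have "\<dots> = W - (\<Sum>p\<in>U. (d p + k p) * (\<Sum>q\<in>U. A p q * (d q - k q)))
      + (\<Sum>p\<in>U. \<Sum>q\<in>U. A p q * k p * d q) - (\<Sum>p\<in>U. \<Sum>q\<in>U. A p q * d p * k q)"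
    by (simp add: sum.distrib sum_subtractf W_def sum_distrib_left)
  also have "(\<Sum>p\<in>U. \<Sum>q\<in>U. A p q * k p * d q) = (\<Sum>p\<in>U. \<Sum>q\<in>U. A p q * d p * k q)"
    by (subst sum.swap) (simp add: sym mult_ac)
  finally have eq: "(\<Sum>p\<in>U. \<Sum>q\<in>U. A p q * k p * k q)
      = W - (\<Sum>p\<in>U. (d p + k p) * (\<Sum>q\<in>U. A p q * (d q - k q)))" by simp
  have "(\<Sum>p\<in>U. (d p + k p) * (\<Sum>q\<in>U. A p q * (d q - k q)))
      \<le> (\<Sum>p\<in>U. (d p + k p) * (e - r - D p + m))"
  proof (intro sum_mono mult_left_mono)
    fix p assume p: "p \<in> U"
    show "(\<Sum>q\<in>U. A p q * (d q - k q)) \<le> e - r - D p + m" using row[OF p] dm[OF p] by (simp add: m_def)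
    show "0 \<le> d p + k p" using k[OF p] by linarith
  qed
  also have "\<dots> = (\<Sum>p\<in>U. (d p + k p) * (e - r + m) - (d p + k p) * D p)"
    by (intro sum.cong refl) (simp add: algebra_simps)
  also have "\<dots> = (\<Sum>p\<in>U. d p + k p) * (e - r + m) - (\<Sum>p\<in>U. (d p + k p) * D p)"
    by (simp only: sum_subtractf sum_distrib_right)
  also have "(\<Sum>p\<in>U. d p + k p) = 2 * e + 2 * r" by (simp add: sum.distrib e r)
  finally have up: "(\<Sum>p\<in>U. (d p + k p) * (\<Sum>q\<in>U. A p q * (d q - k q)))
      \<le> (2 * e + 2 * r) * (e - r + m) - (\<Sum>p\<in>U. (d p + k p) * D p)" .
  have "2 * r \<le> 2 * e" unfolding e[symmetric] r[symmetric] by (intro sum_mono k)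
  hence "(2 * e + 2 * r) * m \<le> (4 * e) * m" by (intro mult_right_mono) (auto simp: m_def)
  moreover have "(2 * e + 2 * r) * (e - r + m) = 2 * e ^ 2 - 2 * r ^ 2 + (2 * e + 2 * r) * m"
    by (simp add: algebra_simps power2_eq_square)
  ultimately show ?thesis using eq up W by (simp add: m_def)
qed

text \<open>The form misses all pairs inside \<open>I\<close> and inside \<open>J\<close>. These
  sets carry the weight \<open>2 r - t\<close> together, and the loss is smallest for an even split,
  when it is \<open>(2 r - t)^2 / 2\<close> out of \<open>(2 r)^2\<close>.\<close>

lemma unique_form_upper_bound:
  fixes A :: "'a \<Rightarrow> 'a \<Rightarrow> real" and k :: "'a \<Rightarrow> real"
  assumes fin: "finite U" and A: "\<And>p q. A p q \<le> 1"
    and k: "\<And>p. p \<in> U \<Longrightarrow> 0 \<le> k p" and r: "(\<Sum>p\<in>U. k p) = 2 * r"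
    and IJ: "I \<subseteq> U" "J \<subseteq> U" "I \<inter> J = {}"
    and I: "\<And>p q. p \<in> I \<Longrightarrow> q \<in> I \<Longrightarrow> A p q = 0" and J: "\<And>p q. p \<in> J \<Longrightarrow> q \<in> J \<Longrightarrow> A p q = 0"
    and t: "t = (\<Sum>p\<in>U - (I \<union> J). k p)"
  shows "(\<Sum>p\<in>U. \<Sum>q\<in>U. A p q * k p * k q) \<le> 2 * r ^ 2 + 2 * r * t - t ^ 2 / 2"
proof -
  define s where "s = (\<lambda>S. \<Sum>p\<in>S. k p)"
  have sub: "A p q * k p * k q \<le> k p * k q - (if p \<in> I \<and> q \<in> I then k p * k q else 0)
        - (if p \<in> J \<and> q \<in> J then k p * k q else 0)" if "p \<in> U" "q \<in> U" for p q
  proof -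
    have "A p q * (k p * k q) \<le> 1 * (k p * k q)"
      by (intro mult_right_mono A mult_nonneg_nonneg k that)
    thus ?thesis using I[of p q] J[of p q] IJ(3) by auto
  qed
  have aux: "(\<Sum>p\<in>U. \<Sum>q\<in>U. if p \<in> S \<and> q \<in> S then k p * k q else 0) = s S ^ 2" if "S \<subseteq> U" for S
  proof -
    have "(\<Sum>p\<in>U. \<Sum>q\<in>U. if p \<in> S \<and> q \<in> S then k p * k q else 0)
        = (\<Sum>p\<in>U. \<Sum>q\<in>U. (if p \<in> S then k p else 0) * (if q \<in> S then k q else 0))"
      by (intro sum.cong) auto
    also have "\<dots> = (\<Sum>p\<in>U. if p \<in> S then k p else 0) * (\<Sum>q\<in>U. if q \<in> S then k q else 0)"
      by (simp add: sum_product)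
    also have "(\<Sum>p\<in>U. if p \<in> S then k p else 0) = s S"
      unfolding s_def using that fin by (simp add: sum.If_cases Int_absorb1)
    finally show ?thesis by (simp add: power2_eq_square)
  qed
  have "(\<Sum>p\<in>U. \<Sum>q\<in>U. A p q * k p * k q) \<le> (\<Sum>p\<in>U. \<Sum>q\<in>U. k p * k q
      - (if p \<in> I \<and> q \<in> I then k p * k q else 0) - (if p \<in> J \<and> q \<in> J then k p * k q else 0))"
    by (intro sum_mono sub)
  also have "\<dots> = (2 * r) ^ 2 - s I ^ 2 - s J ^ 2"
    by (simp add: sum_subtractf aux IJ sum_product[symmetric] r power2_eq_square)
  finally have a: "(\<Sum>p\<in>U. \<Sum>q\<in>U. A p q * k p * k q) \<le> (2 * r) ^ 2 - s I ^ 2 - s J ^ 2" .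
  have "2 * r = s (I \<union> J) + t" unfolding r[symmetric] s_def t
    using sum.subset_diff[of "I \<union> J" U k] IJ fin by (simp add: add.commute)
  also have "s (I \<union> J) = s I + s J" unfolding s_def
    by (rule sum.union_disjoint) (use IJ fin in \<open>auto intro: finite_subset\<close>)
  finally have "s I + s J = 2 * r - t" by simp
  hence "(2 * r - t) ^ 2 = (s I + s J) ^ 2" by simp
  also have "\<dots> \<le> 2 * (s I ^ 2 + s J ^ 2)"
    using sum_squares_bound[of "s I" "s J"] by (simp add: power2_eq_square algebra_simps)
  finally have "(2 * r - t) ^ 2 / 2 \<le> s I ^ 2 + s J ^ 2" by simp
  moreover have "(2 * r - t) ^ 2 / 2 = 2 * r ^ 2 - 2 * r * t + t ^ 2 / 2"
    by (simp add: power2_eq_square algebra_simps add_divide_distrib diff_divide_distrib)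
  ultimately show ?thesis using a by (simp add: power2_eq_square)
qed

subsection \<open>Colour classes under the conflict condition\<close>

definition nbr :: "'a set set \<Rightarrow> 'a \<Rightarrow> 'a set" where
  "nbr E x = {y. {x, y} \<in> E}"

lemma nbr_iff [simp]: "y \<in> nbr E x \<longleftrightarrow> {x, y} \<in> E"
  by (simp add: nbr_def)

definition walk_pairs :: "'a set set \<Rightarrow> 'a \<Rightarrow> 'a \<Rightarrow> ('a \<times> 'a) set" where
  "walk_pairs E y w = {(a, b). {y, a} \<in> E \<and> {a, b} \<in> E \<and> {b, w} \<in> E}"

text \<open>The promised walks lie in \<open>E\<close> rather than in \<open>E'\<close>: cleaning
  removes edges, so the cleaned graph need not be rich in walks of its own.\<close>

definition walk_rich :: "real \<Rightarrow> 'a set set \<Rightarrow> 'a set set \<Rightarrow> bool" where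
  "walk_rich r E' E \<longleftrightarrow> (\<forall>y a b w. {y, a} \<in> E' \<longrightarrow> {a, b} \<in> E' \<longrightarrow> {b, w} \<in> E' \<longrightarrow>
     r \<le> real (card (walk_pairs E y w)))"

lemma walk_richD:
  "walk_rich r E' E \<Longrightarrow> {y, a} \<in> E' \<Longrightarrow> {a, b} \<in> E' \<Longrightarrow> {b, w} \<in> E' \<Longrightarrow> r \<le> real (card (walk_pairs E y w))"
  by (auto simp: walk_rich_def)

lemma finite_simple_graphD:
  assumes "finite_simple_graph (V, E)"
  shows "finite V" "finite E" "\<And>f. f \<in> E \<Longrightarrow> f \<subseteq> V" "\<And>f. f \<in> E \<Longrightarrow> card f = 2"
    "\<And>x y. {x, y} \<in> E \<Longrightarrow> x \<noteq> y" "\<And>x y. {x, y} \<in> E \<Longrightarrow> x \<in> V" "\<And>x y. {x, y} \<in> E \<Longrightarrow> y \<in> V"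
    "\<And>x. nbr E x \<subseteq> V" "\<And>x. finite (nbr E x)"
proof -
  show V: "finite V" and f: "\<And>f. f \<in> E \<Longrightarrow> f \<subseteq> V" and c: "\<And>f. f \<in> E \<Longrightarrow> card f = 2"
    using assms by (auto simp: finite_simple_graph_def)
  show "finite E" using V f by (meson PowI finite_Pow_iff finite_subset subsetI)
  show "x \<noteq> y" if "{x, y} \<in> E" for x y using c[OF that] by auto
  show xy: "x \<in> V" "y \<in> V" if "{x, y} \<in> E" for x y using f[OF that] by auto
  show n: "nbr E x \<subseteq> V" for x using xy by auto
  show "finite (nbr E x)" for x using finite_subset[OF n V] .
qed

lemma card_incident:
  assumes "finite_simple_graph (V, E)"
  shows "card {f \<in> E. x \<in> f} = card (nbr E x)"
proof -
  have "bij_betw (\<lambda>y. {x, y}) (nbr E x) {f \<in> E. x \<in> f}"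
  proof (rule bij_betwI')
    fix y z assume "y \<in> nbr E x" "z \<in> nbr E x"
    thus "({x, y} = {x, z}) = (y = z)" by (auto simp: doubleton_eq_iff)
  next
    fix f assume "f \<in> {f \<in> E. x \<in> f}"
    moreover from this obtain a b where "f = {a, b}"
      using finite_simple_graphD(4)[OF assms, of f] by (auto simp: card_2_iff)
    ultimately show "\<exists>y\<in>nbr E x. f = {x, y}" by (auto simp: insert_commute)
  qed auto
  thus ?thesis by (simp add: bij_betw_same_card)
qed

lemma sum_incident:
  assumes "finite_simple_graph (V, E)" "M \<subseteq> E" "finite S"
  shows "(\<Sum>x\<in>S. card {f \<in> M. x \<in> f}) = (\<Sum>f\<in>M. card (f \<inter> S))"
proof -
  have finM: "finite M" using finite_simple_graphD(2)[OF assms(1)] assms(2) finite_subset by blast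
  have "(\<Sum>x\<in>S. card {f \<in> M. x \<in> f}) = (\<Sum>x\<in>S. \<Sum>f\<in>M. if x \<in> f then 1 else 0)"
    by (intro sum.cong refl) (simp add: sum.If_cases[OF finM] Int_def)
  also have "\<dots> = (\<Sum>f\<in>M. \<Sum>x\<in>S. if x \<in> f then 1 else 0)" by (rule sum.swap)
  also have "\<dots> = (\<Sum>f\<in>M. card (f \<inter> S))"
    by (intro sum.cong refl) (simp add: sum.If_cases[OF assms(3)] Int_def conj_commute)
  finally show ?thesis .
qed

lemma handshake:
  assumes "finite_simple_graph (V, E)" "M \<subseteq> E"
  shows "(\<Sum>x\<in>V. card {f \<in> M. x \<in> f}) = 2 * card M"
proof -
  have "card (f \<inter> V) = 2" if "f \<in> M" for f
    using finite_simple_graphD(3,4)[OF assms(1), of f] assms(2) that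
    by (metis inf.absorb1 subsetD)
  thus ?thesis using sum_incident[OF assms finite_simple_graphD(1)[OF assms(1)]] by simp
qed

definition independent_pair :: "'a set \<Rightarrow> 'a set set \<Rightarrow> 'a set \<Rightarrow> 'a set \<Rightarrow> bool" where
  "independent_pair U E I J \<longleftrightarrow> I \<subseteq> U \<and> J \<subseteq> U \<and> I \<inter> J = {} \<and>
     (\<forall>p\<in>I. \<forall>q\<in>I. {p, q} \<notin> E) \<and> (\<forall>p\<in>J. \<forall>q\<in>J. {p, q} \<notin> E)"

lemma obtain_maximal_subset:
  fixes \<phi> :: "'a set \<Rightarrow> 'b :: linorder"
  assumes "finite V"
  obtains U where "U \<subseteq> V" "\<And>U'. U' \<subseteq> V \<Longrightarrow> \<phi> U' \<le> \<phi> U"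
proof -
  have "Max (\<phi> ` Pow V) \<in> \<phi> ` Pow V" using assms by (intro Max_in) auto
  then obtain U where U: "U \<subseteq> V" "\<phi> U = Max (\<phi> ` Pow V)" by auto
  thus ?thesis using assms by (intro that[OF U(1)]) auto
qed

text \<open>All that the cycles contribute is contained in \<open>conflict\<close>; the counting
  that follows no longer mentions their length. The slack 6 in the degree condition pays for three
  pairs of vertices with two common neighbours each.\<close>

locale conflict_graph =
  fixes U :: "'a set" and E :: "'a set set" and c :: "'a set \<Rightarrow> nat"
  assumes gr: "finite_simple_graph (U, E)"
    and deg: "\<And>v. v \<in> U \<Longrightarrow> card U + 6 < 3 * card (nbr E v)"
    and conflict: "\<And>a b x y u p q. \<lbrakk>{a, b} \<in> E; {x, y} \<in> E; {a, b} \<noteq> {x, y}; c {a, b} = c {x, y};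
      {a, u} \<in> E; {x, u} \<in> E; u \<noteq> b; u \<noteq> y; {b, p} \<in> E; {y, q} \<in> E\<rbrakk> \<Longrightarrow> {p, q} \<notin> E"
begin

lemmas grD = finite_simple_graphD[OF gr]

text \<open>Three common neighbours, because the one that \<open>conflict\<close> asks for must
  avoid two prescribed vertices.\<close>

definition sim :: "'a \<Rightarrow> 'a \<Rightarrow> bool" where
  "sim a b \<longleftrightarrow> 3 \<le> card (nbr E a \<inter> nbr E b)"

lemma sim_sym: "sim a b \<Longrightarrow> sim b a"
  by (simp add: sim_def Int_commute)

lemma sim_witness:
  assumes "sim a x"
  obtains u where "{a, u} \<in> E" "{x, u} \<in> E" "u \<noteq> b" "u \<noteq> y"
proof -
  have "\<not> nbr E a \<inter> nbr E x \<subseteq> {b, y}"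
  proof
    assume "nbr E a \<inter> nbr E x \<subseteq> {b, y}"
    hence "card (nbr E a \<inter> nbr E x) \<le> card {b, y}" by (intro card_mono) auto
    also have "\<dots> \<le> 2" by (simp add: card_insert_if)
    finally show False using assms by (simp add: sim_def)
  qed
  then obtain u where "u \<in> nbr E a" "u \<in> nbr E x" "u \<noteq> b" "u \<noteq> y" by blast
  thus ?thesis using that[of u] by simp
qed

definition same :: "'a set \<Rightarrow> 'a set \<Rightarrow> bool" where
  "same f g \<longleftrightarrow> f \<in> E \<and> g \<in> E \<and> f \<noteq> g \<and> c f = c g"

lemma same_sym: "same f g \<Longrightarrow> same g f"
  by (auto simp: same_def)

lemma sim_parallel:
  assumes "same {a, b} {x, y}" "sim a x" "{b, p} \<in> E" "{y, q} \<in> E"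
  shows "{p, q} \<notin> E"
proof -
  obtain u where "{a, u} \<in> E" "{x, u} \<in> E" "u \<noteq> b" "u \<noteq> y" using sim_witness[OF assms(2)] .
  thus ?thesis using conflict[of a b x y u p q] assms by (auto simp: same_def)
qed

text \<open>The vertex \<open>a\<close> is itself a neighbour of \<open>b\<close>, and
  \<open>x\<close> one of \<open>y\<close>, so each may serve as an end of the excluded
  edge.\<close>

lemma sim_disjoint:
  assumes "same {a, b} {x, y}" "sim a x"
  shows "nbr E a \<inter> nbr E y = {}" "nbr E b \<inter> nbr E x = {}"
proof -
  have e: "{a, b} \<in> E" "{x, y} \<in> E" using assms by (auto simp: same_def)
  show "nbr E a \<inter> nbr E y = {}"
    using sim_parallel[OF assms, of a] e by (auto simp: insert_commute)
  show "nbr E b \<inter> nbr E x = {}"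
    using sim_parallel[OF assms, of _ x] e by (auto simp: insert_commute)
qed

lemma not_sim_if_disjoint: "nbr E a \<inter> nbr E b = {} \<Longrightarrow> \<not> sim a b"
  by (simp add: sim_def)

text \<open>Otherwise the three neighbourhoods overlap in at most \<open>2 + 2 + 2\<close> vertices,
  while their sizes add up to more than \<open>card U + 6\<close>.\<close>

lemma three_sim:
  assumes "a \<in> U" "b \<in> U" "x \<in> U"
  shows "sim a b \<or> sim a x \<or> sim b x"
proof (rule ccontr)
  assume n: "\<not> ?thesis"
  let ?A = "nbr E a" and ?B = "nbr E b" and ?C = "nbr E x"
  have f: "finite ?A" "finite ?B" "finite ?C" using grD by auto
  have 1: "card ?A + card ?B = card (?A \<union> ?B) + card (?A \<inter> ?B)" using f by (rule_tac card_Un_Int) auto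
  have 2: "card (?A \<union> ?B) + card ?C = card (?A \<union> ?B \<union> ?C) + card ((?A \<union> ?B) \<inter> ?C)"
    using f by (rule_tac card_Un_Int) auto
  have "card ((?A \<union> ?B) \<inter> ?C) \<le> card (?A \<inter> ?C) + card (?B \<inter> ?C)"
    by (metis card_Un_le Int_Un_distrib2)
  moreover have "card (?A \<union> ?B \<union> ?C) \<le> card U" using grD by (intro card_mono) auto
  moreover have "card (?A \<inter> ?B) \<le> 2" "card (?A \<inter> ?C) \<le> 2" "card (?B \<inter> ?C) \<le> 2"
    using n by (auto simp: sim_def)
  ultimately show False using 1 2 deg[OF assms(1)] deg[OF assms(2)] deg[OF assms(3)] by linarith
qed

section \<open>Consistent orientation of a colour class\<close>

lemma same_labels_exist:
  assumes "same f g"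
  obtains x y where "f = {x, y}"
proof -
  have "card f = 2" using assms grD(4) by (auto simp: same_def)
  thus ?thesis using that by (auto simp: card_2_iff)
qed

text \<open>Each of the triples \<open>p, x1, y2\<close> and \<open>p, y1, x2\<close> contains a
  similar pair, which by assumption involves \<open>p\<close>. As \<open>p\<close> is never similar
  to both ends of one edge, only these two patterns remain: an end of the third edge recognises
  which ends of the first two correspond.\<close>

lemma third_edge_sim:
  assumes s: "same {x1, y1} {x2, y2}" "same {x1, y1} {a, b}" "same {x2, y2} {a, b}"
    and n: "\<not> sim x1 y2" "\<not> sim y1 x2" and p: "p \<in> {a, b}"
  shows "sim p x1 \<and> sim p x2 \<and> \<not> sim p y1 \<and> \<not> sim p y2 \<or> sim p y1 \<and> sim p y2 \<and> \<not> sim p x1 \<and> \<not> sim p x2"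
proof -
  obtain q where q: "{a, b} = {p, q}" using p by auto
  have s': "same {p, q} {x1, y1}" "same {p, q} {x2, y2}" "same {p, q} {y1, x1}" "same {p, q} {y2, x2}"
    using s(2,3)[THEN same_sym] by (simp_all add: q insert_commute[of y1 x1] insert_commute[of y2 x2])
  have U: "x1 \<in> U" "y1 \<in> U" "x2 \<in> U" "y2 \<in> U" "p \<in> U"
    using s'(1,2) grD(3)[of "{p, q}"] grD(3)[of "{x1, y1}"] grD(3)[of "{x2, y2}"] by (auto simp: same_def)
  have 1: "sim p x1 \<or> sim p y2" using three_sim[of p x1 y2] U n by auto
  have 2: "sim p y1 \<or> sim p x2" using three_sim[of p y1 x2] U n by auto
  have 3: "\<not> (sim p x1 \<and> sim p y1)"
    using sim_disjoint(1)[OF s'(1)] not_sim_if_disjoint by blast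
  have 4: "\<not> (sim p x2 \<and> sim p y2)"
    using sim_disjoint(1)[OF s'(2)] not_sim_if_disjoint by blast
  show ?thesis using 1 2 3 4 by blast
qed

lemma same_not_both:
  assumes "same {x, y} {a, b}" "sim a x"
  shows "\<not> sim b x" "\<not> sim a y"
  using sim_disjoint[of x y a b] assms not_sim_if_disjoint sim_sym by blast+

text \<open>The second edge is oriented so that the crossed pairs are not similar. The ends of the
  third edge then follow opposite patterns of \<open>third_edge_sim\<close>, which orients it as
  well. Finally \<open>x1\<close> and \<open>x2\<close> are similar because neither is similar to
  \<open>y3\<close>, and likewise \<open>y1\<close> and \<open>y2\<close> because of
  \<open>x3\<close>.\<close>

lemma triple_labels:
  assumes s: "same {x1, y1} f" "same {x1, y1} g" "same f g"
  shows "\<exists>x2 y2 x3 y3. f = {x2, y2} \<and> g = {x3, y3} \<and> sim x1 x2 \<and> sim y1 y2 \<and>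
    sim x1 x3 \<and> sim y1 y3 \<and> sim x2 x3 \<and> sim y2 y3"
proof -
  obtain a b where f: "f = {a, b}" using same_labels_exist[OF s(3)] .
  obtain x3' y3' where g: "g = {x3', y3'}" using same_labels_exist[OF same_sym[OF s(3)]] .
  have "\<exists>x2 y2. f = {x2, y2} \<and> \<not> sim x1 y2 \<and> \<not> sim y1 x2"
  proof (cases "sim x1 b \<or> sim y1 a")
    case True
    have "same {x1, y1} {a, b}" "same {y1, x1} {b, a}" using s(1) by (simp_all add: f insert_commute)
    hence "\<not> sim x1 a \<and> \<not> sim y1 b" using True same_not_both sim_sym by blast
    thus ?thesis by (intro exI[of _ b] exI[of _ a]) (auto simp: f insert_commute)
  qed (auto simp: f)
  then obtain x2 y2 where f': "f = {x2, y2}" and n: "\<not> sim x1 y2" "\<not> sim y1 x2" by blast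
  have t: "sim p x1 \<and> sim p x2 \<and> \<not> sim p y1 \<and> \<not> sim p y2 \<or> sim p y1 \<and> sim p y2 \<and> \<not> sim p x1 \<and> \<not> sim p x2"
    if "p \<in> g" for p
    using third_edge_sim[of x1 y1 x2 y2 x3' y3' p] s that n by (auto simp: f' g)
  have "\<exists>x3 y3. g = {x3, y3} \<and> sim x3 x1 \<and> sim x3 x2 \<and> sim y3 y1 \<and> sim y3 y2"
  proof -
    have n1: "\<not> (sim x3' x1 \<and> sim y3' x1)"
      using same_not_both(1)[of x1 y1 x3' y3'] s(2) g by auto
    have n2: "\<not> (sim x3' y1 \<and> sim y3' y1)"
      using same_not_both(1)[of y1 x1 x3' y3'] s(2) g by (auto simp: insert_commute)
    note tx = t[of x3', unfolded g, simplified]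
    note ty = t[of y3', unfolded g, simplified]
    show ?thesis
    proof (cases "sim x3' x1")
      case True
      have "sim x3' x2 \<and> sim y3' y1 \<and> sim y3' y2" using True tx ty n1 by argo
      thus ?thesis using True g by blast
    next
      case False
      hence "sim x3' y1 \<and> sim x3' y2" "sim y3' x1 \<and> sim y3' x2" using tx ty n2 by argo+
      thus ?thesis by (intro exI[of _ y3'] exI[of _ x3']) (auto simp: g insert_commute)
    qed
  qed
  then obtain x3 y3 where g': "g = {x3, y3}" and
    z: "sim x3 x1" "sim x3 x2" "sim y3 y1" "sim y3 y2" by blast
  have U: "x1 \<in> U" "y1 \<in> U" "x2 \<in> U" "y2 \<in> U" "x3 \<in> U" "y3 \<in> U"
    using s f' g' grD(3)[of "{x1, y1}"] grD(3)[of f] grD(3)[of g] by (auto simp: same_def)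
  have d: "\<not> sim x1 y3" "\<not> sim x2 y3" "\<not> sim y1 x3" "\<not> sim y2 x3"
    using same_not_both[of x1 y1 x3 y3] same_not_both[of x2 y2 x3 y3] s z sim_sym f' g' by auto
  have "sim x1 x2" using three_sim[of x1 x2 y3] d U by blast
  moreover have "sim y1 y2" using three_sim[of y1 y2 x3] d U by blast
  ultimately show ?thesis using f' g' z sim_sym by blast
qed

text \<open>A fixed edge \<open>f1\<close> orients all others. Two further edges are compared
  through the triple that they form with \<open>f1\<close>.\<close>

lemma class_labels:
  assumes c3: "3 \<le> card K" and same: "\<And>f g. f \<in> K \<Longrightarrow> g \<in> K \<Longrightarrow> f \<noteq> g \<Longrightarrow> same f g"
  shows "\<exists>x y. (\<forall>f\<in>K. f = {x f, y f}) \<and>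
    (\<forall>f\<in>K. \<forall>g\<in>K. f \<noteq> g \<longrightarrow> sim (x f) (x g) \<and> sim (y f) (y g))"
proof -
  have third: "\<exists>h\<in>K. h \<noteq> f \<and> h \<noteq> g" for f g
  proof (rule ccontr)
    assume "\<not> ?thesis"
    hence "K \<subseteq> {f, g}" by blast
    hence "card K \<le> card {f, g}" by (intro card_mono) auto
    also have "\<dots> \<le> 2" by (simp add: card_insert_if)
    finally show False using c3 by simp
  qed
  obtain f1 where f1: "f1 \<in> K" using third by blast
  obtain f2 where f2: "f2 \<in> K" "f2 \<noteq> f1" using third by blast
  obtain a b where ab: "f1 = {a, b}" using same_labels_exist[OF same[OF f1 f2(1) f2(2)[symmetric]]] .
  have ex: "\<exists>z. g = {fst z, snd z} \<and> sim a (fst z) \<and> sim b (snd z)" if g: "g \<in> K" "g \<noteq> f1" for g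
  proof -
    obtain h where h: "h \<in> K" "h \<noteq> f1" "h \<noteq> g" using third by blast
    obtain x2 y2 where "g = {x2, y2}" "sim a x2" "sim b y2"
      using triple_labels[of a b g h] same f1 g h ab by metis
    thus ?thesis by (intro exI[of _ "(x2, y2)"]) auto
  qed
  define z where "z = (\<lambda>g. if g = f1 then (a, b) else SOME z. g = {fst z, snd z} \<and> sim a (fst z) \<and> sim b (snd z))"
  define x where "x = (\<lambda>g. fst (z g))"
  define y where "y = (\<lambda>g. snd (z g))"
  have zg: "g = {x g, y g} \<and> sim a (x g) \<and> sim b (y g)" if "g \<in> K" "g \<noteq> f1" for g
    using someI_ex[OF ex[OF that]] that by (simp add: x_def y_def z_def)
  have z1: "x f1 = a" "y f1 = b" by (auto simp: x_def y_def z_def)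
  have lab: "f = {x f, y f}" if "f \<in> K" for f using zg[OF that] ab z1 by metis
  have "sim (x f) (x g) \<and> sim (y f) (y g)" if fg: "f \<in> K" "g \<in> K" "f \<noteq> g" for f g
  proof (cases "f = f1 \<or> g = f1")
    case True
    thus ?thesis using zg[of f] zg[of g] fg z1 sim_sym by metis
  next
    case False
    obtain x2 y2 x3 y3 where t: "f = {x2, y2}" "g = {x3, y3}" "sim a x2" "sim b y2"
      "sim a x3" "sim b y3" "sim x2 x3" "sim y2 y3"
      using triple_labels[of a b f g] same f1 fg False ab by metis
    \<comment> \<open>The triple comes with labels of its own. They agree with the chosen ones,
      because only one end of an edge can be similar to \<open>a\<close>.\<close>
    have uniq: "x2 = x h \<and> y2 = y h" if "h \<in> K" "h \<noteq> f1" "h = {x2, y2}" "sim a x2" for h x2 y2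
    proof -
      have "same {a, b} {x h, y h}" using same[OF f1 that(1)] that ab lab[OF that(1)] by auto
      hence "\<not> sim (y h) a" using same_not_both(1)[of a b "x h" "y h"] zg[OF that(1,2)] sim_sym by blast
      hence "x2 \<noteq> y h" using that sim_sym by blast
      thus ?thesis using that lab[OF that(1)] by (auto simp: doubleton_eq_iff)
    qed
    show ?thesis using uniq[of f x2 y2] uniq[of g x3 y3] t fg False by auto
  qed
  thus ?thesis using lab by blast
qed

text \<open>\<open>I\<close> collects the vertices adjacent to two of the ends \<open>x f\<close>,
  and \<open>J\<close> those adjacent to two of the ends \<open>y f\<close>. Two vertices of
  \<open>I\<close> see ends of distinct edges of the class, so the conflict condition forbids an
  edge between them. A vertex in neither set sees at most one end on each side, and no vertex sees
  ends on both sides.\<close>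

lemma class_structure:
  assumes c3: "3 \<le> card K" and same: "\<And>f g. f \<in> K \<Longrightarrow> g \<in> K \<Longrightarrow> f \<noteq> g \<Longrightarrow> same f g"
  shows "\<exists>I J. independent_pair U E I J \<and>
     (\<forall>p\<in>U. (\<Sum>f\<in>K. card (f \<inter> nbr E p)) \<le> card K) \<and>
     (\<forall>p\<in>U - (I \<union> J). (\<Sum>f\<in>K. card (f \<inter> nbr E p)) \<le> 1)"
proof -
  have finK: "finite K" using c3 by (metis card.infinite not_numeral_le_zero)
  have "\<exists>x y. (\<forall>f\<in>K. f = {x f, y f}) \<and>
    (\<forall>f\<in>K. \<forall>g\<in>K. f \<noteq> g \<longrightarrow> sim (x f) (x g) \<and> sim (y f) (y g))"
    by (rule class_labels) (fact c3, fact same)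
  then obtain x y where xy: "\<forall>f\<in>K. f = {x f, y f}"
    "\<forall>f\<in>K. \<forall>g\<in>K. f \<noteq> g \<longrightarrow> sim (x f) (x g) \<and> sim (y f) (y g)"
    by (elim exE conjE)
  have lab: "f = {x f, y f}" if "f \<in> K" for f using xy(1) that by (rule bspec)
  have sm: "sim (x f) (x g) \<and> sim (y f) (y g)" if "f \<in> K" "g \<in> K" "f \<noteq> g" for f g
    using xy(2) that by simp
  have same': "same {x f, y f} {x g, y g}" if "f \<in> K" "g \<in> K" "f \<noteq> g" for f g
    using same[OF that] lab that by simp
  have parX: "{p, q} \<notin> E" if "f \<in> K" "g \<in> K" "f \<noteq> g" "{x f, p} \<in> E" "{x g, q} \<in> E" for f g p q
    using sim_parallel[of "y f" "x f" "y g" "x g" p q] same'[OF that(1-3)] sm[OF that(1-3)] that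
    by (auto simp: insert_commute)
  have parY: "{p, q} \<notin> E" if "f \<in> K" "g \<in> K" "f \<noteq> g" "{y f, p} \<in> E" "{y g, q} \<in> E" for f g p q
    using sim_parallel[of "x f" "y f" "x g" "y g" p q] same'[OF that(1-3)] sm[OF that(1-3)] that by auto
  have disj: "nbr E (x f) \<inter> nbr E (y g) = {}" if "f \<in> K" "g \<in> K" "f \<noteq> g" for f g
    using sim_disjoint(1)[OF same'[OF that]] sm[OF that] by blast
  have inU: "x f \<in> U" "y f \<in> U" if "f \<in> K" for f
  proof -
    have "f \<in> E"
    proof -
      have "\<exists>g\<in>K. g \<noteq> f"
      proof (rule ccontr)
        assume "\<not> ?thesis"
        hence "K \<subseteq> {f}" by blast
        hence "card K \<le> card {f}" by (intro card_mono) auto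
        thus False using c3 by simp
      qed
      then obtain g where "g \<in> K" "g \<noteq> f" by blast
      thus ?thesis using same[OF that, of g] by (auto simp: same_def)
    qed
    thus "x f \<in> U" "y f \<in> U" using lab[OF that] grD(3)[of f] by auto
  qed
  \<comment> \<open>The two ends of one and the same edge need a separate argument. A common
    neighbour \<open>p\<close> of them would give, with two further edges of the class, three
    vertices \<open>p\<close>, \<open>x g\<close>, \<open>y h\<close> without a similar pair; this
    is where at least three edges are required.\<close>
  have disj': "nbr E (x f) \<inter> nbr E (y f) = {}" if f: "f \<in> K" for f
  proof (rule ccontr)
    assume "\<not> ?thesis"
    then obtain p where p: "{x f, p} \<in> E" "{y f, p} \<in> E" by auto
    have "\<exists>g h. g \<in> K \<and> h \<in> K \<and> g \<noteq> f \<and> h \<noteq> f \<and> g \<noteq> h"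
    proof -
      have "2 \<le> card (K - {f})" using c3 f finK by simp
      then obtain g h where "g \<in> K - {f}" "h \<in> K - {f}" "g \<noteq> h"
        using card_le_Suc0_iff_eq[of "K - {f}"] finK by fastforce
      thus ?thesis by blast
    qed
    then obtain g h where gh: "g \<in> K" "h \<in> K" "g \<noteq> f" "h \<noteq> f" "g \<noteq> h" by blast
    have "nbr E p \<inter> nbr E (x g) = {}"
      using parX[OF f gh(1) gh(3)[symmetric] p(1)] by auto
    moreover have "nbr E p \<inter> nbr E (y h) = {}"
      using parY[OF f gh(2) gh(4)[symmetric] p(2)] by auto
    moreover have "nbr E (x g) \<inter> nbr E (y h) = {}" using disj gh by blast
    moreover have "p \<in> U" using p grD by blast
    ultimately show False
      using three_sim[of p "x g" "y h"] inU gh not_sim_if_disjoint by blast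
  qed
  have dj: "nbr E (x f) \<inter> nbr E (y g) = {}" if "f \<in> K" "g \<in> K" for f g
    using disj disj' that by (cases "f = g") auto
  define I where "I = {p \<in> U. \<exists>f\<in>K. \<exists>g\<in>K. f \<noteq> g \<and> {x f, p} \<in> E \<and> {x g, p} \<in> E}"
  define J where "J = {p \<in> U. \<exists>f\<in>K. \<exists>g\<in>K. f \<noteq> g \<and> {y f, p} \<in> E \<and> {y g, p} \<in> E}"
  have I: "{p, q} \<notin> E" if pI: "p \<in> I" and qI: "q \<in> I" for p q
  proof -
    obtain f where f: "f \<in> K" "{x f, p} \<in> E" using pI by (auto simp: I_def)
    obtain g where "g \<in> K" "g \<noteq> f" "{x g, q} \<in> E" using qI by (auto simp: I_def)
    thus ?thesis using parX[of f g p q] f by blast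
  qed
  have J: "{p, q} \<notin> E" if pJ: "p \<in> J" and qJ: "q \<in> J" for p q
  proof -
    obtain f where f: "f \<in> K" "{y f, p} \<in> E" using pJ by (auto simp: J_def)
    obtain g where "g \<in> K" "g \<noteq> f" "{y g, q} \<in> E" using qJ by (auto simp: J_def)
    thus ?thesis using parY[of f g p q] f by blast
  qed
  have IJ: "I \<inter> J = {}"
  proof -
    have False if pI: "p \<in> I" and pJ: "p \<in> J" for p
    proof -
      obtain f where "f \<in> K" "{x f, p} \<in> E" using pI by (auto simp: I_def)
      moreover obtain g where "g \<in> K" "{y g, p} \<in> E" using pJ by (auto simp: J_def)
      ultimately show False using dj[of f g] by auto
    qed
    thus ?thesis by blast
  qed
  have cnt: "card (f \<inter> nbr E p) = (if {x f, p} \<in> E \<or> {y f, p} \<in> E then 1 else 0)" if f: "f \<in> K" for f p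
  proof -
    have "f \<inter> nbr E p = {v. (v = x f \<or> v = y f) \<and> {v, p} \<in> E}"
      using lab[OF f] by (auto simp: insert_commute)
    moreover have "\<not> ({x f, p} \<in> E \<and> {y f, p} \<in> E)" using disj'[OF f] by auto
    ultimately have "f \<inter> nbr E p = (if {x f, p} \<in> E then {x f} else if {y f, p} \<in> E then {y f} else {})"
      by auto
    thus ?thesis by auto
  qed
  have le: "(\<Sum>f\<in>K. card (f \<inter> nbr E p)) \<le> card K" for p
  proof -
    have "(\<Sum>f\<in>K. card (f \<inter> nbr E p)) \<le> (\<Sum>f\<in>K. 1)" by (intro sum_mono) (auto simp: cnt)
    thus ?thesis by simp
  qed
  have le1: "(\<Sum>f\<in>K. card (f \<inter> nbr E p)) \<le> 1" if p: "p \<in> U - (I \<union> J)" for p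
  proof -
    have "(\<Sum>f\<in>K. card (f \<inter> nbr E p)) = (\<Sum>f\<in>K. if {x f, p} \<in> E \<or> {y f, p} \<in> E then 1 else 0)"
      by (rule sum.cong[OF refl cnt])
    also have "\<dots> = card {f \<in> K. {x f, p} \<in> E \<or> {y f, p} \<in> E}"
      using finK by (simp add: sum.If_cases Int_def)
    also have "\<dots> \<le> 1"
    proof -
      have "f = g" if fg: "f \<in> K" "g \<in> K" "{x f, p} \<in> E \<or> {y f, p} \<in> E" "{x g, p} \<in> E \<or> {y g, p} \<in> E" for f g
      proof (rule ccontr)
        assume ne: "f \<noteq> g"
        show False
          using fg ne p dj[of f g] dj[of g f] by (auto simp: I_def J_def)
      qed
      thus ?thesis using finK by (simp add: card_le_Suc0_iff_eq)
    qed
    finally show ?thesis .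
  qed
  have "I \<subseteq> U" "J \<subseteq> U" by (auto simp: I_def J_def)
  hence "independent_pair U E I J" using I J IJ by (simp add: independent_pair_def)
  thus ?thesis
    by (intro exI[of _ I] exI[of _ J] conjI ballI) (assumption | rule le | erule le1)+
qed

text \<open>The conflict condition applies with \<open>p\<close> itself as the common neighbour: if
  \<open>p\<close> sees both ends \<open>a\<close>, \<open>b\<close> of one edge and an end
  \<open>x\<close> of the other edge \<open>x y\<close>, then \<open>p x\<close> joins a neighbour
  of \<open>b\<close> to a neighbour of \<open>y\<close>. This breaks down only if \<open>p\<close>
  is an end of one of the two edges, at the cost of one incidence.\<close>

lemma pair_count:
  assumes "same f g"
  shows "card (f \<inter> nbr E p) + card (g \<inter> nbr E p) \<le> 2 + (if p \<in> f \<union> g then 1 else 0)"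
proof -
  have fg: "f \<in> E" "g \<in> E" using assms by (auto simp: same_def)
  have le2: "card (h \<inter> nbr E p) \<le> 2" if "h \<in> E" for h
    using card_mono[of h "h \<inter> nbr E p"] grD(4)[OF that]
    by (metis Int_lower1 card_eq_0_iff zero_neq_numeral)
  have key: "p \<in> f \<union> g" if h: "same h h'" "card (h \<inter> nbr E p) = 2" "h' \<inter> nbr E p \<noteq> {}" "h \<union> h' = f \<union> g" for h h'
  proof (rule ccontr)
    assume np: "p \<notin> f \<union> g"
    obtain a b where ab: "h = {a, b}" using same_labels_exist[OF h(1)] .
    obtain x where x: "x \<in> h'" "{p, x} \<in> E" using h(3) by auto
    obtain y where y: "h' = {x, y}" using same_labels_exist[OF same_sym[OF h(1)]] x(1) by (metis insert_commute insert_iff singletonD)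
    have "finite h" "card h = 2" using grD(4)[of h] h(1) by (auto simp: same_def card_ge_0_finite)
    hence "h \<inter> nbr E p = h" using h(2) by (intro card_subset_eq) auto
    hence pa: "{p, a} \<in> E" "{p, b} \<in> E" using ab by auto
    have ne: "p \<noteq> b" "p \<noteq> y" using np h(4) ab y by auto
    have "{a, b} \<in> E" "{x, y} \<in> E" "{a, b} \<noteq> {x, y}" "c {a, b} = c {x, y}"
      using h(1) ab y by (auto simp: same_def)
    hence "{p, x} \<notin> E"
      using conflict[of a b x y p p x] pa x ne by (auto simp: insert_commute)
    thus False using x by simp
  qed
  have notin: "card (h \<inter> nbr E p) \<le> 1" if hp: "h \<in> E" "p \<in> h" for h
  proof -
    obtain a where "h = {p, a}" using grD(4)[OF hp(1)] hp(2) by (auto simp: card_2_iff insert_commute)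
    moreover have "{p, p} \<notin> E" using grD(5) by blast
    ultimately have "h \<inter> nbr E p \<subseteq> {a}" by auto
    thus ?thesis by (metis card_mono finite.emptyI finite_insert is_singletonI is_singleton_altdef)
  qed
  show ?thesis
  proof (cases "p \<in> f \<union> g")
    case True
    thus ?thesis using notin[of f] notin[of g] le2[of f] le2[of g] fg by auto
  next
    case False
    have 1: "g \<inter> nbr E p = {}" if "card (f \<inter> nbr E p) = 2" using key[of f g] that assms False by blast
    have 2: "f \<inter> nbr E p = {}" if "card (g \<inter> nbr E p) = 2"
      using key[of g f] that same_sym[OF assms] False by blast
    have "card (f \<inter> nbr E p) = 2 \<or> card (g \<inter> nbr E p) = 2 \<or> card (f \<inter> nbr E p) \<le> 1 \<and> card (g \<inter> nbr E p) \<le> 1"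
      using le2[OF fg(1)] le2[OF fg(2)] by linarith
    thus ?thesis
    proof (elim disjE conjE)
      assume "card (f \<inter> nbr E p) = 2"
      thus ?thesis using 1 by auto
    next
      assume "card (g \<inter> nbr E p) = 2"
      thus ?thesis using 2 by auto
    next
      assume "card (f \<inter> nbr E p) \<le> 1" "card (g \<inter> nbr E p) \<le> 1"
      thus ?thesis by linarith
    qed
  qed
qed

end

subsection \<open>Counting colours\<close>

text \<open>
  Here \<open>B\<close> is the set of colours used on at least three edges, \<open>w j + 2\<close> the size of a class, \<open>\<rho>\<close> the number
  of uniquely coloured edges; \<open>\<delta> j\<close> and \<open>\<kappa> j\<close> are sums of degrees outside of the two independent sets of \<open>j\<close>.
\<close>

lemma weight_or_excess:
  fixes e m \<rho> X \<eta> :: real and w \<kappa> \<delta> :: "'b \<Rightarrow> real"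
  assumes \<eta>: "0 < \<eta>" "\<eta> \<le> 1" and m: "m > 0" "17 < m * \<eta> ^ 2" and e: "(1 - \<eta> ^ 2 / 2) * m ^ 2 \<le> 4 * e" "2 * e \<le> m ^ 2"
    and \<rho>: "0 \<le> \<rho>" and B: "finite B" "X = sum w B" "\<And>j. j \<in> B \<Longrightarrow> 0 \<le> w j"
    and \<kappa>: "\<And>j. j \<in> B \<Longrightarrow> 0 \<le> \<kappa> j" "\<And>j. j \<in> B \<Longrightarrow> \<kappa> j \<le> \<delta> j"
    and empty: "B = {} \<Longrightarrow> 8 * e ^ 3 / m ^ 2 - 2 * e ^ 2 - 4 * e * m \<le> 2 * \<rho> ^ 2"
    and main: "\<And>i. i \<in> B \<Longrightarrow> 8 * e ^ 3 / m ^ 2 - 2 * e ^ 2 - 4 * e * m + (\<Sum>j\<in>B. w j * (\<delta> j + \<kappa> j))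
      \<le> 2 * \<rho> * \<kappa> i - \<kappa> i ^ 2 / 2"
    and large: "\<And>j. j \<in> B \<Longrightarrow> \<eta> * m ^ 2 \<le> \<delta> j"
  shows "2 * e - m ^ 2 / 2 - \<eta> * m ^ 2 \<le> \<rho> - X"
proof (rule ccontr)
  define s where "s = \<rho> - X"
  define g where "g = 4 * e - m ^ 2"
  define \<Delta> where "\<Delta> = 8 * e ^ 3 / m ^ 2 - 2 * e ^ 2 - 4 * e * m"
  assume "\<not> ?thesis"
  hence s: "s < g / 2 - \<eta> * m ^ 2" by (simp add: s_def g_def diff_divide_distrib)
  have "\<eta> ^ 2 \<le> 1" using \<eta> by (simp add: power_le_one)
  hence "0 \<le> (1 - \<eta> ^ 2 / 2) * m ^ 2" by simp
  hence e0: "0 \<le> e" using e by linarith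
  have \<Delta>: "\<Delta> = 2 * e ^ 2 * g / m ^ 2 - 4 * e * m"
    using m by (simp add: \<Delta>_def g_def field_simps power2_eq_square power3_eq_cube)
  have em: "4 * e * m \<le> 2 * m ^ 3"
  proof -
    have "2 * e * (2 * m) \<le> m ^ 2 * (2 * m)" using e m by (intro mult_right_mono) auto
    thus ?thesis by (simp add: power2_eq_square power3_eq_cube)
  qed
  \<comment> \<open>The error \<open>4 e m\<close> is at most \<open>2 m^3\<close>. The strictest
    demand is that \<open>\<eta> m^4 / 8\<close> exceed it when \<open>\<Delta>\<close> is shown to
    be positive, which takes a factor above 16.\<close>
  have m3: "17 * m ^ 3 \<le> \<eta> ^ 2 * m ^ 4"
  proof -
    have "17 * m ^ 3 \<le> (m * \<eta> ^ 2) * m ^ 3" using m by (intro mult_right_mono) auto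
    thus ?thesis by (simp add: power2_eq_square power3_eq_cube power4_eq_xxxx mult_ac)
  qed
  have m3': "17 * m ^ 3 \<le> \<eta> * m ^ 4"
  proof -
    have "\<eta> ^ 2 \<le> \<eta>" using \<eta> by (simp add: power2_eq_square mult_left_le)
    hence "\<eta> ^ 2 * m ^ 4 \<le> \<eta> * m ^ 4" by (intro mult_right_mono) auto
    thus ?thesis using m3 by linarith
  qed
  have mp: "m ^ 3 > 0" using m by simp
  have quad: "\<Delta> \<le> 2 * s ^ 2" and neg: "s < 0 \<Longrightarrow> - s * (\<eta> * m ^ 2) \<le> - \<Delta>"
  proof -
    have "\<Delta> \<le> 2 * s ^ 2 \<and> (s < 0 \<longrightarrow> - s * (\<eta> * m ^ 2) \<le> - \<Delta>)"
    proof (cases "B = {}")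
      case True
      hence "X = 0" using B by simp
      thus ?thesis using empty[OF True] True \<rho> by (simp add: s_def \<Delta>_def)
    next
      case False
      then obtain i where i: "i \<in> B" "\<And>j. j \<in> B \<Longrightarrow> \<kappa> i \<le> \<kappa> j"
        using B(1) by (metis arg_min_if_finite(1) arg_min_least)
      define \<kappa>i where "\<kappa>i = \<kappa> i"
      \<comment> \<open>By minimality of \<open>\<kappa> i\<close>, the weighted sum is at least
        \<open>X * (M + \<kappa>i)\<close>. The bound \<open>\<kappa>i \<le> M\<close> is enough for
        \<open>\<Delta> \<le> 2 s^2\<close>; for negative \<open>s\<close> the other entry of the
        maximum makes \<open>s * M\<close> sufficiently negative.\<close>
      define M where "M = max \<kappa>i (\<eta> * m ^ 2)"
      have X0: "0 \<le> X" unfolding B(2) by (intro sum_nonneg B(3))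
      have "(\<Sum>j\<in>B. w j * (M + \<kappa>i)) \<le> (\<Sum>j\<in>B. w j * (\<delta> j + \<kappa> j))"
      proof (intro sum_mono mult_left_mono add_mono)
        fix j assume j: "j \<in> B"
        show "\<kappa>i \<le> \<kappa> j" using i(2)[OF j] by (simp add: \<kappa>i_def)
        thus "M \<le> \<delta> j" using \<kappa>(2)[OF j] large[OF j] by (simp add: M_def)
      qed (use B(3) in auto)
      hence main': "\<Delta> + X * (M + \<kappa>i) \<le> 2 * \<rho> * \<kappa>i - \<kappa>i ^ 2 / 2"
        using main[OF i(1)] by (simp add: \<Delta>_def B(2) sum_distrib_right \<kappa>i_def)
      have \<kappa>0: "0 \<le> \<kappa>i" using \<kappa>(1)[OF i(1)] by (simp add: \<kappa>i_def)
      have M: "\<kappa>i \<le> M" "\<eta> * m ^ 2 \<le> M" by (auto simp: M_def)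
      have "X * \<kappa>i \<le> X * M" using X0 M by (intro mult_left_mono)
      hence a: "\<Delta> \<le> 2 * s * \<kappa>i - \<kappa>i ^ 2 / 2" using main' by (simp add: s_def algebra_simps)
      have "0 \<le> (2 * s - \<kappa>i) ^ 2 / 2" by simp
      hence "2 * s * \<kappa>i - \<kappa>i ^ 2 / 2 \<le> 2 * s ^ 2" by (simp add: power2_eq_square algebra_simps)
      hence 1: "\<Delta> \<le> 2 * s ^ 2" using a by linarith
      have 2: "- s * (\<eta> * m ^ 2) \<le> - \<Delta>" if "s < 0"
      proof -
        have "\<rho> * \<kappa>i \<le> \<rho> * M" using \<rho> M by (intro mult_left_mono)
        moreover have "s * \<kappa>i \<le> 0" using that \<kappa>0 by (simp add: mult_nonpos_nonneg)
        moreover have "\<Delta> + X * M + X * \<kappa>i \<le> 2 * (\<rho> * \<kappa>i) - \<kappa>i ^ 2 / 2"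
          using main' by (simp add: algebra_simps)
        moreover have "s * \<kappa>i = \<rho> * \<kappa>i - X * \<kappa>i" "s * M = \<rho> * M - X * M"
          by (simp_all add: s_def left_diff_distrib)
        ultimately have "\<Delta> \<le> s * M" using zero_le_power2[of \<kappa>i] by linarith
        also have "s * M \<le> s * (\<eta> * m ^ 2)" using M that by (intro mult_left_mono_neg) auto
        finally show ?thesis by simp
      qed
      show ?thesis using 1 2 by blast
    qed
    thus "\<Delta> \<le> 2 * s ^ 2" "s < 0 \<Longrightarrow> - s * (\<eta> * m ^ 2) \<le> - \<Delta>" by auto
  qed
  \<comment> \<open>If \<open>g\<close> is clearly positive, the walk count makes
    \<open>\<Delta>\<close> positive and the quadratic bound decides. Otherwise \<open>s\<close> is
    clearly negative and the linear bound decides.\<close>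
  show False
  proof (cases "\<eta> * m ^ 2 \<le> g")
    case True
    have "0 \<le> \<eta> * m ^ 2" using \<eta> by simp
    hence "m ^ 2 / 4 \<le> e" using True by (simp add: g_def)
    hence "(m ^ 2 / 4) ^ 2 \<le> e ^ 2" using m by (intro power_mono) auto
    hence "2 * (m ^ 2 / 4) ^ 2 * (\<eta> * m ^ 2) \<le> 2 * e ^ 2 * g"
      using True \<eta> by (intro mult_mono) auto
    hence "2 * (m ^ 2 / 4) ^ 2 * (\<eta> * m ^ 2) / m ^ 2 \<le> 2 * e ^ 2 * g / m ^ 2"
      by (intro divide_right_mono) auto
    moreover have "2 * (m ^ 2 / 4) ^ 2 * (\<eta> * m ^ 2) / m ^ 2 = \<eta> * m ^ 4 / 8"
      using m by (simp add: field_simps power2_eq_square power4_eq_xxxx)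
    ultimately have "0 < \<Delta>" using \<Delta> em m3' mp by linarith
    have spos: "0 \<le> s"
    proof (rule ccontr)
      assume n: "\<not> 0 \<le> s"
      hence "0 \<le> - s * (\<eta> * m ^ 2)" using \<eta> by (intro mult_nonneg_nonneg) auto
      thus False using neg n \<open>0 < \<Delta>\<close> by linarith
    qed
    have "s ^ 2 \<le> (g / 2 - \<eta> * m ^ 2) ^ 2" using spos s by (intro power_mono) auto
    also have "\<dots> = g ^ 2 / 4 - \<eta> * m ^ 2 * (g - \<eta> * m ^ 2)"
      by (simp add: power2_eq_square algebra_simps add_divide_distrib diff_divide_distrib)
    also have "\<dots> \<le> g ^ 2 / 4 - \<eta> * m ^ 2 * (\<eta> * m ^ 2)"
    proof -
      have "0 < g / 2 - \<eta> * m ^ 2" using spos s by linarith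
      hence "\<eta> * m ^ 2 * (\<eta> * m ^ 2) \<le> \<eta> * m ^ 2 * (g - \<eta> * m ^ 2)"
        using \<eta> by (intro mult_left_mono) auto
      thus ?thesis by linarith
    qed
    also have "\<eta> * m ^ 2 * (\<eta> * m ^ 2) = \<eta> ^ 2 * m ^ 4" by (simp add: power2_eq_square power4_eq_xxxx)
    finally have s2: "s ^ 2 \<le> g ^ 2 / 4 - \<eta> ^ 2 * m ^ 4" .
    \<comment> \<open>The square of \<open>2 e - m^2\<close> is nonnegative; hence the main term of
      \<open>\<Delta>\<close> is at least \<open>g^2 / 2\<close>, which is just what
      \<open>2 s^2\<close> cannot reach when \<open>s\<close> is below \<open>g / 2\<close> by a
      margin.\<close>
    have "g * m ^ 2 \<le> 4 * e ^ 2"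
      using zero_le_power2[of "2 * e - m ^ 2"] by (simp add: g_def power2_eq_square algebra_simps)
    hence "g \<le> 4 * e ^ 2 / m ^ 2" using m by (simp add: pos_le_divide_eq)
    hence "g * (g / 2) \<le> 4 * e ^ 2 / m ^ 2 * (g / 2)"
      using order_trans[OF \<open>0 \<le> \<eta> * m ^ 2\<close> True] by (intro mult_right_mono) auto
    hence "g ^ 2 / 2 \<le> 2 * e ^ 2 * g / m ^ 2" by (simp add: power2_eq_square)
    thus False using quad s2 \<Delta> em m3 mp by linarith
  next
    case False
    have s': "s < - (\<eta> * m ^ 2) / 2" using False s by linarith
    have "0 \<le> \<eta> * m ^ 2" using \<eta> by simp
    hence "s < 0" using s' by linarith
    have "\<eta> * m ^ 2 / 2 * (\<eta> * m ^ 2) \<le> - s * (\<eta> * m ^ 2)"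
      using s' \<open>0 \<le> \<eta> * m ^ 2\<close> by (intro mult_right_mono) auto
    also have "\<dots> \<le> - \<Delta>" using neg[OF \<open>s < 0\<close>] .
    finally have 1: "\<eta> ^ 2 * m ^ 4 / 2 \<le> - \<Delta>" by (simp add: power2_eq_square power4_eq_xxxx mult_ac)
    have "- g \<le> \<eta> ^ 2 / 2 * m ^ 2" using e by (simp add: g_def algebra_simps)
    hence "2 * e ^ 2 * (- g) \<le> 2 * e ^ 2 * (\<eta> ^ 2 / 2 * m ^ 2)" by (intro mult_left_mono) auto
    hence "2 * e ^ 2 * (- g) / m ^ 2 \<le> 2 * e ^ 2 * (\<eta> ^ 2 / 2 * m ^ 2) / m ^ 2"
      by (intro divide_right_mono) auto
    hence 2: "- (2 * e ^ 2 * g / m ^ 2) \<le> e ^ 2 * \<eta> ^ 2" using m by simp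
    have "(2 * e) ^ 2 \<le> (m ^ 2) ^ 2" using e e0 by (intro power_mono) auto
    hence "e ^ 2 \<le> m ^ 4 / 4" by (simp add: power2_eq_square power4_eq_xxxx)
    hence "e ^ 2 * \<eta> ^ 2 \<le> m ^ 4 / 4 * \<eta> ^ 2" by (intro mult_right_mono) auto
    hence 3: "e ^ 2 * \<eta> ^ 2 \<le> \<eta> ^ 2 * m ^ 4 / 4" by (simp add: mult.commute)
    show False using 1 2 3 \<Delta> em m3 mp by linarith
  qed
qed

section \<open>Colour classes by their size\<close>

context conflict_graph
begin

definition cls :: "nat \<Rightarrow> 'a set set" where "cls j = {f \<in> E. c f = j}"
definition big :: "nat set" where "big = {j \<in> c ` E. 3 \<le> card (cls j)}"
definition uniq :: "'a set set" where "uniq = {f \<in> E. card (cls (c f)) = 1}"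

lemma cls_same: "f \<in> cls j \<Longrightarrow> g \<in> cls j \<Longrightarrow> f \<noteq> g \<Longrightarrow> same f g"
  by (auto simp: cls_def same_def)

lemma finite_cls [simp]: "finite (cls j)" by (simp add: cls_def grD(2))

lemma finite_big [simp]: "finite big" by (simp add: big_def grD(2))

lemma nonuniq_cls: "j \<in> c ` (E - uniq) \<Longrightarrow> {f \<in> E - uniq. c f = j} = cls j \<and> 2 \<le> card (cls j)"
proof -
  assume "j \<in> c ` (E - uniq)"
  then obtain f where f: "f \<in> E" "f \<notin> uniq" "j = c f" by auto
  have "card (cls j) \<noteq> 0" using f finite_cls by (auto simp: cls_def)
  moreover have "card (cls j) \<noteq> 1" using f by (simp add: uniq_def)
  moreover have "g \<notin> uniq" if "g \<in> cls j" for g using that f by (auto simp: uniq_def cls_def)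
  ultimately show ?thesis by (auto simp: cls_def)
qed

lemma sum_nonuniq: "(\<Sum>f\<in>E - uniq. F f) = (\<Sum>j\<in>c ` (E - uniq). \<Sum>f\<in>cls j. F f)" for F :: "_ \<Rightarrow> nat"
proof -
  have "(\<Sum>f\<in>E - uniq. F f) = (\<Sum>j\<in>c ` (E - uniq). \<Sum>f | f \<in> E - uniq \<and> c f = j. F f)"
    by (rule sum.image_gen) (simp add: grD(2))
  also have "\<dots> = (\<Sum>j\<in>c ` (E - uniq). \<Sum>f\<in>cls j. F f)"
    by (rule sum.cong[OF refl]) (use nonuniq_cls in simp)
  finally show ?thesis .
qed

lemma uniq_subset: "uniq \<subseteq> E" by (auto simp: uniq_def)

lemma big_subset: "big \<subseteq> c ` (E - uniq)"
  by (auto simp: big_def uniq_def)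

lemma card_nonuniq: "(\<Sum>j\<in>c ` (E - uniq). real (card (cls j))) = real (card E) - real (card uniq)"
proof -
  have "card (E - uniq) = (\<Sum>j\<in>c ` (E - uniq). card (cls j))" using sum_nonuniq[of "\<lambda>_. 1"] by simp
  moreover have "card (E - uniq) + card uniq = card E"
    using uniq_subset grD(2) by (metis add.commute card_Diff_subset card_mono finite_subset le_add_diff_inverse)
  ultimately show ?thesis by (simp flip: of_nat_sum)
qed

text \<open>A class of \<open>s \<ge> 2\<close> edges is counted twice as
  \<open>s - (s - 2)\<close>, so classes of two edges need no correction. A uniquely coloured edge
  is counted once in \<open>card E\<close> and once in \<open>card uniq\<close>.\<close>

lemma colour_count:
  "2 * real (card (c ` E)) = real (card E) + real (card uniq) - (\<Sum>j\<in>big. real (card (cls j)) - 2)"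
proof -
  have fin: "finite E" "finite uniq" using grD(2) uniq_subset finite_subset by auto
  have inj: "inj_on c uniq"
  proof (rule inj_onI)
    fix f g assume fg: "f \<in> uniq" "g \<in> uniq" "c f = c g"
    then obtain h where "cls (c f) = {h}" by (auto simp: uniq_def card_1_singleton_iff)
    moreover have "f \<in> cls (c f)" "g \<in> cls (c f)" using fg by (auto simp: uniq_def cls_def)
    ultimately show "f = g" by auto
  qed
  have "c ` E = c ` uniq \<union> c ` (E - uniq)" using uniq_subset by auto
  moreover have "c ` uniq \<inter> c ` (E - uniq) = {}" by (auto simp: uniq_def)
  ultimately have cE: "card (c ` E) = card uniq + card (c ` (E - uniq))"
    using card_Un_disjoint[of "c ` uniq" "c ` (E - uniq)"] fin by (simp add: card_image[OF inj])
  have "(\<Sum>j\<in>big. real (card (cls j)) - 2) = (\<Sum>j\<in>c ` (E - uniq). real (card (cls j)) - 2)"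
  proof (rule sum.mono_neutral_left)
    show "\<forall>j\<in>c ` (E - uniq) - big. real (card (cls j)) - 2 = 0"
    proof
      fix j assume j: "j \<in> c ` (E - uniq) - big"
      hence "2 \<le> card (cls j)" using nonuniq_cls[of j] by blast
      moreover have "card (cls j) < 3" using j by (auto simp: big_def)
      ultimately have "card (cls j) = 2" by simp
      thus "real (card (cls j)) - 2 = 0" by simp
    qed
  qed (use fin big_subset in auto)
  hence "(\<Sum>j\<in>big. real (card (cls j)) - 2) = real (card E) - real (card uniq) - 2 * real (card (c ` (E - uniq)))"
    using card_nonuniq by (simp add: sum_subtractf)
  thus ?thesis using cE by simp
qed

lemma incident_nonuniq: "p \<in> U \<Longrightarrow> real (card {f \<in> E - uniq. p \<in> f}) = real (card (nbr E p)) - real (card {f \<in> uniq. p \<in> f})"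
proof -
  assume "p \<in> U"
  have "{f \<in> E. p \<in> f} = {f \<in> E - uniq. p \<in> f} \<union> {f \<in> uniq. p \<in> f}" using uniq_subset by auto
  moreover have "card ({f \<in> E - uniq. p \<in> f} \<union> {f \<in> uniq. p \<in> f}) = card {f \<in> E - uniq. p \<in> f} + card {f \<in> uniq. p \<in> f}"
    using grD(2) uniq_subset finite_subset[of uniq E] by (intro card_Un_disjoint) auto
  ultimately show ?thesis using card_incident[OF gr, of p] by simp
qed

text \<open>The left side counts incidences of edges outside \<open>uniq\<close> with
  \<open>nbr E p\<close>. A class contributes at most its size, and at most 2 if it is big and
  \<open>p\<close> lies in its outer set \<open>Ou j\<close>. A class of two edges may exceed its
  size by one, but only if one of its edges contains \<open>p\<close>, and at most
  \<open>card (nbr E p)\<close> colours occur at \<open>p\<close>.\<close>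

lemma row_bound:
  assumes p: "p \<in> U"
    and le: "\<And>j. j \<in> big \<Longrightarrow> (\<Sum>f\<in>cls j. card (f \<inter> nbr E p)) \<le> card (cls j)"
    and le1: "\<And>j. j \<in> big \<Longrightarrow> p \<in> Ou j \<Longrightarrow> (\<Sum>f\<in>cls j. card (f \<inter> nbr E p)) \<le> 1"
  shows "(\<Sum>q\<in>nbr E p. real (card (nbr E q)) - real (card {f \<in> uniq. q \<in> f})) \<le>
    real (card E) - real (card uniq) - (\<Sum>j\<in>big. if p \<in> Ou j then real (card (cls j)) - 2 else 0) + real (card (nbr E p))"
proof -
  have fin: "finite E" "finite uniq" using grD(2) uniq_subset finite_subset by auto
  have "(\<Sum>q\<in>nbr E p. real (card (nbr E q)) - real (card {f \<in> uniq. q \<in> f})) =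
      real (\<Sum>q\<in>nbr E p. card {f \<in> E - uniq. q \<in> f})"
  proof -
    have "q \<in> U" if "q \<in> nbr E p" for q using that grD(8) by blast
    thus ?thesis unfolding of_nat_sum by (intro sum.cong refl incident_nonuniq[symmetric])
  qed
  also have "(\<Sum>q\<in>nbr E p. card {f \<in> E - uniq. q \<in> f}) = (\<Sum>f\<in>E - uniq. card (f \<inter> nbr E p))"
    by (rule sum_incident[OF gr]) (use grD in auto)
  also have "\<dots> = (\<Sum>j\<in>c ` (E - uniq). \<Sum>f\<in>cls j. card (f \<inter> nbr E p))" by (rule sum_nonuniq)
  also have "real \<dots> \<le> (\<Sum>j\<in>c ` (E - uniq). real (card (cls j)) + (if j \<in> c ` {f \<in> E. p \<in> f} then 1 else 0)
      - (if j \<in> big \<and> p \<in> Ou j then real (card (cls j)) - 2 else 0))"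
    unfolding of_nat_sum[of _ "c ` (E - uniq)"]
  proof (rule sum_mono)
    fix j assume j: "j \<in> c ` (E - uniq)"
    show "real (\<Sum>f\<in>cls j. card (f \<inter> nbr E p)) \<le> real (card (cls j)) + (if j \<in> c ` {f \<in> E. p \<in> f} then 1 else 0)
      - (if j \<in> big \<and> p \<in> Ou j then real (card (cls j)) - 2 else 0)"
    proof (cases "j \<in> big")
      case True
      show ?thesis
      proof (cases "p \<in> Ou j")
        case pO: True
        have "real (\<Sum>f\<in>cls j. card (f \<inter> nbr E p)) \<le> 1" using le1[OF True pO] by linarith
        thus ?thesis using True pO by simp
      next
        case False
        have "real (\<Sum>f\<in>cls j. card (f \<inter> nbr E p)) \<le> real (card (cls j))" using le[OF True] by linarith
        thus ?thesis using False by simp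
      qed
    next
      case False
      have "2 \<le> card (cls j)" using nonuniq_cls[OF j] by blast
      moreover have "j \<in> c ` E" using j by auto
      ultimately have c2: "card (cls j) = 2" using False by (auto simp: big_def)
      then obtain f g where fg: "cls j = {f, g}" "f \<noteq> g" by (meson card_2_iff)
      have "card (f \<inter> nbr E p) + card (g \<inter> nbr E p) \<le> 2 + (if p \<in> f \<union> g then 1 else 0)"
        by (rule pair_count[OF cls_same[of f j g]]) (use fg in auto)
      moreover have "j \<in> c ` {f \<in> E. p \<in> f}" if "p \<in> f \<union> g"
      proof -
        have "f \<in> E" "g \<in> E" "c f = j" "c g = j" using fg(1) by (auto simp: cls_def)
        thus ?thesis using that by (auto intro: rev_image_eqI)
      qed
      ultimately show ?thesis using fg False c2 by (auto split: if_splits)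
    qed
  qed
  also have "\<dots> = (\<Sum>j\<in>c ` (E - uniq). real (card (cls j))) + (\<Sum>j\<in>c ` (E - uniq). if j \<in> c ` {f \<in> E. p \<in> f} then 1 else 0)
      - (\<Sum>j\<in>c ` (E - uniq). if j \<in> big \<and> p \<in> Ou j then real (card (cls j)) - 2 else 0)"
    by (simp only: sum_subtractf sum.distrib)
  also note card_nonuniq
  also have "(\<Sum>j\<in>c ` (E - uniq). if j \<in> big \<and> p \<in> Ou j then real (card (cls j)) - 2 else 0) =
     (\<Sum>j\<in>big. if p \<in> Ou j then real (card (cls j)) - 2 else 0)"
    by (rule sum.mono_neutral_cong_right) (use fin big_subset in auto)
  finally have 1: "(\<Sum>q\<in>nbr E p. real (card (nbr E q)) - real (card {f \<in> uniq. q \<in> f})) \<le>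
     real (card E) - real (card uniq) + (\<Sum>j\<in>c ` (E - uniq). if j \<in> c ` {f \<in> E. p \<in> f} then 1 else 0)
      - (\<Sum>j\<in>big. if p \<in> Ou j then real (card (cls j)) - 2 else 0)" .
  have "(\<Sum>j\<in>c ` (E - uniq). if j \<in> c ` {f \<in> E. p \<in> f} then 1 else 0 :: real) =
      real (card (c ` (E - uniq) \<inter> c ` {f \<in> E. p \<in> f}))"
    using fin by (simp add: sum.If_cases)
  also have "\<dots> \<le> real (card (c ` {f \<in> E. p \<in> f}))"
    using fin by (intro of_nat_mono card_mono) auto
  also have "\<dots> \<le> real (card (nbr E p))"
    using card_image_le[of "{f \<in> E. p \<in> f}" c] fin card_incident[OF gr, of p] by simp
  finally show ?thesis using 1 by linarith
qed

text \<open>If the degrees outside of the two independent sets are large for every big class,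
  \<open>weight_or_excess\<close> yields the colours. A class for which they are small exhibits the
  nearly bipartite structure by itself.\<close>

lemma many_colours_or_bipartite:
  assumes \<eta>: "0 < \<eta>" "\<eta> \<le> 1" and m: "17 < real (card U) * \<eta> ^ 2"
    and e: "(1 - \<eta> ^ 2 / 2) * real (card U) ^ 2 \<le> 4 * real (card E)"
  shows "3 / 2 * real (card E) - real (card U) ^ 2 / 4 - \<eta> * real (card U) ^ 2 \<le> real (card (c ` E)) \<or>
    (\<exists>I J. independent_pair U E I J \<and>
      (\<Sum>p\<in>U - (I \<union> J). real (card (nbr E p))) \<le> \<eta> * real (card U) ^ 2)"
proof -
  define m where "m = real (card U)"
  define ee where "ee = real (card E)"
  define \<rho> where "\<rho> = real (card uniq)"
  define A where "A = (\<lambda>p q. if {p, q} \<in> E then 1 else 0 :: real)"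
  define d where "d = (\<lambda>p. real (card (nbr E p)))"
  define k where "k = (\<lambda>p. real (card {f \<in> uniq. p \<in> f}))"
  have fin: "finite U" "finite E" using grD by auto
  define P where "P = (\<lambda>j I J. independent_pair U E I J \<and>
     (\<forall>p\<in>U. (\<Sum>f\<in>cls j. card (f \<inter> nbr E p)) \<le> card (cls j)) \<and>
     (\<forall>p\<in>U - (I \<union> J). (\<Sum>f\<in>cls j. card (f \<inter> nbr E p)) \<le> 1))"
  have "\<exists>I J. P j I J" if "j \<in> big" for j
  proof -
    have "3 \<le> card (cls j)" using that by (simp add: big_def)
    thus ?thesis unfolding P_def by (rule class_structure) (rule cls_same)
  qed
  then obtain I J where IJ0: "\<And>j. j \<in> big \<Longrightarrow> P j (I j) (J j)" by metis
  have IJ: "I j \<subseteq> U" "J j \<subseteq> U" "I j \<inter> J j = {}" "p \<in> I j \<Longrightarrow> q \<in> I j \<Longrightarrow> {p, q} \<notin> E"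
    "p \<in> J j \<Longrightarrow> q \<in> J j \<Longrightarrow> {p, q} \<notin> E" "p \<in> U \<Longrightarrow> (\<Sum>f\<in>cls j. card (f \<inter> nbr E p)) \<le> card (cls j)"
    "p \<in> U - (I j \<union> J j) \<Longrightarrow> (\<Sum>f\<in>cls j. card (f \<inter> nbr E p)) \<le> 1" if "j \<in> big" for j p q
    using IJ0[OF that] unfolding P_def independent_pair_def by blast+
  define Ou where "Ou = (\<lambda>j. U - (I j \<union> J j))"
  define w where "w = (\<lambda>j. real (card (cls j)) - 2)"
  define D where "D = (\<lambda>p. \<Sum>j\<in>big. if p \<in> Ou j then w j else 0)"
  define \<delta> where "\<delta> = (\<lambda>j. \<Sum>p\<in>Ou j. d p)"
  define \<kappa> where "\<kappa> = (\<lambda>j. \<Sum>p\<in>Ou j. k p)"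
  have A: "0 \<le> A p q" "A p q \<le> 1" "A p q = A q p" for p q by (auto simp: A_def insert_commute)
  have nb: "(\<Sum>q\<in>U. A p q * F q) = (\<Sum>q\<in>nbr E p. F q)" for p F
  proof -
    have "(\<Sum>q\<in>U. A p q * F q) = (\<Sum>q\<in>U. if q \<in> nbr E p then F q else 0)"
      by (intro sum.cong) (auto simp: A_def)
    also have "\<dots> = (\<Sum>q\<in>U \<inter> nbr E p. F q)" using fin by (simp add: sum.inter_restrict)
    also have "U \<inter> nbr E p = nbr E p" using grD(8) by blast
    finally show ?thesis .
  qed
  have dA: "d p = (\<Sum>q\<in>U. A p q)" for p using nb[of p "\<lambda>_. 1"] by (simp add: d_def)
  have dm: "d p \<le> real (card U)" for p
    using card_mono[OF fin(1) grD(8)[of p]] by (simp add: d_def)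
  have k: "0 \<le> k p" "k p \<le> d p" for p
  proof -
    show "0 \<le> k p" by (simp add: k_def)
    have "card {f \<in> uniq. p \<in> f} \<le> card {f \<in> E. p \<in> f}" using uniq_subset fin by (intro card_mono) auto
    thus "k p \<le> d p" by (simp add: k_def d_def card_incident[OF gr])
  qed
  have hs: "(\<Sum>p\<in>U. real (card {f \<in> M. p \<in> f})) = 2 * real (card M)" if "M \<subseteq> E" for M
    using arg_cong[OF handshake[OF gr that], of real] by simp
  have sd: "(\<Sum>p\<in>U. d p) = 2 * ee"
    using hs[of E] by (simp add: d_def ee_def card_incident[OF gr])
  have sk: "(\<Sum>p\<in>U. k p) = 2 * \<rho>" using hs[OF uniq_subset] by (simp add: k_def \<rho>_def)
  have row: "(\<Sum>q\<in>U. A p q * (d q - k q)) \<le> ee - \<rho> - D p + d p" if p: "p \<in> U" for p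
  proof -
    have 1: "(\<Sum>f\<in>cls j. card (f \<inter> nbr E p)) \<le> card (cls j)" if "j \<in> big" for j
      using IJ(6)[OF that p] .
    have 2: "(\<Sum>f\<in>cls j. card (f \<inter> nbr E p)) \<le> 1" if "j \<in> big" "p \<in> Ou j" for j
      using IJ(7)[OF that(1)] that(2) by (simp only: Ou_def)
    show ?thesis using row_bound[where Ou = Ou, OF p 1 2]
      unfolding nb by (simp only: d_def k_def ee_def \<rho>_def D_def w_def)
  qed
  have low: "8 * ee ^ 3 / m ^ 2 - 2 * ee ^ 2 + 2 * \<rho> ^ 2 + (\<Sum>p\<in>U. (d p + k p) * D p)
           - 4 * ee * m \<le> (\<Sum>p\<in>U. \<Sum>q\<in>U. A p q * k p * k q)"
    unfolding m_def by (rule unique_form_lower_bound[OF fin(1) A(1) A(3) dA dm k sd sk row])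
  have DD: "(\<Sum>p\<in>U. (d p + k p) * D p) = (\<Sum>j\<in>big. w j * (\<delta> j + \<kappa> j))"
  proof -
    have "(\<Sum>p\<in>U. (d p + k p) * D p) = (\<Sum>p\<in>U. \<Sum>j\<in>big. if p \<in> Ou j then w j * (d p + k p) else 0)"
      by (auto simp: D_def sum_distrib_left intro!: sum.cong)
    also have "\<dots> = (\<Sum>j\<in>big. \<Sum>p\<in>U. if p \<in> Ou j then w j * (d p + k p) else 0)" by (rule sum.swap)
    also have "\<dots> = (\<Sum>j\<in>big. \<Sum>p\<in>U \<inter> Ou j. w j * (d p + k p))" using fin by (simp add: sum.inter_restrict)
    also have "\<dots> = (\<Sum>j\<in>big. w j * (\<delta> j + \<kappa> j))"
    proof (intro sum.cong refl)
      fix j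
      have "U \<inter> Ou j = Ou j" by (auto simp: Ou_def)
      thus "(\<Sum>p\<in>U \<inter> Ou j. w j * (d p + k p)) = w j * (\<delta> j + \<kappa> j)"
        by (simp add: \<delta>_def \<kappa>_def sum.distrib sum_distrib_left[symmetric])
    qed
    finally show ?thesis .
  qed
  have up: "(\<Sum>p\<in>U. \<Sum>q\<in>U. A p q * k p * k q) \<le> 2 * \<rho> ^ 2 + 2 * \<rho> * \<kappa> j - \<kappa> j ^ 2 / 2" if "j \<in> big" for j
    by (rule unique_form_upper_bound[OF fin(1) A(2) k(1) sk IJ(1-3)[OF that]])
       (use IJ(4,5)[OF that] in \<open>auto simp: A_def \<kappa>_def Ou_def\<close>)
  \<comment> \<open>With empty independent sets the outer weight is all of \<open>2 \<rho>\<close>.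
    This serves the case without big classes.\<close>
  have up0: "(\<Sum>p\<in>U. \<Sum>q\<in>U. A p q * k p * k q) \<le> 4 * \<rho> ^ 2"
  proof -
    have "(\<Sum>p\<in>U. \<Sum>q\<in>U. A p q * k p * k q) \<le> 2 * \<rho> ^ 2 + 2 * \<rho> * (2 * \<rho>) - (2 * \<rho>) ^ 2 / 2"
      by (rule unique_form_upper_bound[OF fin(1) A(2) k(1) sk, of "{}" "{}"]) (auto simp: sk)
    thus ?thesis by (simp add: power2_eq_square)
  qed
  have e2: "2 * ee \<le> m ^ 2"
  proof -
    have "2 * ee \<le> (\<Sum>p\<in>U. m)" unfolding sd[symmetric] by (intro sum_mono) (use dm in \<open>simp add: m_def\<close>)
    thus ?thesis by (simp add: m_def power2_eq_square)
  qed
  have mpos: "m > 0" using assms(3) by (cases "card U = 0") (auto simp: m_def)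
  have cc: "2 * real (card (c ` E)) = ee + \<rho> - sum w big"
    using colour_count by (simp add: ee_def \<rho>_def w_def)
  show ?thesis
  proof (cases "\<exists>j\<in>big. \<delta> j \<le> \<eta> * m ^ 2")
    case True
    then obtain j where j: "j \<in> big" "\<delta> j \<le> \<eta> * m ^ 2" by blast
    thus ?thesis
      using IJ0[OF j(1)]
      by (intro disjI2 exI[of _ "I j"] exI[of _ "J j"]) (simp add: P_def \<delta>_def Ou_def d_def m_def)
  next
    case False
    have "2 * ee - m ^ 2 / 2 - \<eta> * m ^ 2 \<le> \<rho> - sum w big"
    proof (rule weight_or_excess[where B = big and w = w and \<kappa> = \<kappa> and \<delta> = \<delta>])
      show "17 < m * \<eta>\<^sup>2" using assms(3) by (simp add: m_def)
      show "(1 - \<eta>\<^sup>2 / 2) * m\<^sup>2 \<le> 4 * ee" using e by (simp add: m_def ee_def)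
      show "0 \<le> \<rho>" by (simp add: \<rho>_def)
      show "0 \<le> w j" if "j \<in> big" for j using that by (simp add: w_def big_def)
      show "0 \<le> \<kappa> j" for j by (simp add: \<kappa>_def k sum_nonneg)
      show "\<kappa> j \<le> \<delta> j" for j unfolding \<kappa>_def \<delta>_def by (intro sum_mono k)
      show "8 * ee ^ 3 / m\<^sup>2 - 2 * ee\<^sup>2 - 4 * ee * m \<le> 2 * \<rho>\<^sup>2" if "big = {}"
        using low up0 that unfolding DD by simp
      show "8 * ee ^ 3 / m\<^sup>2 - 2 * ee\<^sup>2 - 4 * ee * m + (\<Sum>j\<in>big. w j * (\<delta> j + \<kappa> j)) \<le> 2 * \<rho> * \<kappa> i - (\<kappa> i)\<^sup>2 / 2"
        if "i \<in> big" for i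
        using low up[OF that] unfolding DD by linarith
      show "\<eta> * m\<^sup>2 \<le> \<delta> j" if "j \<in> big" for j using False that by force
    qed (use \<eta> mpos e2 in auto)
    hence "3 / 2 * ee - m ^ 2 / 4 - \<eta> * m ^ 2 / 2 \<le> real (card (c ` E))" using cc by simp
    moreover have "0 \<le> \<eta> * m ^ 2" using \<eta> by simp
    ultimately have "3 / 2 * ee - m ^ 2 / 4 - \<eta> * m ^ 2 \<le> real (card (c ` E))" by linarith
    thus ?thesis by (simp add: ee_def m_def)
  qed
qed

end

subsection \<open>Making walks of three edges robust\<close>

locale host_graph =
  fixes V :: "'a set" and E :: "'a set set"
  assumes gr: "finite_simple_graph (V, E)"
begin

lemmas grD = finite_simple_graphD[OF gr]

definition adj :: "('a \<times> 'a) set" where "adj = {(a, b). {a, b} \<in> E}"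

text \<open>Vertices are grouped by their trace on \<open>W\<close>. Adding a vertex to
  \<open>W\<close> makes its neighbourhood a union of cells, and the number of cells is bounded in
  terms of \<open>card W\<close> alone.\<close>

definition cell :: "'a set \<Rightarrow> 'a \<Rightarrow> 'a set" where
  "cell W a = {x \<in> V. nbr E x \<inter> W = nbr E a \<inter> W}"

text \<open>The vertices \<open>y\<close> and \<open>w\<close> certify a defect of the cells
  \<open>A\<close> and \<open>B\<close>: each has many neighbours in its cell, and yet too few of
  the walks from \<open>y\<close> to \<open>w\<close> pass through them.\<close>

definition thin_witness :: "real \<Rightarrow> 'a set \<Rightarrow> 'a set \<Rightarrow> 'a \<Rightarrow> 'a \<Rightarrow> bool" where
  "thin_witness \<epsilon> A B y w \<longleftrightarrow> y \<in> V \<and> w \<in> V \<and>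
     \<epsilon> * real (card A) \<le> real (card (nbr E y \<inter> A)) \<and> \<epsilon> * real (card B) \<le> real (card (nbr E w \<inter> B)) \<and>
     real (card ((nbr E y \<inter> A) \<times> (nbr E w \<inter> B) \<inter> adj)) < \<epsilon> * (real (card (nbr E y \<inter> A)) * real (card (nbr E w \<inter> B)))"

definition thin :: "real \<Rightarrow> 'a set \<Rightarrow> ('a \<times> 'a) set \<Rightarrow> ('a set \<times> 'a set) set" where
  "thin \<epsilon> W D = {(A, B) \<in> cell W ` V \<times> cell W ` V. A \<times> B \<inter> D = {} \<and> (\<exists>y w. thin_witness \<epsilon> A B y w)}"

definition thin_area :: "real \<Rightarrow> 'a set \<Rightarrow> ('a \<times> 'a) set \<Rightarrow> real" where
  "thin_area \<epsilon> W D = (\<Sum>(A, B)\<in>thin \<epsilon> W D. real (card A) * real (card B))"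

text \<open>
  Each refinement enlarges the sparse set \<open>D\<close> by at least \<open>\<epsilon>\<^sup>3 n\<^sup>2\<close> pairs, so that boundedly many
  refinements, and hence boundedly many cells, suffice whatever \<open>n\<close> is.
\<close>

definition sparse_state :: "real \<Rightarrow> 'a set \<Rightarrow> ('a \<times> 'a) set \<Rightarrow> bool" where
  "sparse_state \<epsilon> W D \<longleftrightarrow> W \<subseteq> V \<and> D \<subseteq> V \<times> V \<and> (\<forall>x y. (x, y) \<in> D \<longrightarrow> cell W x \<times> cell W y \<subseteq> D) \<and>
     real (card (D \<inter> adj)) \<le> \<epsilon> * card D"

lemma cell_subset: "cell W a \<subseteq> V" by (auto simp: cell_def)

lemma finite_cell [simp]: "finite (cell W a)"
  using cell_subset grD(1) finite_subset by blast

lemma thin_subset: "thin \<epsilon> W D \<subseteq> cell W ` V \<times> cell W ` V" by (auto simp: thin_def)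

lemma mem_cell: "a \<in> V \<Longrightarrow> a \<in> cell W a" by (simp add: cell_def)

lemma cell_eq: "x \<in> cell W a \<Longrightarrow> cell W x = cell W a" by (auto simp: cell_def)

lemma card_cells: "card (cell W ` V) \<le> 2 ^ card W" if "finite W"
proof -
  have "cell W ` V \<subseteq> (\<lambda>T. {x \<in> V. nbr E x \<inter> W = T}) ` Pow W"
    by (auto simp: cell_def)
  hence "card (cell W ` V) \<le> card (Pow W)"
    using that by (meson card_image_le card_mono finite_Pow_iff finite_imageI le_trans)
  thus ?thesis using that by (simp add: card_Pow)
qed

text \<open>Every thin pair of cells gives its witnesses to \<open>W\<close> and the rectangle
  \<open>R p\<close> of their neighbours to \<open>D\<close>. With the witnesses in \<open>W\<close>
  this rectangle is a union of products of cells, so the state is preserved. It has density below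
  \<open>\<epsilon>\<close> and takes up at least an \<open>\<epsilon>^2\<close> share of the thin
  pair; the thin pairs are disjoint and cover \<open>\<epsilon> n^2\<close>, so \<open>D\<close>
  grows by \<open>\<epsilon>^3 n^2\<close>.\<close>

lemma refine_cells:
  fixes \<epsilon> :: real
  assumes \<epsilon>: "0 < \<epsilon>" and state: "sparse_state \<epsilon> W D" and area: "\<epsilon> * real (card V) ^ 2 \<le> thin_area \<epsilon> W D"
  shows "\<exists>W' D'. sparse_state \<epsilon> W' D' \<and> card W' \<le> card W + 2 * 4 ^ card W \<and>
    real (card D) + \<epsilon> ^ 3 * real (card V) ^ 2 \<le> real (card D')"
proof -
  have W: "W \<subseteq> V" and D: "D \<subseteq> V \<times> V" "\<And>x y. (x, y) \<in> D \<Longrightarrow> cell W x \<times> cell W y \<subseteq> D"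
    and few: "real (card (D \<inter> adj)) \<le> \<epsilon> * card D"
    using state by (auto simp: sparse_state_def)
  define F where "F = thin \<epsilon> W D"
  have finV: "finite V" and finW: "finite W" using grD(1) W finite_subset by auto
  have FP: "F \<subseteq> cell W ` V \<times> cell W ` V" by (auto simp: F_def thin_def)
  hence finF: "finite F" using finV by (meson finite_SigmaI finite_imageI finite_subset)
  have "card F \<le> card (cell W ` V \<times> cell W ` V)" using FP finV by (intro card_mono) auto
  also have "\<dots> \<le> 2 ^ card W * 2 ^ card W"
    unfolding card_cartesian_product by (intro mult_mono card_cells finW) auto
  also have "\<dots> = 4 ^ card W" by (simp flip: power_mult_distrib)
  finally have cF: "card F \<le> 4 ^ card W" .
  have "\<exists>y w. thin_witness \<epsilon> (fst p) (snd p) y w" if "p \<in> F" for p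
    using that by (auto simp: F_def thin_def)
  then obtain y w where "\<And>p. p \<in> F \<Longrightarrow> thin_witness \<epsilon> (fst p) (snd p) (y p) (w p)" by metis
  note yw = this[unfolded thin_witness_def]
  define R where "R = (\<lambda>p. (nbr E (y p) \<inter> fst p) \<times> (nbr E (w p) \<inter> snd p))"
  define W' where "W' = W \<union> y ` F \<union> w ` F"
  define D' where "D' = D \<union> (\<Union>p\<in>F. R p)"
  have Rsub: "R p \<subseteq> fst p \<times> snd p" for p by (auto simp: R_def)
  have FV: "fst p \<subseteq> V \<and> snd p \<subseteq> V" if "p \<in> F" for p using FP that cell_subset by fastforce
  have RV: "R p \<subseteq> V \<times> V" if "p \<in> F" for p using Rsub[of p] FV[OF that] by fastforce
  have finR: "finite (R p)" if "p \<in> F" for p using RV[OF that] finV by (meson finite_SigmaI finite_subset)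
  have finD: "finite D" using D finV by (meson finite_SigmaI finite_subset)
  have cR: "card (R p) = card (nbr E (y p) \<inter> fst p) * card (nbr E (w p) \<inter> snd p)" for p
    by (simp add: R_def card_cartesian_product)
  have disj: "R p \<inter> R q = {}" if pq: "p \<in> F" "q \<in> F" "p \<noteq> q" for p q
  proof (rule ccontr)
    assume "R p \<inter> R q \<noteq> {}"
    then obtain x y where xy: "x \<in> fst p" "x \<in> fst q" "y \<in> snd p" "y \<in> snd q" using Rsub by fastforce
    have "fst p = cell W x \<and> snd p = cell W y" "fst q = cell W x \<and> snd q = cell W y"
      using FP pq xy cell_eq by fastforce+
    thus False using pq(3) by (simp add: prod_eq_iff)
  qed
  have disjD: "D \<inter> (\<Union>p\<in>F. R p) = {}"
  proof -
    have "fst p \<times> snd p \<inter> D = {}" if "p \<in> F" for p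
      using that unfolding F_def thin_def case_prod_unfold by blast
    thus ?thesis using Rsub by fastforce
  qed
  have cD': "card D' = card D + (\<Sum>p\<in>F. card (R p))"
  proof -
    have "card D' = card D + card (\<Union>p\<in>F. R p)"
      unfolding D'_def using finD finF finR disjD by (intro card_Un_disjoint) auto
    also have "card (\<Union>p\<in>F. R p) = (\<Sum>p\<in>F. card (R p))"
      using finF finR disj by (intro card_UN_disjoint) auto
    finally show ?thesis .
  qed
  have "card W' \<le> card W + card F + card F"
    unfolding W'_def using card_image_le[OF finF] by (meson add_mono card_Un_le le_refl le_trans)
  hence 1: "card W' \<le> card W + 2 * 4 ^ card W" using cF by linarith
  have 2: "W' \<subseteq> V" using W yw by (auto simp: W'_def)
  have 3: "D' \<subseteq> V \<times> V" using D(1) RV by (auto simp: D'_def)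
  have 4: "\<forall>x y. (x, y) \<in> D' \<longrightarrow> cell W' x \<times> cell W' y \<subseteq> D'"
  proof (intro allI impI subsetI)
    fix x v z assume xy: "(x, v) \<in> D'" and z: "z \<in> cell W' x \<times> cell W' v"
    obtain x' v' where zz: "z = (x', v')" by (cases z)
    have W': "cell W' a \<subseteq> cell W a" for a by (auto simp: cell_def W'_def)
    from xy consider "(x, v) \<in> D" | p where "p \<in> F" "(x, v) \<in> R p" by (auto simp: D'_def)
    thus "z \<in> D'"
    proof cases
      case 1
      hence "cell W x \<times> cell W v \<subseteq> D" using D(2) by blast
      thus ?thesis using z W' by (fastforce simp: D'_def)
    next
      case (2 p)
      have p: "fst p = cell W x" "snd p = cell W v" using FP 2 Rsub[of p] cell_eq by fastforce+
      have a: "y p \<in> W'" "w p \<in> W'" using 2(1) by (auto simp: W'_def)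
      have "y p \<in> nbr E x" "w p \<in> nbr E v" using 2(2) by (auto simp: R_def insert_commute)
      hence "y p \<in> nbr E x'" "w p \<in> nbr E v'" using z zz a by (auto simp: cell_def)
      hence "z \<in> R p" using z zz W' p by (auto simp: R_def insert_commute)
      thus ?thesis using 2(1) by (auto simp: D'_def)
    qed
  qed
  have 5: "real (card (D' \<inter> adj)) \<le> \<epsilon> * card D'"
  proof -
    have "D' \<inter> adj = (D \<inter> adj) \<union> (\<Union>p\<in>F. R p \<inter> adj)" by (auto simp: D'_def)
    hence "card (D' \<inter> adj) \<le> card (D \<inter> adj) + (\<Sum>p\<in>F. card (R p \<inter> adj))"
      using card_Un_le[of "D \<inter> adj" "\<Union>p\<in>F. R p \<inter> adj"] card_UN_le[OF finF, of "\<lambda>p. R p \<inter> adj"] by simp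
    hence "real (card (D' \<inter> adj)) \<le> real (card (D \<inter> adj)) + (\<Sum>p\<in>F. real (card (R p \<inter> adj)))"
      by (metis of_nat_add of_nat_le_iff of_nat_sum)
    also have "\<dots> \<le> \<epsilon> * card D + (\<Sum>p\<in>F. \<epsilon> * real (card (R p)))"
    proof (intro add_mono few sum_mono)
      fix p assume "p \<in> F"
      thus "real (card (R p \<inter> adj)) \<le> \<epsilon> * real (card (R p))"
        using yw[of p] unfolding cR of_nat_mult unfolding R_def by linarith
    qed
    also have "\<dots> = \<epsilon> * card D'" by (simp add: cD' sum_distrib_left distrib_left)
    finally show ?thesis .
  qed
  have 6: "real (card D) + \<epsilon> ^ 3 * real (card V) ^ 2 \<le> real (card D')"
  proof -
    have "\<epsilon> ^ 3 * real (card V) ^ 2 = \<epsilon> ^ 2 * (\<epsilon> * real (card V) ^ 2)" by (simp add: power2_eq_square power3_eq_cube)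
    also have "\<dots> \<le> \<epsilon> ^ 2 * (\<Sum>(A, B)\<in>F. real (card A) * real (card B))"
      using area by (intro mult_left_mono) (auto simp: F_def thin_area_def)
    also have "\<dots> = (\<Sum>p\<in>F. (\<epsilon> * card (fst p)) * (\<epsilon> * card (snd p)))"
      by (simp add: sum_distrib_left case_prod_unfold power2_eq_square mult_ac)
    also have "\<dots> \<le> (\<Sum>p\<in>F. real (card (R p)))"
    proof (intro sum_mono)
      fix p assume "p \<in> F"
      thus "(\<epsilon> * card (fst p)) * (\<epsilon> * card (snd p)) \<le> real (card (R p))"
        unfolding cR of_nat_mult using yw \<epsilon> by (intro mult_mono) auto
    qed
    finally show ?thesis by (simp add: cD')
  qed
  have "sparse_state \<epsilon> W' D'" using 2 3 4 5 by (simp add: sparse_state_def)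
  thus ?thesis using 1 6 by blast
qed

primrec cell_bound :: "nat \<Rightarrow> nat" where
  "cell_bound 0 = 0"
| "cell_bound (Suc t) = cell_bound t + 2 * 4 ^ cell_bound t"

lemma refine_iterate:
  fixes \<epsilon> :: real
  assumes \<epsilon>: "0 < \<epsilon>"
  shows "\<exists>W D. sparse_state \<epsilon> W D \<and> card W \<le> cell_bound t \<and>
    (real t * \<epsilon> ^ 3 * real (card V) ^ 2 \<le> real (card D) \<or> thin_area \<epsilon> W D < \<epsilon> * real (card V) ^ 2)"
proof (induction t)
  case 0
  show ?case by (rule exI[of _ "{}"], rule exI[of _ "{}"]) (simp add: sparse_state_def)
next
  case (Suc t)
  then obtain W D where WD: "sparse_state \<epsilon> W D" "card W \<le> cell_bound t"
    "real t * \<epsilon> ^ 3 * real (card V) ^ 2 \<le> real (card D) \<or> thin_area \<epsilon> W D < \<epsilon> * real (card V) ^ 2" by blast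
  show ?case
  proof (cases "thin_area \<epsilon> W D < \<epsilon> * real (card V) ^ 2")
    case True
    thus ?thesis using WD by (intro exI[of _ W] exI[of _ D]) auto
  next
    case False
    obtain W' D' where W': "sparse_state \<epsilon> W' D'" "card W' \<le> card W + 2 * 4 ^ card W"
      "real (card D) + \<epsilon> ^ 3 * real (card V) ^ 2 \<le> real (card D')"
      using refine_cells[OF \<epsilon> WD(1)] False by (auto simp: not_less)
    have "(4::nat) ^ card W \<le> 4 ^ cell_bound t" using WD(2) by (intro power_increasing) auto
    hence "card W' \<le> cell_bound (Suc t)" unfolding cell_bound.simps using W'(2) WD(2) by linarith
    moreover have "real (Suc t) * \<epsilon> ^ 3 * real (card V) ^ 2 \<le> real (card D')"
      using WD(3) False W'(3) by (simp add: algebra_simps)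
    ultimately show ?thesis using W'(1) by (intro exI[of _ W'] exI[of _ D']) blast
  qed
qed

end

text \<open>\<open>\<kappa>\<close> depends on \<open>\<epsilon>\<close> alone because the number of
  refinements does. Four kinds of edges are deleted, at most \<open>\<epsilon> n^2\<close> of each.
  For a walk \<open>y a b w\<close> of surviving edges, the cells of \<open>a\<close> and
  \<open>b\<close> are large, \<open>y\<close> and \<open>w\<close> have many neighbours in them,
  and the pair of cells is neither thin nor part of \<open>D\<close>, so many edges join these
  neighbours.\<close>

lemma walk_cleaning:
  fixes \<epsilon> :: real
  assumes \<epsilon>: "0 < \<epsilon>"
  shows "\<exists>\<kappa>>0. \<forall>(V :: 'a set) E. finite_simple_graph (V, E) \<longrightarrow> (\<exists>E'\<subseteq>E.
     real (card (E - E')) \<le> 4 * \<epsilon> * real (card V) ^ 2 \<and>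
     walk_rich (\<kappa> * real (card V) ^ 2) E' E)"
proof -
  \<comment> \<open>\<open>D\<close> contains at most \<open>n^2\<close> pairs and gains
    \<open>\<epsilon>^3 n^2\<close> in each refinement, so the refinement must have come to a halt
    within \<open>t\<close> rounds.\<close>
  define t where "t = nat \<lceil>1 / \<epsilon> ^ 3\<rceil> + 1"
  define L where "L = host_graph.cell_bound t"
  \<comment> \<open>One factor \<open>\<epsilon>\<close> stems from the density, and for each of the
    two cells one from its size and one from the share of neighbours in it; \<open>4 ^ L\<close>
    bounds the square of the number of cells.\<close>
  define \<kappa> where "\<kappa> = \<epsilon> ^ 5 / 4 ^ L"
  have t: "1 < real t * \<epsilon> ^ 3"
  proof -
    have "1 / \<epsilon> ^ 3 < real t" unfolding t_def by linarith
    thus ?thesis using \<epsilon> by (simp add: pos_divide_less_eq)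
  qed
  have "\<exists>E'\<subseteq>E. real (card (E - E')) \<le> 4 * \<epsilon> * real (card V) ^ 2 \<and>
     walk_rich (\<kappa> * real (card V) ^ 2) E' E"
    if gr: "finite_simple_graph (V, E)" for V :: "'a set" and E
  proof -
    interpret host_graph V E by standard (rule gr)
    define n where "n = real (card V)"
    obtain W D where state: "sparse_state \<epsilon> W D" and WL: "card W \<le> L" and alt: "real t * \<epsilon> ^ 3 * real (card V) ^ 2 \<le> real (card D) \<or>
      thin_area \<epsilon> W D < \<epsilon> * real (card V) ^ 2"
      using refine_iterate[OF \<epsilon>, of t] by (auto simp: L_def)
    have W: "W \<subseteq> V" "card W \<le> L" and D: "D \<subseteq> V \<times> V" "\<And>x y. (x, y) \<in> D \<Longrightarrow> cell W x \<times> cell W y \<subseteq> D"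
      "real (card (D \<inter> adj)) \<le> \<epsilon> * card D"
      using state WL by (auto simp: sparse_state_def)
    have finV: "finite V" and finW: "finite W" using grD(1) W finite_subset by auto
    have "card D \<le> card (V \<times> V)" using D finV by (intro card_mono) auto
    hence "card D \<le> card V * card V" by (simp add: card_cartesian_product)
    hence Dn: "real (card D) \<le> n ^ 2" unfolding n_def power2_eq_square by (metis of_nat_le_iff of_nat_mult)
    have area: "thin_area \<epsilon> W D \<le> \<epsilon> * n ^ 2"
    proof (cases "V = {}")
      case True
      hence "thin \<epsilon> W D = {}" using thin_subset[of \<epsilon> W D] by simp
      thus ?thesis using \<epsilon> by (simp add: thin_area_def)
    next
      case False
      hence "n ^ 2 > 0" using finV by (simp add: n_def card_gt_0_iff)
      hence "n ^ 2 < real t * \<epsilon> ^ 3 * n ^ 2" using t by simp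
      hence "\<not> real t * \<epsilon> ^ 3 * n ^ 2 \<le> real (card D)" using Dn by linarith
      thus ?thesis using alt unfolding n_def by linarith
    qed
    \<comment> \<open>In turn: edges in the sparse set, pairs in thin products of cells, pairs with
      an end in a small cell, and edges from \<open>b\<close> into a cell in which \<open>b\<close>
      has few neighbours. The pairs are ordered, and an edge is deleted if either of its
      orientations is bad.\<close>
    define P1 where "P1 = D \<inter> adj"
    define P2 where "P2 = {(a, b) \<in> V \<times> V. (cell W a, cell W b) \<in> thin \<epsilon> W D}"
    define S where "S = {a \<in> V. card (cell W a) < \<epsilon> * n / 2 ^ card W}"
    define P3 where "P3 = S \<times> V"
    define P4 where "P4 = {(a, b) \<in> V \<times> V. a \<in> nbr E b \<and> card (nbr E b \<inter> cell W a) < \<epsilon> * card (cell W a)}"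
    define P where "P = P1 \<union> P2 \<union> P3 \<union> P4"
    define E' where "E' = E - (\<lambda>(a, b). {a, b}) ` P"
    have finp: "finite (X :: ('a \<times> 'a) set)" if "X \<subseteq> V \<times> V" for X
      using that finV by (meson finite_SigmaI finite_subset)
    have fP: "finite P1" "finite P2" "finite P3" "finite P4"
      using D(1) by (auto intro!: finp simp: P1_def P2_def P3_def P4_def S_def)
    have c1: "real (card P1) \<le> \<epsilon> * n ^ 2"
    proof -
      have "\<epsilon> * real (card D) \<le> \<epsilon> * n ^ 2" using Dn \<epsilon> by (intro mult_left_mono) auto
      thus ?thesis using D(3) by (simp add: P1_def)
    qed
    have finthin: "finite (thin \<epsilon> W D)"
    proof -
      show ?thesis using finV thin_subset[of \<epsilon> W D] by (meson finite_SigmaI finite_imageI finite_subset)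
    qed
    have c2: "real (card P2) \<le> \<epsilon> * n ^ 2"
    proof -
      have "P2 \<subseteq> (\<Union>(A, B)\<in>thin \<epsilon> W D. A \<times> B)"
      proof
        fix z assume "z \<in> P2"
        then obtain a b where "z = (a, b)" "a \<in> V" "b \<in> V" "(cell W a, cell W b) \<in> thin \<epsilon> W D"
          by (auto simp: P2_def)
        thus "z \<in> (\<Union>(A, B)\<in>thin \<epsilon> W D. A \<times> B)" using mem_cell by blast
      qed
      moreover have "finite (\<Union>(A, B)\<in>thin \<epsilon> W D. A \<times> B)"
        using finthin by (rule finite_UN_I) (auto simp: thin_def)
      ultimately have "card P2 \<le> card (\<Union>(A, B)\<in>thin \<epsilon> W D. A \<times> B)" by (intro card_mono)
      also have "\<dots> \<le> (\<Sum>p\<in>thin \<epsilon> W D. card (case p of (A, B) \<Rightarrow> A \<times> B))" by (rule card_UN_le[OF finthin])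
      finally have "real (card P2) \<le> real (\<Sum>p\<in>thin \<epsilon> W D. card (case p of (A, B) \<Rightarrow> A \<times> B))" by linarith
      also have "\<dots> = (\<Sum>(A, B)\<in>thin \<epsilon> W D. real (card A) * real (card B))"
        by (simp add: case_prod_unfold card_cartesian_product)
      finally show ?thesis using area by (simp add: thin_area_def)
    qed
    have c3: "real (card P3) \<le> \<epsilon> * n ^ 2"
    proof -
      define Q where "Q = {A \<in> cell W ` V. card A < \<epsilon> * n / 2 ^ card W}"
      have finQ: "finite Q" using finV by (simp add: Q_def)
      have "S \<subseteq> \<Union>Q" using mem_cell by (auto simp: S_def Q_def)
      moreover have "finite (\<Union>Q)" using finQ by (auto simp: Q_def)
      ultimately have "card S \<le> card (\<Union>Q)" by (intro card_mono)
      also have "\<dots> \<le> (\<Sum>A\<in>Q. card A)" by (rule card_Union_le_sum_card)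
      finally have "real (card S) \<le> (\<Sum>A\<in>Q. real (card A))" by (simp only: of_nat_sum[symmetric] of_nat_le_iff)
      also have "\<dots> \<le> (\<Sum>A\<in>Q. \<epsilon> * n / 2 ^ card W)" by (intro sum_mono) (auto simp: Q_def)
      also have "\<dots> = real (card Q) * (\<epsilon> * n / 2 ^ card W)" by simp
      also have "\<dots> \<le> 2 ^ card W * (\<epsilon> * n / 2 ^ card W)"
      proof (rule mult_right_mono)
        have "card Q \<le> card (cell W ` V)" using finV by (intro card_mono) (auto simp: Q_def)
        also have "\<dots> \<le> 2 ^ card W" by (rule card_cells[OF finW])
        finally show "real (card Q) \<le> 2 ^ card W" by (metis of_nat_le_iff of_nat_numeral of_nat_power)
      qed (use \<epsilon> in \<open>simp add: n_def\<close>)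
      finally have "real (card S) * n \<le> \<epsilon> * n * n" by (intro mult_right_mono) (auto simp: n_def)
      thus ?thesis by (simp add: P3_def card_cartesian_product n_def power2_eq_square)
    qed
    have c4: "real (card P4) \<le> \<epsilon> * n ^ 2"
    proof -
      have fib: "real (card {a \<in> V. (a, b) \<in> P4}) \<le> \<epsilon> * n" for b
      proof -
        define Q where "Q = {A \<in> cell W ` V. card (nbr E b \<inter> A) < \<epsilon> * card A}"
        have finQ: "finite Q" using finV by (simp add: Q_def)
        have "{a \<in> V. (a, b) \<in> P4} \<subseteq> (\<Union>A\<in>Q. nbr E b \<inter> A)"
          using mem_cell by (auto simp: P4_def Q_def)
        moreover have "finite (\<Union>A\<in>Q. nbr E b \<inter> A)" using finQ grD(9) by auto
        ultimately have "card {a \<in> V. (a, b) \<in> P4} \<le> card (\<Union>A\<in>Q. nbr E b \<inter> A)" by (intro card_mono)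
        also have "\<dots> \<le> (\<Sum>A\<in>Q. card (nbr E b \<inter> A))" by (rule card_UN_le[OF finQ])
        finally have "real (card {a \<in> V. (a, b) \<in> P4}) \<le> (\<Sum>A\<in>Q. real (card (nbr E b \<inter> A)))"
          by (simp only: of_nat_sum[symmetric] of_nat_le_iff)
        also have "\<dots> \<le> (\<Sum>A\<in>Q. \<epsilon> * real (card A))" by (intro sum_mono) (auto simp: Q_def)
        also have "\<dots> = \<epsilon> * real (\<Sum>A\<in>Q. card A)" by (simp add: sum_distrib_left)
        also have "(\<Sum>A\<in>Q. card A) = card (\<Union>Q)"
        proof (rule card_Union_disjoint[symmetric])
          show "pairwise disjnt Q"
            unfolding pairwise_def disjnt_def Q_def using cell_eq by blast
        qed (auto simp: Q_def)
        also have "\<epsilon> * real (card (\<Union>Q)) \<le> \<epsilon> * n"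
          unfolding n_def using finV cell_subset \<epsilon> by (intro mult_left_mono of_nat_mono card_mono) (auto simp: Q_def)
        finally show ?thesis .
      qed
      have "P4 = (\<Union>b\<in>V. (\<lambda>a. (a, b)) ` {a \<in> V. (a, b) \<in> P4})" by (auto simp: P4_def)
      hence "card P4 \<le> (\<Sum>b\<in>V. card ((\<lambda>a. (a, b)) ` {a \<in> V. (a, b) \<in> P4}))"
        using card_UN_le[OF finV, of "\<lambda>b. (\<lambda>a. (a, b)) ` {a \<in> V. (a, b) \<in> P4}"] by simp
      also have "\<dots> \<le> (\<Sum>b\<in>V. card {a \<in> V. (a, b) \<in> P4})" using finV by (intro sum_mono card_image_le) auto
      finally have "real (card P4) \<le> (\<Sum>b\<in>V. real (card {a \<in> V. (a, b) \<in> P4}))"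
        by (simp only: of_nat_sum[symmetric] of_nat_le_iff)
      also have "\<dots> \<le> (\<Sum>b\<in>V. \<epsilon> * n)" by (intro sum_mono fib)
      finally show ?thesis by (simp add: n_def power2_eq_square mult_ac)
    qed
    have "card (E - E') \<le> card P"
    proof -
      have "E - E' \<subseteq> (\<lambda>(a, b). {a, b}) ` P" by (auto simp: E'_def)
      hence "card (E - E') \<le> card ((\<lambda>(a, b). {a, b}) ` P)" using fP by (intro card_mono) (auto simp: P_def)
      also have "\<dots> \<le> card P" using fP by (intro card_image_le) (auto simp: P_def)
      finally show ?thesis .
    qed
    also have "\<dots> \<le> card P1 + card P2 + card P3 + card P4"
      using card_Un_le[of "P1 \<union> P2 \<union> P3" P4] card_Un_le[of "P1 \<union> P2" P3] card_Un_le[of P1 P2]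
      unfolding P_def by linarith
    finally have lost: "real (card (E - E')) \<le> 4 * \<epsilon> * n ^ 2" using c1 c2 c3 c4 by simp
    have walks: "\<kappa> * n ^ 2 \<le> real (card (walk_pairs E y w))"
      if e: "{y, a} \<in> E'" "{a, b} \<in> E'" "{b, w} \<in> E'" for y a b w
    proof -
      have notP: "{p, q} \<in> E \<and> (p, q) \<notin> P \<and> (q, p) \<notin> P \<and> p \<in> V \<and> q \<in> V" if "{p, q} \<in> E'" for p q
        using that grD(6,7) unfolding E'_def by (auto intro: rev_image_eqI simp: insert_commute)
      note nya = notP[OF e(1)] note nab = notP[OF e(2)] note nbw = notP[OF e(3)]
      define A where "A = cell W a"
      define B where "B = cell W b"
      have A1: "\<epsilon> * card A \<le> card (nbr E y \<inter> A)"
        using nya by (auto simp: P_def P4_def A_def insert_commute)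
      have B1: "\<epsilon> * card B \<le> card (nbr E w \<inter> B)"
        using nbw by (auto simp: P_def P4_def B_def insert_commute)
      have A2: "\<epsilon> * n / 2 ^ card W \<le> card A" using nab by (auto simp: P_def P3_def S_def A_def)
      have B2: "\<epsilon> * n / 2 ^ card W \<le> card B" using nab by (auto simp: P_def P3_def S_def B_def)
      have "(a, b) \<notin> D" using nab by (auto simp: P_def P1_def adj_def)
      have AB: "A \<times> B \<inter> D = {}"
      proof (rule ccontr)
        assume "A \<times> B \<inter> D \<noteq> {}"
        then obtain x z where xz: "x \<in> A" "z \<in> B" "(x, z) \<in> D" by auto
        hence "cell W x \<times> cell W z \<subseteq> D" using D(2) by blast
        moreover have "cell W x = A" "cell W z = B" using xz cell_eq by (auto simp: A_def B_def)
        moreover have "a \<in> A" "b \<in> B" using mem_cell nab by (auto simp: A_def B_def)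
        ultimately show False using \<open>(a, b) \<notin> D\<close> by blast
      qed
      have "(A, B) \<notin> thin \<epsilon> W D" using nab by (auto simp: P_def P2_def A_def B_def)
      hence dense: "\<epsilon> * (real (card (nbr E y \<inter> A)) * card (nbr E w \<inter> B))
          \<le> card ((nbr E y \<inter> A) \<times> (nbr E w \<inter> B) \<inter> adj)"
        using AB A1 B1 nya nab nbw unfolding thin_def thin_witness_def A_def B_def by force
      have "(2::real) ^ card W \<le> 2 ^ L" using W(2) by (intro power_increasing) auto
      hence "\<epsilon> * n / 2 ^ L \<le> \<epsilon> * n / 2 ^ card W" using \<epsilon> by (intro divide_left_mono) (auto simp: n_def)
      hence AB3: "\<epsilon> * n / 2 ^ L \<le> card A" "\<epsilon> * n / 2 ^ L \<le> card B" using A2 B2 by auto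
      have "\<epsilon> * (\<epsilon> * n / 2 ^ L) \<le> \<epsilon> * card A" "\<epsilon> * (\<epsilon> * n / 2 ^ L) \<le> \<epsilon> * card B"
        using mult_left_mono[OF AB3(1), of \<epsilon>] mult_left_mono[OF AB3(2), of \<epsilon>] \<epsilon> by simp_all
      hence "\<epsilon> * (\<epsilon> * n / 2 ^ L) \<le> card (nbr E y \<inter> A)" "\<epsilon> * (\<epsilon> * n / 2 ^ L) \<le> card (nbr E w \<inter> B)"
        using A1 B1 by linarith+
      hence "\<epsilon> * ((\<epsilon> * (\<epsilon> * n / 2 ^ L)) * (\<epsilon> * (\<epsilon> * n / 2 ^ L)))
          \<le> \<epsilon> * (real (card (nbr E y \<inter> A)) * card (nbr E w \<inter> B))"
        using \<epsilon> by (intro mult_left_mono mult_mono) (auto simp: n_def)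
      moreover have "\<epsilon> * ((\<epsilon> * (\<epsilon> * n / 2 ^ L)) * (\<epsilon> * (\<epsilon> * n / 2 ^ L))) = \<kappa> * n ^ 2"
      proof -
        have "(2::real) ^ L * 2 ^ L = 4 ^ L" by (simp flip: power_mult_distrib)
        thus ?thesis by (simp add: \<kappa>_def power2_eq_square eval_nat_numeral mult_ac)
      qed
      ultimately have "\<kappa> * n ^ 2 \<le> card ((nbr E y \<inter> A) \<times> (nbr E w \<inter> B) \<inter> adj)" using dense by linarith
      also have "card ((nbr E y \<inter> A) \<times> (nbr E w \<inter> B) \<inter> adj) \<le> card (walk_pairs E y w)"
      proof (rule card_mono)
        have "walk_pairs E y w \<subseteq> V \<times> V" using grD(6,7) by (auto simp: walk_pairs_def)
        thus "finite (walk_pairs E y w)" by (rule finp)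
      qed (auto simp: adj_def walk_pairs_def insert_commute)
      finally show ?thesis by simp
    qed
    show ?thesis
      by (intro exI[of _ E'] conjI) (use lost walks in \<open>auto simp: n_def E'_def walk_rich_def\<close>)
  qed
  moreover have "\<kappa> > 0" using \<epsilon> by (simp add: \<kappa>_def)
  ultimately show ?thesis by (intro exI[of _ \<kappa>]) blast
qed

subsection \<open>Conflicting edges of equal colour\<close>

abbreviation walk :: "'a set set \<Rightarrow> 'a list \<Rightarrow> bool" where
  "walk E \<equiv> successively (\<lambda>x y. {x, y} \<in> E)"

fun path_edges :: "'a list \<Rightarrow> 'a set set" where
  "path_edges (x # y # xs) = insert {x, y} (path_edges (y # xs))"
| "path_edges _ = {}"

lemma path_edges_nth: "path_edges xs = {{xs ! i, xs ! Suc i} | i. Suc i < length xs}"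
proof (induction xs rule: path_edges.induct)
  case (1 x y xs)
  have "{{(x # y # xs) ! i, (x # y # xs) ! Suc i} | i. Suc i < length (x # y # xs)} =
     insert {x, y} {{(y # xs) ! i, (y # xs) ! Suc i} | i. Suc i < length (y # xs)}" (is "?L = insert _ ?R")
  proof (intro equalityI subsetI)
    fix f assume "f \<in> ?L"
    then obtain i where "Suc i < length (x # y # xs)" "f = {(x # y # xs) ! i, (x # y # xs) ! Suc i}" by blast
    thus "f \<in> insert {x, y} ?R" by (cases i) auto
  next
    fix f assume "f \<in> insert {x, y} ?R"
    thus "f \<in> ?L"
    proof
      assume "f = {x, y}" thus ?thesis by (intro CollectI exI[of _ 0]) auto
    next
      assume "f \<in> ?R"
      then obtain i where "Suc i < length (y # xs)" "f = {(y # xs) ! i, (y # xs) ! Suc i}" by blast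
      thus ?thesis by (intro CollectI exI[of _ "Suc i"]) auto
    qed
  qed
  thus ?case using 1 by simp
qed auto

lemma path_edges_mid: "{x, y} \<in> path_edges (us @ x # y # vs)"
  by (induction us rule: path_edges.induct) auto

lemma walk_path_edges: "walk E xs \<longleftrightarrow> path_edges xs \<subseteq> E"
  by (induction xs rule: path_edges.induct) auto

text \<open>The positions in the list provide the isomorphism with the cycle, whose last index wraps
  around to the closing edge. Later arguments thus only have to exhibit a list of
  \<open>2 * k + 1\<close> vertices.\<close>

lemma rainbow_cycle:
  assumes gr: "finite_simple_graph (V, E)" and rb: "copies_rainbow (cycle_graph (2 * k + 1)) (V, E) c"
    and xs: "distinct xs" "length xs = 2 * k + 1" "walk E xs" "{last xs, hd xs} \<in> E"
    and fg: "f \<in> insert {last xs, hd xs} (path_edges xs)" "g \<in> insert {last xs, hd xs} (path_edges xs)" "f \<noteq> g"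
  shows "c f \<noteq> c g"
proof -
  define m where "m = 2 * k + 1"
  define F where "F = insert {last xs, hd xs} (path_edges xs)"
  have FE: "F \<subseteq> E" using xs(3,4) by (auto simp: F_def walk_path_edges)
  have ne: "xs \<noteq> []" using xs(2) by auto
  have F: "F = (\<lambda>i. {xs ! i, xs ! (Suc i mod m)}) ` {..<m}"
  proof -
    have "{..<m} = insert (m - 1) {i. Suc i < m}" using m_def by auto
    hence "(\<lambda>i. {xs ! i, xs ! (Suc i mod m)}) ` {..<m} =
        insert {xs ! (m - 1), xs ! (Suc (m - 1) mod m)} ((\<lambda>i. {xs ! i, xs ! (Suc i mod m)}) ` {i. Suc i < m})"
      by simp
    also have "(\<lambda>i. {xs ! i, xs ! (Suc i mod m)}) ` {i. Suc i < m} = path_edges xs"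
      unfolding path_edges_nth xs(2) m_def by auto
    also have "{xs ! (m - 1), xs ! (Suc (m - 1) mod m)} = {last xs, hd xs}"
      using xs(2) ne by (simp add: m_def last_conv_nth hd_conv_nth)
    finally show ?thesis by (simp add: F_def)
  qed
  have vV: "v \<in> V" if v: "v \<in> set xs" for v
  proof -
    obtain i where i: "i < m" "v = xs ! i" using v xs(2) by (auto simp: m_def in_set_conv_nth)
    hence "{v, xs ! (Suc i mod m)} \<in> E" using FE F by auto
    thus ?thesis using finite_simple_graphD(6)[OF gr] by blast
  qed
  have "finite_simple_graph (set xs, F)"
    unfolding finite_simple_graph_def
  proof (intro conjI ballI)
    fix f assume f: "f \<in> edges (set xs, F)"
    then obtain i where i: "i < m" "f = {xs ! i, xs ! (Suc i mod m)}" by (auto simp: F)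
    have "Suc i mod m < m" using m_def by simp
    thus "f \<subseteq> verts (set xs, F)" using i xs(2) by (auto simp: m_def)
    show "card f = 2" using f FE finite_simple_graphD(4)[OF gr] by auto
  qed simp
  hence "subgraph (set xs, F) (V, E)" using FE vV by (auto simp: subgraph_def)
  moreover have "graph_iso (cycle_graph m) (set xs, F)"
    unfolding graph_iso_def
  proof (intro exI[of _ "\<lambda>i. xs ! i"] conjI)
    show "bij_betw ((!) xs) (verts (cycle_graph m)) (verts (set xs, F))"
      using xs(1,2) by (auto simp: m_def cycle_graph_def intro: bij_betw_nth)
    show "edges (set xs, F) = (`) ((!) xs) ` edges (cycle_graph m)"
      by (simp add: cycle_graph_def F image_image)
  qed
  ultimately have "rainbow c (set xs, F)"
    using rb by (auto simp: m_def copies_rainbow_def is_copy_def)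
  thus ?thesis using fg by (auto simp: rainbow_def F_def inj_on_def)
qed

text \<open>Vertices of degree at most \<open>t\<close> are deleted one at a time. A deletion loses
  at most \<open>t\<close> pairs and lowers the required number by \<open>t\<close>, so the strict
  inequality survives and the process stops at a nonempty core.\<close>

lemma dense_core:
  assumes "finite P" "finite Q" "t * (card P + card Q) < card (R \<inter> P \<times> Q)"
  shows "\<exists>P' Q'. P' \<subseteq> P \<and> Q' \<subseteq> Q \<and> P' \<noteq> {} \<and> (\<forall>p\<in>P'. t < card {q \<in> Q'. (p, q) \<in> R}) \<and>
    (\<forall>q\<in>Q'. t < card {p \<in> P'. (p, q) \<in> R})"
  using assms
proof (induction "card P + card Q" arbitrary: P Q rule: less_induct)
  case less
  define s where "s = (\<lambda>P Q. \<Sum>p\<in>P. \<Sum>q\<in>Q. of_bool ((p, q) \<in> R) :: nat)"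
  have card_s: "card (R \<inter> P \<times> Q) = s P Q" if "finite P" "finite Q" for P Q
  proof -
    have "s P Q = (\<Sum>z\<in>P \<times> Q. of_bool (z \<in> R))" by (simp add: s_def sum.cartesian_product)
    also have "\<dots> = card (P \<times> Q \<inter> R)" using that by (simp add: Int_def)
    finally show ?thesis by (simp add: Int_commute)
  qed
  have row: "card {q \<in> Q. (p, q) \<in> R} = (\<Sum>q\<in>Q. of_bool ((p, q) \<in> R))" for p
    using less.prems(2) by (simp add: Int_def)
  have col: "card {p \<in> P. (p, q) \<in> R} = (\<Sum>p\<in>P. of_bool ((p, q) \<in> R))" for q
    using less.prems(1) by (simp add: Int_def)
  have fin: "finite P" "finite Q" by (fact less.prems)+
  have big: "t * (card P + card Q) < s P Q" using less.prems by (simp add: card_s)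
  consider p where "p \<in> P" "card {q \<in> Q. (p, q) \<in> R} \<le> t" | q where "q \<in> Q" "card {p \<in> P. (p, q) \<in> R} \<le> t"
    | "\<forall>p\<in>P. t < card {q \<in> Q. (p, q) \<in> R}" "\<forall>q\<in>Q. t < card {p \<in> P. (p, q) \<in> R}"
    unfolding not_le[symmetric] by blast
  thus ?case
  proof cases
    case (1 p)
    have cp: "card P = Suc (card (P - {p}))" using card.remove[OF fin(1) 1(1)] .
    have "s P Q = card {q \<in> Q. (p, q) \<in> R} + s (P - {p}) Q"
      unfolding s_def row by (rule sum.remove[OF fin(1) 1(1)])
    hence "t * (card (P - {p}) + card Q) < card (R \<inter> (P - {p}) \<times> Q)"
      using big fin 1(2) by (simp add: cp card_s)
    from less.hyps[OF _ _ _ this] obtain P' Q' where "P' \<subseteq> P - {p}" "Q' \<subseteq> Q" "P' \<noteq> {}"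
      "\<forall>p\<in>P'. t < card {q \<in> Q'. (p, q) \<in> R}" "\<forall>q\<in>Q'. t < card {p \<in> P'. (p, q) \<in> R}"
      using fin cp by auto
    thus ?thesis by (intro exI[of _ P'] exI[of _ Q']) auto
  next
    case (2 q)
    have cq: "card Q = Suc (card (Q - {q}))" using card.remove[OF fin(2) 2(1)] .
    have "s P Q = card {p \<in> P. (p, q) \<in> R} + s P (Q - {q})"
      unfolding s_def col sum.swap[of _ _ P] by (rule sum.remove[OF fin(2) 2(1)])
    hence "t * (card P + card (Q - {q})) < card (R \<inter> P \<times> (Q - {q}))"
      using big fin 2(2) by (simp add: cq card_s)
    from less.hyps[OF _ _ _ this] obtain P' Q' where "P' \<subseteq> P" "Q' \<subseteq> Q - {q}" "P' \<noteq> {}"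
      "\<forall>p\<in>P'. t < card {q \<in> Q'. (p, q) \<in> R}" "\<forall>q\<in>Q'. t < card {p \<in> P'. (p, q) \<in> R}"
      using fin cq by auto
    thus ?thesis by (intro exI[of _ P'] exI[of _ Q']) auto
  next
    case 3
    have "P \<noteq> {}" using big by (auto simp: s_def)
    thus ?thesis using 3 by (intro exI[of _ P] exI[of _ Q]) auto
  qed
qed

section \<open>Paths between prescribed ends\<close>

lemma fresh_element:
  assumes "card F < card A" "finite F"
  obtains x where "x \<in> A" "x \<notin> F"
  using assms by (metis card_mono not_le subsetI)

text \<open>In a core of sufficient minimum degree a path can be prolonged greedily by two vertices
  at a time, avoiding \<open>S\<close> and itself. In the application
  \<open>R = walk_pairs F y w\<close>, so the last two conjuncts say that the first vertex is
  adjacent to \<open>y\<close> and the last one to \<open>w\<close>: many walks of three edges yield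
  longer paths of odd length.\<close>

lemma alternating_path:
  assumes fin: "finite V" "finite S" and R: "R \<subseteq> V \<times> V" "\<And>p q. (p, q) \<in> R \<Longrightarrow> {p, q} \<in> E" "\<And>p. {p} \<notin> E"
    and big: "(card S + 2 * Suc j) * (2 * card V) < card R"
  shows "\<exists>xs. length xs = 2 * Suc j \<and> distinct xs \<and> set xs \<inter> S = {} \<and> walk E xs \<and>
    (\<exists>q. (hd xs, q) \<in> R) \<and> (\<exists>p. (p, last xs) \<in> R)"
proof -
  define t where "t = card S + 2 * Suc j"
  have "R \<inter> V \<times> V = R" using R by auto
  hence "t * (card V + card V) < card (R \<inter> V \<times> V)" using big by (simp only: t_def mult_2)
  from dense_core[OF fin(1) fin(1) this] obtain P Q where P0: "P \<noteq> {}" and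
    PQ: "\<forall>p\<in>P. t < card {q \<in> Q. (p, q) \<in> R}" "\<forall>q\<in>Q. t < card {p \<in> P. (p, q) \<in> R}"
    by blast
  have step: "\<exists>p q. p \<in> P \<and> q \<in> Q \<and> (p', q) \<in> R \<and> (p, q) \<in> R \<and> q \<notin> F \<and> p \<notin> F \<and> p \<noteq> q"
    if F: "finite F" "card F < t" "p' \<in> P" for F p'
  proof -
    have "card F < card {q \<in> Q. (p', q) \<in> R}" using bspec[OF PQ(1) F(3)] F(2) by simp
    then obtain q where q: "q \<in> Q" "(p', q) \<in> R" "q \<notin> F" using fresh_element[OF _ F(1)] by blast
    have "card F < card {p \<in> P. (p, q) \<in> R}" using bspec[OF PQ(2) q(1)] F(2) by simp
    then obtain p where p: "p \<in> P" "(p, q) \<in> R" "p \<notin> F" using fresh_element[OF _ F(1)] by blast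
    have "p \<noteq> q" using R(2)[OF p(2)] R(3)[of p] by auto
    thus ?thesis using p q by blast
  qed
  have "i \<le> j \<Longrightarrow> \<exists>xs. length xs = 2 * Suc i \<and> distinct xs \<and> set xs \<inter> S = {} \<and> walk E xs \<and> hd xs \<in> P \<and> last xs \<in> Q" for i
  proof (induction i)
    case 0
    obtain p' where "p' \<in> P" using P0 by blast
    then obtain p q where "p \<in> P" "q \<in> Q" "(p, q) \<in> R" "p \<notin> S" "q \<notin> S" "p \<noteq> q"
      using step[OF fin(2), of p'] by (auto simp: t_def)
    thus ?case using R(2) by (intro exI[of _ "[p, q]"]) auto
  next
    case (Suc i)
    then obtain xs where xs: "length xs = 2 * Suc i" "distinct xs" "set xs \<inter> S = {}" "walk E xs" "hd xs \<in> P" "last xs \<in> Q"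
      by auto
    have "card (S \<union> set xs) \<le> card S + length xs"
      using card_Un_le[of S "set xs"] card_length[of xs] by linarith
    hence "card (S \<union> set xs) < t" using xs(1) Suc.prems by (simp add: t_def)
    then obtain p q where pq: "p \<in> P" "q \<in> Q" "(hd xs, q) \<in> R" "(p, q) \<in> R" "p \<notin> S \<union> set xs" "q \<notin> S \<union> set xs" "p \<noteq> q"
      using step[of "S \<union> set xs" "hd xs"] fin xs(5) by auto
    obtain z zs where "xs = z # zs" using xs(1) by (cases xs) auto
    thus ?case using pq xs R(2)[OF pq(3)] R(2)[OF pq(4)]
      by (intro exI[of _ "p # q # xs"]) (auto simp: insert_commute)
  qed
  from this[of j] obtain xs where xs: "length xs = 2 * Suc j" "distinct xs" "set xs \<inter> S = {}" "walk E xs"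
    "hd xs \<in> P" "last xs \<in> Q" by auto
  have "{q \<in> Q. (hd xs, q) \<in> R} \<noteq> {}" using bspec[OF PQ(1) xs(5)] by (metis card.empty not_less_zero)
  moreover have "{p \<in> P. (p, last xs) \<in> R} \<noteq> {}" using bspec[OF PQ(2) xs(6)] by (metis card.empty not_less_zero)
  ultimately show ?thesis using xs by blast
qed

text \<open>Cleaning is nested twice because some cycles need two replacements: a walk of
  \<open>E''\<close> is traded for a path in \<open>E'\<close>, and an edge of that path belongs to
  a second walk, which is traded for a path in \<open>E\<close>. The condition \<open>large\<close>
  leaves room for five forbidden vertices and fewer than \<open>2 k\<close> new ones.\<close>

locale cleaned_graph =
  fixes V :: "'a set" and E E' E'' :: "'a set set" and c :: "'a set \<Rightarrow> nat" and k :: nat and \<kappa> :: real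
  assumes gr: "finite_simple_graph (V, E)" and rb: "copies_rainbow (cycle_graph (2 * k + 1)) (V, E) c"
    and k: "3 \<le> k" and sub: "E' \<subseteq> E" "E'' \<subseteq> E'"
    and walk1: "walk_rich (\<kappa> * real (card V) ^ 2) E'' E'" and walk2: "walk_rich (\<kappa> * real (card V) ^ 2) E' E"
    and large: "4 * real k + 20 < \<kappa> * real (card V)"
begin

lemmas grD = finite_simple_graphD[OF gr]

lemma connecting_path:
  assumes F: "F \<subseteq> E" and S: "length ss \<le> 5" and j: "Suc j < k"
    and w: "\<kappa> * real (card V) ^ 2 \<le> real (card (walk_pairs F y w))"
  obtains xs where "length xs = 2 * Suc j" "distinct xs" "set xs \<inter> set ss = {}" "walk F xs"
    "{y, hd xs} \<in> F" "{last xs, w} \<in> F"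
proof -
  have R: "walk_pairs F y w \<subseteq> V \<times> V" using F grD(6,7) by (auto simp: walk_pairs_def)
  have s: "{p} \<notin> F" for p using F grD(5)[of p p] by auto
  have "card V \<noteq> 0" using large by (metis mult_zero_right of_nat_0 of_nat_0_le_iff add_nonneg_nonneg mult_nonneg_nonneg not_le zero_le_numeral)
  hence cV: "real (card V) > 0" by simp
  have "card (set ss) \<le> 5" using S card_length[of ss] by linarith
  hence "(card (set ss) + 2 * Suc j) * 2 \<le> 4 * k + 20" using j by (simp add: algebra_simps)
  hence "real ((card (set ss) + 2 * Suc j) * 2) \<le> real (4 * k + 20)" using of_nat_le_iff by blast
  hence "real ((card (set ss) + 2 * Suc j) * 2) < \<kappa> * real (card V)" using large by simp
  hence "real ((card (set ss) + 2 * Suc j) * 2) * real (card V) < \<kappa> * real (card V) * real (card V)"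
    using cV by (rule mult_strict_right_mono)
  also have "\<kappa> * real (card V) * real (card V) \<le> real (card (walk_pairs F y w))"
    using w by (simp add: power2_eq_square mult_ac)
  finally have "real ((card (set ss) + 2 * Suc j) * (2 * card V)) < real (card (walk_pairs F y w))"
    by (simp add: algebra_simps)
  hence "(card (set ss) + 2 * Suc j) * (2 * card V) < card (walk_pairs F y w)" using of_nat_less_iff by blast
  from alternating_path[OF grD(1) finite_set R _ s this] obtain xs where
    "length xs = 2 * Suc j" "distinct xs" "set xs \<inter> set ss = {}" "walk F xs"
    "\<exists>q. (hd xs, q) \<in> walk_pairs F y w" "\<exists>p. (p, last xs) \<in> walk_pairs F y w"
    by (auto simp: walk_pairs_def)
  thus ?thesis using that by (auto simp: walk_pairs_def)
qed

lemma walk_mono: "walk F xs \<Longrightarrow> F \<subseteq> F' \<Longrightarrow> walk F' xs"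
  by (auto simp: walk_path_edges)

text \<open>The triangle \<open>s p q\<close> provides the right parity. The walk
  \<open>a s p q\<close> is replaced by a path \<open>a b' p' q\<close> avoiding \<open>s\<close>.
  The walk \<open>p' q s x\<close>, whose first edge is only known to lie in \<open>E'\<close>, is
  then replaced by a path with \<open>2 (k - 2)\<close> inner vertices. With \<open>s\<close> it
  closes up to a cycle \<open>s a b' p' ... x\<close>.\<close>

lemma shared_vertex_colours:
  assumes e: "{s, a} \<in> E''" "{s, x} \<in> E''" "a \<noteq> x" and t: "{s, p} \<in> E''" "{s, q} \<in> E''" "{p, q} \<in> E''"
  shows "c {s, a} \<noteq> c {s, x}"
proof -
  have E: "E'' \<subseteq> E" using sub by auto
  have ne: "s \<noteq> a" "s \<noteq> x" using e E grD(5) by blast+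
  have "\<kappa> * real (card V) ^ 2 \<le> real (card (walk_pairs E' a q))"
    using walk_richD[OF walk1, of a s p q] e t by (simp add: insert_commute)
  then obtain xs where xs: "length xs = 2 * Suc 0" "distinct xs" "set xs \<inter> {a, s, x} = {}" "walk E' xs"
    "{a, hd xs} \<in> E'" "{last xs, q} \<in> E'"
    using connecting_path[OF sub(1), of "[a, s, x]" 0 a q] k by auto
  then obtain b' p' where "xs = [b', p']"
    by (metis One_nat_def Suc_1 length_0_conv length_Suc_conv mult.right_neutral)
  hence bp: "{a, b'} \<in> E'" "{b', p'} \<in> E'" "{p', q} \<in> E'" "b' \<noteq> p'" "b' \<notin> {a, s, x}" "p' \<notin> {a, s, x}"
    using xs by auto
  have "\<kappa> * real (card V) ^ 2 \<le> real (card (walk_pairs E p' x))"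
    using walk_richD[OF walk2, of p' q s x] bp(3) e t sub by (auto simp: insert_commute)
  moreover have "Suc (k - 3) < k" using k by simp
  ultimately obtain ys where ys: "length ys = 2 * Suc (k - 3)" "distinct ys" "set ys \<inter> {s, a, b', p', x} = {}" "walk E ys"
    "{p', hd ys} \<in> E" "{last ys, x} \<in> E"
    using connecting_path[of E "[s, a, b', p', x]" "k - 3" p' x] by auto
  define zs where "zs = [s, a, b', p'] @ ys @ [x]"
  have yne: "ys \<noteq> []" using ys by auto
  show ?thesis
  proof (rule rainbow_cycle[OF gr rb, of zs])
    show "distinct zs" using ys bp ne e(3) by (auto simp: zs_def)
    show "length zs = 2 * k + 1" using ys(1) k by (simp add: zs_def)
    show "walk E zs" using ys yne bp e E sub
      by (auto simp: zs_def successively_append_iff successively_Cons)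
    show "{last zs, hd zs} \<in> E" using e E by (auto simp: zs_def insert_commute)
    show "{s, a} \<in> insert {last zs, hd zs} (path_edges zs)" by (simp add: zs_def)
    show "{s, x} \<in> insert {last zs, hd zs} (path_edges zs)" by (auto simp add: zs_def)
    show "{s, a} \<noteq> {s, x}" using e(3) by (auto simp: doubleton_eq_iff)
  qed
qed

text \<open>An edge \<open>p q\<close> would make \<open>b p q y\<close> a walk and so yield a path
  from \<open>b\<close> to \<open>y\<close> of suitable length. For disjoint edges it closes up
  through \<open>y x u a b\<close>, and for \<open>x = a\<close> through the common vertex. In the
  other coincidences the two edges share a vertex of a triangle, formed with \<open>u\<close> or by
  \<open>p\<close> and \<open>q\<close>.\<close>

lemma conflicting_edges:
  assumes ab: "{a, b} \<in> E''" and xy: "{x, y} \<in> E''" and ne: "{a, b} \<noteq> {x, y}" and col: "c {a, b} = c {x, y}"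
    and u: "{a, u} \<in> E''" "{x, u} \<in> E''" "u \<noteq> b" "u \<noteq> y" and pq: "{b, p} \<in> E''" "{y, q} \<in> E''"
  shows "{p, q} \<notin> E''"
proof
  assume "{p, q} \<in> E''"
  have E: "E'' \<subseteq> E" using sub by auto
  have d: "a \<noteq> b" "x \<noteq> y" "a \<noteq> u" "x \<noteq> u" using ab xy u E grD(5) by blast+
  have w: "\<kappa> * real (card V) ^ 2 \<le> real (card (walk_pairs E' b y))"
    using walk_richD[OF walk1, of b p q y] pq \<open>{p, q} \<in> E''\<close> by (simp add: insert_commute)
  consider "x = a" | "b = y" "x \<noteq> a" | "a = y" "x \<noteq> a" | "b = x" "x \<noteq> a" | "x \<noteq> a" "b \<noteq> y" "a \<noteq> y" "b \<noteq> x" by blast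
  thus False
  proof cases
    case 1
    have bny: "b \<noteq> y" using ne 1 by auto
    have "Suc (k - 2) < k" using k by simp
    then obtain ys where ys: "length ys = 2 * Suc (k - 2)" "distinct ys" "set ys \<inter> {a, b, y} = {}" "walk E' ys"
      "{b, hd ys} \<in> E'" "{last ys, y} \<in> E'"
      using connecting_path[OF sub(1) _ _ w, of "[a, b, y]" "k - 2"] by auto
    define zs where "zs = [a, b] @ ys @ [y]"
    have yne: "ys \<noteq> []" using ys by auto
    have "c {a, b} \<noteq> c {x, y}"
    proof (rule rainbow_cycle[OF gr rb, of zs])
      show "distinct zs" using ys d bny 1 by (auto simp: zs_def)
      show "length zs = 2 * k + 1" using ys(1) k by (simp add: zs_def)
      show "walk E zs" using walk_mono[OF ys(4) sub(1)] ys(5,6) yne ab E sub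
        by (auto simp: zs_def successively_append_iff successively_Cons)
      show "{last zs, hd zs} \<in> E" using xy E 1 by (auto simp: zs_def insert_commute)
      show "{a, b} \<in> insert {last zs, hd zs} (path_edges zs)" by (simp add: zs_def)
      show "{x, y} \<in> insert {last zs, hd zs} (path_edges zs)" using 1 by (auto simp add: zs_def)
    qed (rule ne)
    thus False using col by simp
  next
    case 2
    thus False using shared_vertex_colours[of b a x p q] ab xy pq \<open>{p, q} \<in> E''\<close> col by (auto simp: insert_commute)
  next
    case 3
    thus False using shared_vertex_colours[of a b x x u] ab xy u ne col by (auto simp: insert_commute)
  next
    case 4
    thus False using shared_vertex_colours[of b a y a u] ab xy u ne col by (auto simp: insert_commute)
  next
    case 5
    have "Suc (k - 3) < k" using k by simp
    then obtain ys where ys: "length ys = 2 * Suc (k - 3)" "distinct ys" "set ys \<inter> {u, a, b, x, y} = {}" "walk E' ys"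
      "{b, hd ys} \<in> E'" "{last ys, y} \<in> E'"
      using connecting_path[OF sub(1) _ _ w, of "[u, a, b, x, y]" "k - 3"] by auto
    \<comment> \<open>These are \<open>3 + 2 (k - 2) + 2\<close> vertices; for \<open>k = 3\<close>
      the connecting path has two inner vertices, the least number that
      \<open>connecting_path\<close> supplies.\<close>
    define zs where "zs = [u, a, b] @ ys @ [y, x]"
    have yne: "ys \<noteq> []" using ys by auto
    have "c {a, b} \<noteq> c {x, y}"
    proof (rule rainbow_cycle[OF gr rb, of zs])
      show "distinct zs" using ys d u 5 by (auto simp: zs_def)
      show "length zs = 2 * k + 1" using ys(1) k by (simp add: zs_def)
      show "walk E zs" using walk_mono[OF ys(4) sub(1)] ys(5,6) yne ab xy u E sub
        by (auto simp: zs_def successively_append_iff successively_Cons insert_commute)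
      show "{last zs, hd zs} \<in> E" using u E by (auto simp: zs_def insert_commute)
      show "{a, b} \<in> insert {last zs, hd zs} (path_edges zs)" by (simp add: zs_def)
      show "{x, y} \<in> insert {last zs, hd zs} (path_edges zs)"
        using path_edges_mid[of y x "[u, a, b] @ ys" "[]"] by (simp add: zs_def insert_commute[of y x])
    qed (rule ne)
    thus False using col by simp
  qed
qed

end

subsection \<open>Nearly bipartite graphs\<close>

text \<open>An almost complete pair inside a larger graph. By \<open>large\<close>, greedy choices
  can avoid \<open>2 k + 3\<close> vertices, more than a cycle of length \<open>2 k + 1\<close>
  occupies.\<close>

locale dense_pair =
  fixes V :: "'a set" and E :: "'a set set" and c :: "'a set \<Rightarrow> nat" and k :: nat and X Y :: "'a set" and t :: real
  assumes gr: "finite_simple_graph (V, E)" and rb: "copies_rainbow (cycle_graph (2 * k + 1)) (V, E) c"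
    and k: "3 \<le> k" and XY: "finite X" "finite Y" "X \<inter> Y = {}"
    and missX: "\<And>x. x \<in> X \<Longrightarrow> real (card (Y - nbr E x)) \<le> t"
    and missY: "\<And>y. y \<in> Y \<Longrightarrow> real (card (X - nbr E y)) \<le> t"
    and large: "2 * t + 2 * real k + 4 \<le> card X" "2 * t + 2 * real k + 4 \<le> card Y"
begin

lemmas grD = finite_simple_graphD[OF gr]

lemma common_neighbour:
  assumes x: "x \<in> X" and z: "t + 2 * real k + 4 \<le> card (nbr E z \<inter> Y)" and F: "length F \<le> 2 * k + 3"
  obtains y where "y \<in> Y" "{x, y} \<in> E" "{y, z} \<in> E" "y \<notin> set F"
proof -
  have "card (nbr E z \<inter> Y) \<le> card ((nbr E z \<inter> Y \<inter> nbr E x) \<union> (Y - nbr E x))"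
    using XY by (intro card_mono) auto
  also have "\<dots> \<le> card (nbr E z \<inter> Y \<inter> nbr E x) + card (Y - nbr E x)" by (rule card_Un_le)
  finally have "real (card (set F)) < real (card (nbr E z \<inter> Y \<inter> nbr E x))"
    using z missX[OF x] F card_length[of F] by linarith
  hence "card (set F) < card (nbr E z \<inter> Y \<inter> nbr E x)" by simp
  then obtain y where "y \<in> nbr E z \<inter> Y \<inter> nbr E x" "y \<notin> set F"
    using fresh_element[of "set F"] by blast
  thus ?thesis using that[of y] by (auto simp: insert_commute)
qed

lemma neighbourX:
  assumes "y \<in> Y" "length F \<le> 2 * k + 3"
  obtains x where "x \<in> X" "{y, x} \<in> E" "x \<notin> set F"
proof -
  have "card X \<le> card ((X \<inter> nbr E y) \<union> (X - nbr E y))" using XY by (intro card_mono) auto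
  also have "\<dots> \<le> card (X \<inter> nbr E y) + card (X - nbr E y)" by (rule card_Un_le)
  finally have "real (card X) \<le> real (card (X \<inter> nbr E y)) + real (card (X - nbr E y))" by linarith
  moreover have "0 \<le> t" using missY[OF assms(1)] by linarith
  ultimately have "real (card (set F)) < real (card (X \<inter> nbr E y))"
    using missY[OF assms(1)] large(1) assms(2) card_length[of F] by linarith
  hence "card (set F) < card (X \<inter> nbr E y)" by simp
  then obtain x where "x \<in> X \<inter> nbr E y" "x \<notin> set F"
    using fresh_element[of "set F"] by blast
  thus ?thesis using that[of x] by auto
qed

lemma neighboursX:
  assumes "x \<in> X" shows "t + 2 * real k + 4 \<le> card (nbr E x \<inter> Y)"
proof -
  have "card Y \<le> card ((nbr E x \<inter> Y) \<union> (Y - nbr E x))" using XY by (intro card_mono) auto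
  also have "\<dots> \<le> card (nbr E x \<inter> Y) + card (Y - nbr E x)" by (rule card_Un_le)
  finally have "real (card Y) \<le> real (card (nbr E x \<inter> Y)) + real (card (Y - nbr E x))" by linarith
  thus ?thesis using missX[OF assms] large(2) by linarith
qed

text \<open>Only the neighbours of \<open>z\<close> in \<open>Y\<close> matter, so \<open>z\<close>
  may lie outside of the pair. This admits atypical vertices as ends of the edge that closes the
  cycle.\<close>

lemma alternating_connection:
  assumes "x \<in> X" and z: "t + 2 * real k + 4 \<le> card (nbr E z \<inter> Y)" and "length F + 2 * l \<le> 2 * k + 1"
  shows "\<exists>xs. length xs = 2 * l + 1 \<and> distinct xs \<and> set xs \<inter> set F = {} \<and>
    {x, hd xs} \<in> E \<and> walk E xs \<and> {last xs, z} \<in> E"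
  using assms(1,3)
proof (induction l arbitrary: x F)
  case 0
  hence "length F \<le> 2 * k + 3" by simp
  then obtain y where "y \<in> Y" "{x, y} \<in> E" "{y, z} \<in> E" "y \<notin> set F"
    using common_neighbour[OF 0(1) z] by blast
  thus ?case by (intro exI[of _ "[y]"]) auto
next
  case (Suc l)
  have len: "length F \<le> 2 * k + 3" using Suc.prems by simp
  obtain y where y: "y \<in> Y" "{x, y} \<in> E" "y \<notin> set F"
    using common_neighbour[OF Suc.prems(1) neighboursX[OF Suc.prems(1)] len] by blast
  have "length (y # F) \<le> 2 * k + 3" using Suc.prems by simp
  then obtain x' where x': "x' \<in> X" "{y, x'} \<in> E" "x' \<notin> set (y # F)"
    using neighbourX[OF y(1)] by blast
  have "length (x' # y # F) + 2 * l \<le> 2 * k + 1" using Suc.prems by simp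
  from Suc.IH[OF x'(1) this] obtain xs where xs: "length xs = 2 * l + 1" "distinct xs" "set xs \<inter> set (x' # y # F) = {}"
    "{x', hd xs} \<in> E" "walk E xs" "{last xs, z} \<in> E" by blast
  have "xs \<noteq> []" using xs(1) by auto
  thus ?case using xs y x' by (intro exI[of _ "y # x' # xs"]) (auto simp: successively_Cons)
qed

text \<open>The edge \<open>p q\<close> closes an even path \<open>p b a ... a' b' q\<close> through
  both edges to an odd cycle. If they share \<open>a\<close>, the path runs through
  \<open>b a b'\<close>, and a further neighbour \<open>\<alpha>\<close> of \<open>b'\<close> leads
  back to \<open>X\<close>. If they share \<open>b\<close>, it runs through \<open>a' b a\<close>
  and is joined to \<open>p\<close> by a common neighbour \<open>\<beta>\<close>.\<close>

lemma inside_edge_colours: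
  assumes pq: "{p, q} \<in> E" and p: "t + 2 * real k + 4 \<le> card (nbr E p \<inter> Y)"
    and q: "t + 2 * real k + 4 \<le> card (nbr E q \<inter> Y)"
    and a: "a \<in> X" "a' \<in> X" "a \<notin> {p, q}" "a' \<notin> {p, q}" and b: "b \<in> Y" "b' \<in> Y" "b \<notin> {p, q}" "b' \<notin> {p, q}"
    and ab: "{a, b} \<in> E" "{a', b'} \<in> E" "(a, b) \<noteq> (a', b')" and pb: "{p, b} \<in> E" "{q, b'} \<in> E"
  shows "c {a, b} \<noteq> c {a', b'}"
proof -
  have XYne: "x \<noteq> y" if "x \<in> X" "y \<in> Y" for x y using XY(3) that by auto
  have pne: "p \<noteq> q" using pq grD(5) by blast
  have ne: "{a, b} \<noteq> {a', b'}" using ab(3) XYne[OF a(1) b(2)] XYne[OF a(2) b(1)] by (auto simp: doubleton_eq_iff)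
  have l: "2 * (k - 3) + 6 \<le> 2 * k + 1" using k by simp
  consider "a \<noteq> a'" "b \<noteq> b'" | "a = a'" "b \<noteq> b'" | "a \<noteq> a'" "b = b'" using ab(3) by auto
  thus ?thesis
  proof cases
    case 1
    obtain xs where xs: "length xs = 2 * (k - 3) + 1" "distinct xs" "set xs \<inter> set [p, q, a, a', b, b'] = {}"
      "{a, hd xs} \<in> E" "walk E xs" "{last xs, a'} \<in> E"
      using alternating_connection[OF a(1) neighboursX[OF a(2)], of "[p, q, a, a', b, b']" "k - 3"] l by auto
    have "xs \<noteq> []" using xs(1) by auto
    define zs where "zs = [p, b, a] @ xs @ [a', b', q]"
    show ?thesis
    proof (rule rainbow_cycle[OF gr rb, of zs])
      show "distinct zs" using xs 1 a b pne XYne by (auto simp: zs_def)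
      show "length zs = 2 * k + 1" using xs(1) k by (simp add: zs_def)
      show "walk E zs" using xs \<open>xs \<noteq> []\<close> ab pb
        by (auto simp: zs_def successively_append_iff successively_Cons insert_commute)
      show "{last zs, hd zs} \<in> E" using pq by (auto simp: zs_def insert_commute)
      show "{a, b} \<in> insert {last zs, hd zs} (path_edges zs)" by (simp add: zs_def insert_commute)
      show "{a', b'} \<in> insert {last zs, hd zs} (path_edges zs)"
        using path_edges_mid[of a' b' "[p, b, a] @ xs" "[q]"] by (simp add: zs_def)
    qed (rule ne)
  next
    case 2
    obtain \<alpha> where \<alpha>: "\<alpha> \<in> X" "{b', \<alpha>} \<in> E" "\<alpha> \<notin> set [p, q, a, b, b']"
      using neighbourX[OF b(2), of "[p, q, a, b, b']"] k by auto
    obtain xs where xs: "length xs = 2 * (k - 3) + 1" "distinct xs" "set xs \<inter> set [p, q, a, b, b', \<alpha>] = {}"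
      "{\<alpha>, hd xs} \<in> E" "walk E xs" "{last xs, q} \<in> E"
      using alternating_connection[OF \<alpha>(1) q, of "[p, q, a, b, b', \<alpha>]" "k - 3"] l by auto
    have "xs \<noteq> []" using xs(1) by auto
    define zs where "zs = [p, b, a, b', \<alpha>] @ xs @ [q]"
    show ?thesis
    proof (rule rainbow_cycle[OF gr rb, of zs])
      show "distinct zs" using xs 2 a b pne XYne \<alpha> by (auto simp: zs_def)
      show "length zs = 2 * k + 1" using xs(1) k by (simp add: zs_def)
      show "walk E zs" using xs \<open>xs \<noteq> []\<close> ab pb \<alpha> 2
        by (auto simp: zs_def successively_append_iff successively_Cons insert_commute)
      show "{last zs, hd zs} \<in> E" using pq by (auto simp: zs_def insert_commute)
      show "{a, b} \<in> insert {last zs, hd zs} (path_edges zs)" by (simp add: zs_def insert_commute)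
      show "{a', b'} \<in> insert {last zs, hd zs} (path_edges zs)" using 2 by (simp add: zs_def insert_commute)
    qed (rule ne)
  next
    case 3
    obtain \<beta> where \<beta>: "\<beta> \<in> Y" "{a', \<beta>} \<in> E" "{\<beta>, p} \<in> E" "\<beta> \<notin> set [p, q, a, a', b]"
      using common_neighbour[OF a(2) p, of "[p, q, a, a', b]"] k by auto
    obtain xs where xs: "length xs = 2 * (k - 3) + 1" "distinct xs" "set xs \<inter> set [p, q, a, a', b, \<beta>] = {}"
      "{a, hd xs} \<in> E" "walk E xs" "{last xs, q} \<in> E"
      using alternating_connection[OF a(1) q, of "[p, q, a, a', b, \<beta>]" "k - 3"] l by auto
    have "xs \<noteq> []" using xs(1) by auto
    define zs where "zs = [p, \<beta>, a', b, a] @ xs @ [q]"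
    show ?thesis
    proof (rule rainbow_cycle[OF gr rb, of zs])
      show "distinct zs" using xs 3 a b pne XYne \<beta> by (auto simp: zs_def)
      show "length zs = 2 * k + 1" using xs(1) k by (simp add: zs_def)
      show "walk E zs" using xs \<open>xs \<noteq> []\<close> ab pb \<beta> 3
        by (auto simp: zs_def successively_append_iff successively_Cons insert_commute)
      show "{last zs, hd zs} \<in> E" using pq by (auto simp: zs_def insert_commute)
      show "{a, b} \<in> insert {last zs, hd zs} (path_edges zs)" by (simp add: zs_def insert_commute)
      show "{a', b'} \<in> insert {last zs, hd zs} (path_edges zs)" using 3 by (simp add: zs_def insert_commute)
    qed (rule ne)
  qed
qed

lemma dense_pair_swap: "dense_pair V E c k Y X t"
  by standard (use gr rb k XY missX missY large in auto)

end

section \<open>Counting cross edges of distinct colours\<close>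

lemma card_colours_ge:
  assumes gr: "finite_simple_graph (V, E)" and P: "P \<subseteq> X \<times> Y" "X \<inter> Y = {}" "\<And>a b. (a, b) \<in> P \<Longrightarrow> {a, b} \<in> E"
    and inj: "\<And>a b a' b'. (a, b) \<in> P \<Longrightarrow> (a', b') \<in> P \<Longrightarrow> (a, b) \<noteq> (a', b') \<Longrightarrow> c {a, b} \<noteq> (c {a', b'} :: nat)"
  shows "card P \<le> card (c ` E)"
proof -
  have "inj_on (\<lambda>(a, b). c {a, b}) P" by (rule inj_onI) (use inj in fastforce)
  hence "card P = card ((\<lambda>(a, b). c {a, b}) ` P)" by (simp add: card_image)
  also have "\<dots> \<le> card (c ` E)"
    using P(3) finite_simple_graphD(2)[OF gr] by (intro card_mono) auto
  finally show ?thesis .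
qed

lemma card_pairs_ge:
  assumes "finite X" "finite Y" "\<And>y. y \<in> Y \<Longrightarrow> r \<le> real (card (X \<inter> nbr E y))"
  shows "r * real (card Y) \<le> real (card {(x, y) \<in> X \<times> Y. {x, y} \<in> E})"
proof -
  have "{(x, y) \<in> X \<times> Y. {x, y} \<in> E} = (\<Union>y\<in>Y. (\<lambda>x. (x, y)) ` (X \<inter> nbr E y))" by (auto simp: insert_commute)
  also have "card \<dots> = (\<Sum>y\<in>Y. card ((\<lambda>x. (x, y)) ` (X \<inter> nbr E y)))"
    using assms by (intro card_UN_disjoint) auto
  also have "\<dots> = (\<Sum>y\<in>Y. card (X \<inter> nbr E y))" by (intro sum.cong refl card_image) (auto simp: inj_on_def)
  finally have "real (card {(x, y) \<in> X \<times> Y. {x, y} \<in> E}) = (\<Sum>y\<in>Y. real (card (X \<inter> nbr E y)))" by simp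
  also have "\<dots> \<ge> (\<Sum>y\<in>Y. r)" by (intro sum_mono assms)
  finally show ?thesis by (simp add: mult.commute)
qed

lemma card_Diff_ge: "finite B \<Longrightarrow> real (card A) - real (card B) \<le> real (card (A - B))"
  by (metis diff_card_le_card_Diff le_diff_conv of_nat_add of_nat_le_iff diff_le_eq)

lemma nbr_restrict:
  assumes "finite B" "S \<subseteq> B"
  shows "real (card (nbr E v \<inter> B)) - real (card (B - S)) \<le> real (card (nbr E v \<inter> S))"
proof -
  have "card (nbr E v \<inter> B) \<le> card ((nbr E v \<inter> S) \<union> (B - S))" using assms finite_subset[OF assms(2,1)] by (intro card_mono) auto
  also have "\<dots> \<le> card (nbr E v \<inter> S) + card (B - S)" by (rule card_Un_le)
  finally show ?thesis by linarith
qed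

lemma most_neighbours:
  assumes "finite A" "S \<subseteq> A"
  shows "real (card S) - real (card (A - nbr E b)) \<le> real (card (S \<inter> nbr E b))"
proof -
  have "card S \<le> card ((S \<inter> nbr E b) \<union> (A - nbr E b))" using assms finite_subset[OF assms(2,1)] by (intro card_mono) auto
  also have "\<dots> \<le> card (S \<inter> nbr E b) + card (A - nbr E b)" by (rule card_Un_le)
  finally show ?thesis by linarith
qed

text \<open>\<open>A0\<close> and \<open>B0\<close> are the typical vertices, adjacent to almost all
  of the other part. The tolerance \<open>1/1000\<close> is small enough for both counts below to
  reach \<open>13/100\<close>, slightly above \<open>1/8\<close>. The condition \<open>cut\<close>
  speaks of \<open>A\<close> only; the locale is instantiated with the parts in either
  order.\<close>

locale near_bipartite =
  fixes U :: "'a set" and E :: "'a set set" and c :: "'a set \<Rightarrow> nat" and k :: nat and A B A0 B0 :: "'a set" and m :: real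
  assumes gr: "finite_simple_graph (U, E)" and rb: "copies_rainbow (cycle_graph (2 * k + 1)) (U, E) c"
    and k: "3 \<le> k" and m: "m = real (card U)" "1000 * (2 * real k + 10) \<le> m"
    and AB: "A \<union> B = U" "A \<inter> B = {}" "A0 \<subseteq> A" "B0 \<subseteq> B"
    and bal: "real (card A) \<le> (1 / 2 + 1 / 1000) * m" "real (card B) \<le> (1 / 2 + 1 / 1000) * m"
    and few: "real (card (A - A0)) \<le> m / 1000" "real (card (B - B0)) \<le> m / 1000"
    and missA: "\<And>a. a \<in> A0 \<Longrightarrow> real (card (B - nbr E a)) \<le> m / 1000"
    and missB: "\<And>b. b \<in> B0 \<Longrightarrow> real (card (A - nbr E b)) \<le> m / 1000"
    and deg: "\<And>v. v \<in> U \<Longrightarrow> (1 / 2 - 1 / 1000) * m \<le> real (card (nbr E v))"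
    and cut: "\<And>v. v \<in> A \<Longrightarrow> card (nbr E v \<inter> A) \<le> card (nbr E v \<inter> B)"
begin

lemmas grD = finite_simple_graphD[OF gr]

lemma fin: "finite A" "finite B" "finite A0" "finite B0"
  using grD(1) AB by (auto intro: finite_subset)

lemma m0: "0 < m" using m(2) by (smt (verit) of_nat_0_le_iff)

lemma cAB: "card A + card B = card U"
  using AB card_Un_disjoint[of A B] fin by auto

lemma bal': "(1 / 2 - 1 / 1000) * m \<le> real (card A)" "(1 / 2 - 1 / 1000) * m \<le> real (card B)"
  using bal cAB m(1) by (auto simp: algebra_simps)

lemma card_core: "(1 / 2 - 2 / 1000) * m \<le> real (card A0)" "(1 / 2 - 2 / 1000) * m \<le> real (card B0)"
proof -
  have "real (card A) = real (card (A - A0)) + real (card A0)"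
    using AB(3) fin by (metis add.commute card_Diff_subset card_mono le_add_diff_inverse of_nat_add)
  moreover have "real (card B) = real (card (B - B0)) + real (card B0)"
    using AB(4) fin by (metis add.commute card_Diff_subset card_mono le_add_diff_inverse of_nat_add)
  ultimately show "(1 / 2 - 2 / 1000) * m \<le> real (card A0)" "(1 / 2 - 2 / 1000) * m \<le> real (card B0)"
    using bal' few by (auto simp: algebra_simps)
qed

lemma core_pair: "dense_pair U E c k A0 B0 (m / 1000)"
proof
  show "real (card (B0 - nbr E x)) \<le> m / 1000" if "x \<in> A0" for x
  proof -
    have "card (B0 - nbr E x) \<le> card (B - nbr E x)" using AB fin by (intro card_mono) auto
    thus ?thesis using missA[OF that] by linarith
  qed
  show "real (card (A0 - nbr E y)) \<le> m / 1000" if "y \<in> B0" for y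
  proof -
    have "card (A0 - nbr E y) \<le> card (A - nbr E y)" using AB fin by (intro card_mono) auto
    thus ?thesis using missB[OF that] by linarith
  qed
  show "A0 \<inter> B0 = {}" using AB by auto
  show "2 * (m / 1000) + 2 * real k + 4 \<le> card A0" "2 * (m / 1000) + 2 * real k + 4 \<le> card B0"
    using card_core m(2) m0 by (auto simp: algebra_simps)
qed (use gr rb k fin in auto)

text \<open>Since \<open>2/5 + 2/5 - 1/2 = 3/10\<close>, the ends share about \<open>3/10 m\<close>
  neighbours in \<open>B\<close>. The edges between these and \<open>A0\<close>, about
  \<open>3/20 m^2\<close> in number, have distinct colours.\<close>

lemma colours_balanced_edge:
  assumes pq: "{p, q} \<in> E" "p \<in> A" "q \<in> A"
    and d: "2 / 5 * m \<le> real (card (nbr E p \<inter> B))" "2 / 5 * m \<le> real (card (nbr E q \<inter> B))"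
  shows "13 / 100 * m ^ 2 \<le> real (card (c ` E))"
proof -
  interpret dp: dense_pair U E c k A0 B0 "m / 1000" by (rule core_pair)
  define X where "X = A0 - {p, q}"
  define Y where "Y = B0 \<inter> nbr E p \<inter> nbr E q"
  define P where "P = {(x, y) \<in> X \<times> Y. {x, y} \<in> E}"
  have dp0: "(2 / 5 - 1 / 1000) * m \<le> real (card (nbr E p \<inter> B0))" "(2 / 5 - 1 / 1000) * m \<le> real (card (nbr E q \<inter> B0))"
    using nbr_restrict[OF fin(2) AB(4), where E = E and v = p] nbr_restrict[OF fin(2) AB(4), where E = E and v = q] few d by (auto simp: algebra_simps)
  hence big: "m / 1000 + 2 * real k + 4 \<le> real (card (nbr E p \<inter> B0))" "m / 1000 + 2 * real k + 4 \<le> real (card (nbr E q \<inter> B0))"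
    using m(2) m0 by (auto simp: algebra_simps)
  have cY: "(3 / 10 - 3 / 1000) * m \<le> real (card Y)"
  proof -
    have "card (nbr E p \<inter> B0) + card (nbr E q \<inter> B0) = card ((nbr E p \<inter> B0) \<union> (nbr E q \<inter> B0)) + card ((nbr E p \<inter> B0) \<inter> (nbr E q \<inter> B0))"
      using fin by (intro card_Un_Int) auto
    moreover have "card ((nbr E p \<inter> B0) \<union> (nbr E q \<inter> B0)) \<le> card B" using fin AB by (intro card_mono) auto
    moreover have "(nbr E p \<inter> B0) \<inter> (nbr E q \<inter> B0) = Y" by (auto simp: Y_def)
    ultimately have "real (card (nbr E p \<inter> B0)) + real (card (nbr E q \<inter> B0)) \<le> real (card B) + real (card Y)" by simp
    thus ?thesis using dp0 bal by (simp add: algebra_simps)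
  qed
  have cX: "(1 / 2 - 3 / 1000) * m \<le> real (card X)"
  proof -
    have "real (card {p, q}) \<le> 2" by (simp add: card_insert_if)
    thus ?thesis using card_Diff_ge[of "{p, q}" A0] card_core m(2) by (simp add: X_def algebra_simps)
  qed
  have row: "(1 / 2 - 4 / 1000) * m \<le> real (card (X \<inter> nbr E y))" if "y \<in> Y" for y
  proof -
    have "real (card X) - m / 1000 \<le> real (card (X \<inter> nbr E y))"
      using most_neighbours[OF fin(1), where E = E and S = X and b = y] missB[of y] that AB by (force simp: X_def Y_def)
    thus ?thesis using cX by (simp add: algebra_simps)
  qed
  have "13 / 100 * m ^ 2 \<le> (1 / 2 - 4 / 1000) * m * ((3 / 10 - 3 / 1000) * m)"
    by (simp add: power2_eq_square algebra_simps)
  also have "\<dots> \<le> (1 / 2 - 4 / 1000) * m * real (card Y)" using cY m0 by (intro mult_left_mono) auto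
  also have "\<dots> \<le> real (card P)"
    unfolding P_def by (rule card_pairs_ge) (use fin row in \<open>auto simp: X_def Y_def\<close>)
  also have "card P \<le> card (c ` E)"
  proof (rule card_colours_ge[OF gr])
    show "P \<subseteq> A0 \<times> B0" by (auto simp: P_def X_def Y_def)
    show "A0 \<inter> B0 = {}" using AB by auto
    fix a b a' b' assume ab: "(a, b) \<in> P" "(a', b') \<in> P" "(a, b) \<noteq> (a', b')"
    show "c {a, b} \<noteq> c {a', b'}"
      by (rule dp.inside_edge_colours[OF pq(1) big]) (use ab pq AB in \<open>auto simp: P_def X_def Y_def insert_commute\<close>)
  qed (auto simp: P_def)
  finally show ?thesis by simp
qed

text \<open>A degree of about \<open>m/2\<close> leaves about \<open>m/10\<close> neighbours of
  \<open>p\<close> in \<open>A\<close>, and \<open>cut\<close> ensures about \<open>m/4\<close> in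
  \<open>B\<close>. The cross edges \<open>P1\<close> at the latter are only guaranteed to number
  about \<open>m^2 / 8\<close>, with losses. The surplus comes from \<open>P2\<close>, about
  \<open>m^2 / 100\<close> cross edges from neighbours of \<open>p\<close> in \<open>A\<close> to
  non-neighbours of \<open>p\<close> in \<open>B\<close>.\<close>

lemma colours_unbalanced_vertex:
  assumes p: "p \<in> A" and d: "real (card (nbr E p \<inter> B)) \<le> 2 / 5 * m"
  shows "13 / 100 * m ^ 2 \<le> real (card (c ` E))"
proof -
  interpret dp: dense_pair U E c k A0 B0 "m / 1000" by (rule core_pair)
  interpret dq: dense_pair U E c k B0 A0 "m / 1000" by (rule dp.dense_pair_swap)
  have "nbr E p \<subseteq> A \<union> B" using grD(8) AB by auto
  hence "nbr E p = (nbr E p \<inter> A) \<union> (nbr E p \<inter> B)" by auto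
  moreover have "card ((nbr E p \<inter> A) \<union> (nbr E p \<inter> B)) = card (nbr E p \<inter> A) + card (nbr E p \<inter> B)"
    using fin AB by (intro card_Un_disjoint) auto
  ultimately have dsum: "real (card (nbr E p)) = real (card (nbr E p \<inter> A)) + real (card (nbr E p \<inter> B))"
    by (metis of_nat_add)
  have pU: "p \<in> U" using p AB by auto
  have dA: "(1 / 10 - 1 / 1000) * m \<le> real (card (nbr E p \<inter> A))"
    using dsum d deg[OF pU] by (simp add: algebra_simps)
  have dB: "(1 / 4 - 1 / 2000) * m \<le> real (card (nbr E p \<inter> B))"
    using dsum cut[OF p] deg[OF pU] by (simp add: algebra_simps)
  define P0 where "P0 = nbr E p \<inter> B0"
  define S0 where "S0 = nbr E p \<inter> A0"
  have cP: "(1 / 4 - 2 / 1000) * m \<le> real (card P0)"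
    using nbr_restrict[OF fin(2) AB(4), where E = E and v = p] dB few m0 by (auto simp: P0_def algebra_simps)
  have cS: "(1 / 10 - 2 / 1000) * m \<le> real (card S0)"
    using nbr_restrict[OF fin(1) AB(3), where E = E and v = p] dA few by (auto simp: S0_def algebra_simps)
  have bigP: "m / 1000 + 2 * real k + 4 \<le> real (card (nbr E p \<inter> B0))"
    using cP m(2) m0 by (auto simp: P0_def algebra_simps)
  have bigS: "m / 1000 + 2 * real k + 4 \<le> real (card (nbr E p \<inter> A0))"
    using cS m(2) m0 by (auto simp: S0_def algebra_simps)
  define P1 where "P1 = {(x, y) \<in> (A0 - {p}) \<times> P0. {x, y} \<in> E}"
  define P2 where "P2 = {(x, y) \<in> S0 \<times> (B0 - P0). {x, y} \<in> E}"
  have finP: "finite P1" "finite P2"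
    using fin by (auto simp: P1_def P2_def P0_def S0_def intro: finite_subset[of _ "A0 \<times> B0"])
  have c1: "(1 / 2 - 4 / 1000) * m * ((1 / 4 - 2 / 1000) * m) \<le> real (card P1)"
  proof -
    have "(1 / 2 - 4 / 1000) * m * ((1 / 4 - 2 / 1000) * m) \<le> (1 / 2 - 4 / 1000) * m * real (card P0)"
      using cP m0 by (intro mult_left_mono) auto
    also have "\<dots> \<le> real (card P1)"
      unfolding P1_def
    proof (rule card_pairs_ge)
      fix y assume "y \<in> P0"
      hence "real (card (A0 - {p})) - m / 1000 \<le> real (card ((A0 - {p}) \<inter> nbr E y))"
        using most_neighbours[OF fin(1), where E = E and S = "A0 - {p}" and b = y] missB[of y] AB by (force simp: P0_def)
      moreover have "real (card A0) - 1 \<le> real (card (A0 - {p}))" using card_Diff_ge[of "{p}" A0] by simp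
      ultimately show "(1 / 2 - 4 / 1000) * m \<le> real (card ((A0 - {p}) \<inter> nbr E y))"
        using card_core m(2) by (simp add: algebra_simps)
    qed (use fin in \<open>auto simp: P0_def\<close>)
    finally show ?thesis .
  qed
  have c2: "(1 / 10 - 3 / 1000) * m * ((1 / 10 - 2 / 1000) * m) \<le> real (card P2)"
  proof -
    have "card P0 \<le> card (nbr E p \<inter> B)" using fin AB by (intro card_mono) (auto simp: P0_def)
    hence "real (card P0) \<le> 2 / 5 * m" using d by linarith
    hence "(1 / 10 - 2 / 1000) * m \<le> real (card (B0 - P0))"
      using card_Diff_ge[of P0 B0] card_core fin by (simp add: P0_def algebra_simps)
    hence "(1 / 10 - 3 / 1000) * m * ((1 / 10 - 2 / 1000) * m) \<le> (1 / 10 - 3 / 1000) * m * real (card (B0 - P0))"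
      using m0 by (intro mult_left_mono) auto
    also have "\<dots> \<le> real (card P2)"
      unfolding P2_def
    proof (rule card_pairs_ge)
      fix y assume "y \<in> B0 - P0"
      hence "real (card S0) - m / 1000 \<le> real (card (S0 \<inter> nbr E y))"
        using most_neighbours[OF fin(1), where E = E and S = S0 and b = y] missB[of y] AB by (force simp: S0_def)
      thus "(1 / 10 - 3 / 1000) * m \<le> real (card (S0 \<inter> nbr E y))"
        using cS by (simp add: algebra_simps)
    qed (use fin in \<open>auto simp: S0_def\<close>)
    finally show ?thesis .
  qed
  \<comment> \<open>The inside edge is adapted to the two given edges: \<open>q\<close> is a
    neighbour of \<open>p\<close> in \<open>A\<close> that also sees \<open>b'\<close>.\<close>
  have first: "c {a, b} \<noteq> c {a', b'}"
    if ab: "(a, b) \<in> P1" "(a', b') \<in> P1 \<union> P2" "(a, b) \<noteq> (a', b')" for a b a' b'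
  proof -
    have b': "b' \<in> B0" using ab by (auto simp: P1_def P2_def P0_def)
    have "real (card S0) - m / 1000 \<le> real (card (S0 \<inter> nbr E b'))"
      using most_neighbours[OF fin(1), where E = E and S = S0 and b = b'] missB[OF b'] AB by (force simp: S0_def)
    hence "2 < real (card (S0 \<inter> nbr E b'))" using cS m(2) m0 by (simp add: algebra_simps)
    moreover have "card {a, a'} \<le> 2" by (simp add: card_insert_if)
    ultimately have "card {a, a'} < card (S0 \<inter> nbr E b')" by linarith
    then obtain q where q: "q \<in> S0 \<inter> nbr E b'" "q \<notin> {a, a'}" using fresh_element by blast
    have bq: "m / 1000 + 2 * real k + 4 \<le> real (card (nbr E q \<inter> B0))"
      using q by (intro dp.neighboursX) (auto simp: S0_def)
    show ?thesis
      by (rule dp.inside_edge_colours[OF _ bigP bq])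
        (use ab q p AB grD(5) in \<open>auto simp: P1_def P2_def P0_def S0_def insert_commute\<close>)
  qed
  \<comment> \<open>The sides are exchanged and \<open>p\<close> is treated as a vertex on the side
    of \<open>B\<close>: its edge to \<open>q\<close> in \<open>B\<close> becomes the inside edge,
    and the ends in \<open>S0\<close> are neighbours of \<open>p\<close> on the opposite
    side.\<close>
  have second: "c {a, b} \<noteq> c {a', b'}"
    if ab: "(a, b) \<in> P2" "(a', b') \<in> P2" "(a, b) \<noteq> (a', b')" for a b a' b'
  proof -
    have a': "a' \<in> A0" using ab by (auto simp: P2_def S0_def)
    have "real (card P0) - m / 1000 \<le> real (card (P0 \<inter> nbr E a'))"
      using most_neighbours[OF fin(2), where E = E and S = P0 and b = a'] missA[OF a'] AB by (force simp: P0_def)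
    hence "0 < real (card (P0 \<inter> nbr E a'))" using cP m0 by (simp add: algebra_simps)
    hence "P0 \<inter> nbr E a' \<noteq> {}" by auto
    then obtain q where q: "q \<in> P0" "{a', q} \<in> E" by auto
    have bq: "m / 1000 + 2 * real k + 4 \<le> real (card (nbr E q \<inter> A0))"
      using q by (intro dq.neighboursX) (auto simp: P0_def)
    have "c {b, a} \<noteq> c {b', a'}"
      by (rule dq.inside_edge_colours[OF _ bigS bq])
        (use ab q p AB grD(5) in \<open>auto simp: P2_def P0_def S0_def insert_commute\<close>)
    thus ?thesis by (simp add: insert_commute)
  qed
  have "13 / 100 * m ^ 2 \<le> (1 / 2 - 4 / 1000) * m * ((1 / 4 - 2 / 1000) * m) + (1 / 10 - 3 / 1000) * m * ((1 / 10 - 2 / 1000) * m)"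
    by (simp add: power2_eq_square algebra_simps)
  also have "\<dots> \<le> real (card P1) + real (card P2)" by (intro add_mono c1 c2)
  also have "\<dots> = real (card (P1 \<union> P2))"
  proof -
    have "P1 \<inter> P2 = {}" by (auto simp: P1_def P2_def)
    thus ?thesis using card_Un_disjoint[OF finP] by simp
  qed
  also have "card (P1 \<union> P2) \<le> card (c ` E)"
  proof (rule card_colours_ge[OF gr])
    show "P1 \<union> P2 \<subseteq> A0 \<times> B0" by (auto simp: P1_def P2_def P0_def S0_def)
    show "A0 \<inter> B0 = {}" using AB by auto
    fix a b a' b' assume ab: "(a, b) \<in> P1 \<union> P2" "(a', b') \<in> P1 \<union> P2" "(a, b) \<noteq> (a', b')"
    show "c {a, b} \<noteq> c {a', b'}"
      using ab first[of a b a' b'] first[of a' b' a b] second[of a b a' b'] by (metis UnE)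
  qed (auto simp: P1_def P2_def)
  finally show ?thesis by simp
qed

lemma colours_inside_edge:
  assumes "{p, q} \<in> E" "p \<in> A" "q \<in> A"
  shows "13 / 100 * m ^ 2 \<le> real (card (c ` E))"
  using colours_balanced_edge[OF assms] colours_unbalanced_vertex[OF assms(2)] colours_unbalanced_vertex[OF assms(3)]
  by linarith

end

section \<open>Extremal induced subgraphs and minimum partitions\<close>

lemma copies_rainbow_subgraph:
  assumes "copies_rainbow H (V, E) c" "V' \<subseteq> V" "E' \<subseteq> E"
  shows "copies_rainbow H (V', E') c"
  using assms by (fastforce simp: copies_rainbow_def is_copy_def subgraph_def)

definition induced :: "'a set set \<Rightarrow> 'a set \<Rightarrow> 'a set set" where
  "induced E U = {f \<in> E. f \<subseteq> U}"

lemma induced_graph: "finite_simple_graph (V, E) \<Longrightarrow> U \<subseteq> V \<Longrightarrow> finite_simple_graph (U, induced E U)"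
  by (auto simp: finite_simple_graph_def induced_def intro: finite_subset)

text \<open>Removing \<open>v\<close> changes the potential by \<open>\<beta> (2 |U| - 1)\<close>
  minus \<open>\<alpha>\<close> times the degree of \<open>v\<close>, which is not positive at a
  maximum. It is used with \<open>\<alpha> = 1\<close>, \<open>\<beta>\<close> just below
  \<open>1/4\<close>, for degrees near \<open>|U| / 2\<close>, and with
  \<open>\<alpha> = 3/2\<close>, \<open>\<beta>\<close> just above \<open>1/4\<close>, for degrees
  above \<open>|U| / 3\<close>.\<close>

lemma extremal_induced_subgraph:
  fixes \<alpha> \<beta> :: real
  assumes gr: "finite_simple_graph (V, E)"
  obtains U where "U \<subseteq> V" "\<alpha> * card E - \<beta> * real (card V) ^ 2 \<le> \<alpha> * card (induced E U) - \<beta> * real (card U) ^ 2"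
    "\<And>v. v \<in> U \<Longrightarrow> \<beta> * (2 * real (card U) - 1) \<le> \<alpha> * card (nbr (induced E U) v)"
proof -
  define \<phi> where "\<phi> = (\<lambda>U. \<alpha> * card (induced E U) - \<beta> * real (card U) ^ 2)"
  obtain U where U: "U \<subseteq> V" and max: "\<And>U'. U' \<subseteq> V \<Longrightarrow> \<phi> U' \<le> \<phi> U"
    by (rule obtain_maximal_subset[OF finite_simple_graphD(1)[OF gr], of \<phi>]) (rule that)
  have "induced E V = E" using finite_simple_graphD(3)[OF gr] by (auto simp: induced_def)
  hence 1: "\<alpha> * card E - \<beta> * real (card V) ^ 2 \<le> \<alpha> * card (induced E U) - \<beta> * real (card U) ^ 2"
    using max[of V] by (simp add: \<phi>_def)
  have finU: "finite U" using U finite_simple_graphD(1)[OF gr] finite_subset by auto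
  have grU: "finite_simple_graph (U, induced E U)" by (rule induced_graph[OF gr U])
  have 2: "\<beta> * (2 * real (card U) - 1) \<le> \<alpha> * card (nbr (induced E U) v)" if v: "v \<in> U" for v
  proof -
    have "induced E U = induced E (U - {v}) \<union> {f \<in> induced E U. v \<in> f}" by (auto simp: induced_def)
    moreover have "card (induced E (U - {v}) \<union> {f \<in> induced E U. v \<in> f}) = card (induced E (U - {v})) + card {f \<in> induced E U. v \<in> f}"
      using finite_simple_graphD(2)[OF gr] by (intro card_Un_disjoint) (auto simp: induced_def)
    ultimately have e: "card (induced E U) = card (induced E (U - {v})) + card (nbr (induced E U) v)"
      using card_incident[OF grU, of v] by simp
    have cU: "real (card (U - {v})) = real (card U) - 1"
      using v finU by (metis card.remove of_nat_1 of_nat_Suc add_diff_cancel_left' diff_add_cancel)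
    have "\<phi> (U - {v}) \<le> \<phi> U" using U by (intro max) auto
    thus ?thesis unfolding \<phi>_def cU e by (simp add: power2_eq_square algebra_simps)
  qed
  show ?thesis using that[OF U 1 2] .
qed

lemma card_relation:
  assumes "finite X" "finite Y"
  shows "card {(x, y) \<in> X \<times> Y. R x y} = (\<Sum>x\<in>X. card {y \<in> Y. R x y})"
proof -
  have "{(x, y) \<in> X \<times> Y. R x y} = (\<Union>x\<in>X. Pair x ` {y \<in> Y. R x y})" by auto
  also have "card \<dots> = (\<Sum>x\<in>X. card (Pair x ` {y \<in> Y. R x y}))"
    using assms by (intro card_UN_disjoint) auto
  also have "\<dots> = (\<Sum>x\<in>X. card {y \<in> Y. R x y})" by (intro sum.cong refl card_image) (auto simp: inj_on_def)
  finally show ?thesis .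
qed

definition inner_edges :: "'a set set \<Rightarrow> 'a set \<Rightarrow> 'a set \<Rightarrow> 'a set set" where
  "inner_edges E A B = {f \<in> E. f \<subseteq> A \<or> f \<subseteq> B}"

text \<open>Moving \<open>v\<close> to the other part frees the inner edges from \<open>v\<close> to
  \<open>A\<close> and creates at most those from \<open>v\<close> to \<open>B\<close>.\<close>

lemma min_cut_degree:
  assumes gr: "finite_simple_graph (U, E)" and AB: "A \<union> B = U" "A \<inter> B = {}" and v: "v \<in> A"
    and min: "card (inner_edges E A B) \<le> card (inner_edges E (A - {v}) (insert v B))"
  shows "card (nbr E v \<inter> A) \<le> card (nbr E v \<inter> B)"
proof -
  note grD = finite_simple_graphD[OF gr]
  define I where "I = inner_edges E A B"
  define Iv where "Iv = (\<lambda>y. {v, y}) ` (nbr E v \<inter> A)"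
  define Jv where "Jv = (\<lambda>y. {v, y}) ` (nbr E v \<inter> B)"
  have finI: "finite I" using grD(2) by (simp add: I_def inner_edges_def)
  have fin: "finite (nbr E v \<inter> A)" "finite (nbr E v \<inter> B)" using grD(9) by auto
  have inj: "inj_on (\<lambda>y. {v, y}) S" for S by (auto simp: inj_on_def doubleton_eq_iff)
  have IvI: "Iv \<subseteq> I" using v by (auto simp: Iv_def I_def inner_edges_def)
  have "inner_edges E (A - {v}) (insert v B) \<subseteq> (I - Iv) \<union> Jv"
  proof
    fix f assume f: "f \<in> inner_edges E (A - {v}) (insert v B)"
    hence fE: "f \<in> E" by (simp add: inner_edges_def)
    then obtain x y where xy: "f = {x, y}" "x \<noteq> y" using grD(4) by (meson card_2_iff)
    show "f \<in> (I - Iv) \<union> Jv"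
    proof (cases "v \<in> f")
      case True
      then obtain z where z: "f = {v, z}" "z \<noteq> v" using xy by auto
      hence "z \<in> B" using f by (auto simp: inner_edges_def)
      thus ?thesis using z fE by (auto simp: Jv_def)
    next
      case False
      thus ?thesis using f by (auto simp: I_def Iv_def inner_edges_def)
    qed
  qed
  hence "card (inner_edges E (A - {v}) (insert v B)) \<le> card ((I - Iv) \<union> Jv)"
    using finI fin by (intro card_mono) (auto simp: Jv_def)
  also have "\<dots> \<le> card (I - Iv) + card Jv" by (rule card_Un_le)
  also have "card (I - Iv) = card I - card Iv" using IvI finI by (intro card_Diff_subset) (auto intro: finite_subset)
  finally have "card I \<le> card I - card Iv + card Jv" using min by (simp add: I_def)
  moreover have "card Iv \<le> card I" using IvI finI by (intro card_mono)
  ultimately have "card Iv \<le> card Jv" by linarith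
  thus ?thesis by (simp add: Iv_def Jv_def card_image[OF inj])
qed

lemma missing_pairs:
  assumes gr: "finite_simple_graph (U, E)" and AB: "A \<union> B = U" "A \<inter> B = {}"
  shows "card {(a, b) \<in> A \<times> B. {a, b} \<notin> E} + card E \<le> card A * card B + card (inner_edges E A B)"
proof -
  note grD = finite_simple_graphD[OF gr]
  have fin: "finite A" "finite B" using grD(1) AB by (auto intro: finite_subset)
  define C where "C = {(a, b) \<in> A \<times> B. {a, b} \<in> E}"
  define M where "M = {(a, b) \<in> A \<times> B. {a, b} \<notin> E}"
  have finC: "finite C" using fin by (auto simp: C_def intro: finite_subset[of _ "A \<times> B"])
  have finM: "finite M" using fin by (auto simp: M_def intro: finite_subset[of _ "A \<times> B"])
  have "A \<times> B = C \<union> M" by (auto simp: C_def M_def)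
  moreover have "card (C \<union> M) = card C + card M" using finC finM by (intro card_Un_disjoint) (auto simp: C_def M_def)
  ultimately have 1: "card A * card B = card C + card M" by (metis card_cartesian_product)
  have "E \<subseteq> inner_edges E A B \<union> (\<lambda>(a, b). {a, b}) ` C"
  proof
    fix f assume f: "f \<in> E"
    then obtain x y where xy: "f = {x, y}" using grD(4) by (meson card_2_iff)
    have "x \<in> A \<union> B" "y \<in> A \<union> B" using f grD(3)[OF f] AB xy by auto
    moreover have "{x, y} \<in> E" "{y, x} \<in> E" using f xy by (auto simp: insert_commute)
    ultimately have "f \<subseteq> A \<or> f \<subseteq> B \<or> (x, y) \<in> C \<or> (y, x) \<in> C" by (auto simp: C_def xy)
    thus "f \<in> inner_edges E A B \<union> (\<lambda>(a, b). {a, b}) ` C"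
      using f by (auto simp: inner_edges_def xy insert_commute intro: rev_image_eqI)
  qed
  hence "card E \<le> card (inner_edges E A B \<union> (\<lambda>(a, b). {a, b}) ` C)"
    using grD(2) finC by (intro card_mono) (auto simp: inner_edges_def)
  also have "\<dots> \<le> card (inner_edges E A B) + card ((\<lambda>(a, b). {a, b}) ` C)" by (rule card_Un_le)
  also have "card ((\<lambda>(a, b). {a, b}) ` C) \<le> card C" by (rule card_image_le[OF finC])
  finally show ?thesis using 1 by (simp add: M_def)
qed

lemma few_atypical:
  fixes t :: real
  assumes fin: "finite A" "finite B"
  shows "t * real (card {a \<in> A. t < real (card (B - nbr E a))}) \<le> real (card {(a, b) \<in> A \<times> B. {a, b} \<notin> E})"
proof -
  define A1 where "A1 = {a \<in> A. t < real (card (B - nbr E a))}"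
  have "t * real (card A1) = (\<Sum>a\<in>A1. t)" by simp
  also have "\<dots> \<le> (\<Sum>a\<in>A1. real (card (B - nbr E a)))" by (intro sum_mono) (auto simp: A1_def)
  also have "\<dots> \<le> (\<Sum>a\<in>A. real (card (B - nbr E a)))"
    using fin by (intro sum_mono2) (auto simp: A1_def)
  also have "\<dots> = real (card {(a, b) \<in> A \<times> B. {a, b} \<notin> E})"
    by (subst card_relation[OF fin]) (simp add: set_diff_eq)
  finally show ?thesis by (simp add: A1_def)
qed

text \<open>The given partition only shows that few inner edges are possible. It is replaced by a
  partition of \<open>U\<close> with the fewest inner edges, for which the cut condition holds at
  every vertex, while the extremal choice of \<open>U\<close> supplies the minimum degree.\<close>

lemma near_bipartite_colours:
  assumes gr: "finite_simple_graph (V, E)" and rb: "copies_rainbow (cycle_graph (2 * k + 1)) (V, E) c" and k: "3 \<le> k"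
    and S: "S \<subseteq> V" and few: "real (card (inner_edges E S (V - S))) \<le> real (card V) ^ 2 / 10000000"
    and e: "real (card V) ^ 2 < 4 * real (card E)" and n: "2000 * (2 * real k + 10) \<le> real (card V)"
  shows "real (card V) ^ 2 / 8 \<le> real (card (c ` E))"
proof -
  define n where "n = real (card V)"
  obtain U where U: "U \<subseteq> V" "1 * real (card E) - (1 / 4 - 1 / 4000) * real (card V) ^ 2
      \<le> 1 * real (card (induced E U)) - (1 / 4 - 1 / 4000) * real (card U) ^ 2"
    "\<And>v. v \<in> U \<Longrightarrow> (1 / 4 - 1 / 4000) * (2 * real (card U) - 1) \<le> 1 * real (card (nbr (induced E U) v))"
    by (rule extremal_induced_subgraph[OF gr, where \<alpha> = 1 and \<beta> = "1 / 4 - 1 / 4000"]) (rule that)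
  define F where "F = induced E U"
  define m where "m = real (card U)"
  have grF: "finite_simple_graph (U, F)" unfolding F_def by (rule induced_graph[OF gr U(1)])
  note grD = finite_simple_graphD[OF grF]
  have FE: "F \<subseteq> E" by (auto simp: F_def induced_def)
  have rbF: "copies_rainbow (cycle_graph (2 * k + 1)) (U, F) c" by (rule copies_rainbow_subgraph[OF rb U(1) FE])
  have finV: "finite V" using finite_simple_graphD(1)[OF gr] .
  have mn: "m \<le> n" using U(1) finV by (simp add: m_def n_def card_mono)
  have m0: "0 \<le> m" by (simp add: m_def)
  have mn2: "m ^ 2 \<le> n ^ 2" using mn m0 by (intro power_mono)
  \<comment> \<open>As the weight is below \<open>1/4\<close> and \<open>m \<le> n\<close>, the
    surplus over a quarter of the square survives in \<open>U\<close>, which later forces an inner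
    edge. The additional term \<open>(n^2 - m^2) / 4000\<close> shows that \<open>U\<close> is
    almost everything.\<close>
  have eF: "m ^ 2 / 4 + n ^ 2 / 4000 - m ^ 2 / 4000 < real (card F)"
    using U(2) e unfolding F_def[symmetric] m_def[symmetric] n_def[symmetric] by (simp add: field_simps)
  have fewF: "real (card (inner_edges F A' (U - A'))) \<le> n ^ 2 / 10000000" if "A' = S \<inter> U" for A'
  proof -
    have "inner_edges F A' (U - A') \<subseteq> inner_edges E S (V - S)"
      using that U(1) by (auto simp: inner_edges_def F_def induced_def)
    hence "card (inner_edges F A' (U - A')) \<le> card (inner_edges E S (V - S))"
      using finite_simple_graphD(2)[OF gr] by (intro card_mono) (auto simp: inner_edges_def)
    thus ?thesis using few unfolding n_def by linarith
  qed
  obtain A where A: "A \<subseteq> U" "\<And>A'. A' \<subseteq> U \<Longrightarrow> card (inner_edges F A (U - A)) \<le> card (inner_edges F A' (U - A'))"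
    using obtain_maximal_subset[OF grD(1), of "\<lambda>A. - int (card (inner_edges F A (U - A)))"]
    by (metis neg_le_iff_le of_nat_le_iff)
  have "card (inner_edges F A (U - A)) \<le> card (inner_edges F (S \<inter> U) (U - (S \<inter> U)))" by (rule A(2)) auto
  hence mono: "real (card (inner_edges F A (U - A))) \<le> n ^ 2 / 10000000" using fewF[OF refl] by linarith
  define pr where "pr = (\<lambda>(X :: 'a set) (Y :: 'a set). real (card X) * real (card Y))"
  have prod: "4 * pr X Y \<le> m ^ 2" if "X \<union> Y = U" "X \<inter> Y = {}" for X Y
  proof -
    have "card X + card Y = card U" using that card_Un_disjoint[of X Y] grD(1) by (metis finite_Un)
    hence "m = real (card X) + real (card Y)" by (simp add: m_def)
    thus ?thesis using zero_le_power2[of "real (card X) - real (card Y)"]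
      by (simp add: pr_def power2_eq_square algebra_simps)
  qed
  have miss: "real (card {(a, b) \<in> X \<times> Y. {a, b} \<notin> F}) + real (card F) \<le> pr X Y + n ^ 2 / 10000000"
    if XY: "X \<union> Y = U" "X \<inter> Y = {}" "inner_edges F X Y = inner_edges F A (U - A)" for X Y
  proof -
    have "real (card {(a, b) \<in> X \<times> Y. {a, b} \<notin> F} + card F) \<le> real (card X * card Y + card (inner_edges F X Y))"
      by (intro of_nat_mono missing_pairs[OF grF XY(1,2)])
    thus ?thesis using mono XY(3) by (simp add: pr_def)
  qed
  \<comment> \<open>At most \<open>m^2 / 4 + n^2 / 10^7\<close> edges are possible, so
    \<open>n^2 - m^2\<close> is at most \<open>4000 / 10^7\<close> of \<open>n^2\<close>.\<close>
  have m_large: "9996 / 10000 * n ^ 2 \<le> m ^ 2"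
  proof -
    have 1: "A \<union> (U - A) = U" "A \<inter> (U - A) = {}" using A(1) by auto
    have "0 \<le> real (card {(a, b) \<in> A \<times> (U - A). {a, b} \<notin> F})" by simp
    thus ?thesis using miss[OF 1 refl] prod[OF 1] eF by linarith
  qed
  have mn_half: "n / 2 \<le> m"
  proof (rule ccontr)
    assume "\<not> ?thesis"
    hence "m ^ 2 \<le> (n / 2) ^ 2" using m0 by (intro power_mono) auto
    hence "m ^ 2 \<le> n ^ 2 / 4" by (simp add: power_divide)
    moreover have "0 < n ^ 2" using n by (simp add: n_def)
    ultimately show False using m_large by linarith
  qed
  have mk: "1000 * (2 * real k + 10) \<le> m" using mn_half n by (simp add: n_def)
  have nb: "near_bipartite U F c k X Y {a \<in> X. real (card (Y - nbr F a)) \<le> m / 1000} {b \<in> Y. real (card (X - nbr F b)) \<le> m / 1000} m"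
    if XY: "X \<union> Y = U" "X \<inter> Y = {}" and inX: "X = A \<and> Y = U - A \<or> X = U - A \<and> Y = A" for X Y
  proof -
    have fin: "finite X" "finite Y" using XY(1) grD(1) by auto
    have mono': "inner_edges F X Y = inner_edges F A (U - A)"
      using inX A(1) by (auto simp: inner_edges_def)
    have card: "m = real (card X) + real (card Y)"
      using XY card_Un_disjoint[OF fin] by (simp add: m_def)
    have ms: "real (card {(a, b) \<in> X \<times> Y. {a, b} \<notin> F}) \<le> n ^ 2 / 10000000"
      using miss[OF XY mono'] prod[OF XY] eF mn2 by linarith
    have ms': "real (card {(a, b) \<in> Y \<times> X. {a, b} \<notin> F}) \<le> n ^ 2 / 10000000"
    proof -
      have "inner_edges F Y X = inner_edges F A (U - A)"
        using mono' by (auto simp: inner_edges_def)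
      moreover have 1: "Y \<union> X = U" "Y \<inter> X = {}" using XY by auto
      ultimately show ?thesis using miss[of Y X] prod[OF 1] eF mn2 by linarith
    qed
    have "m ^ 2 / 4 - n ^ 2 / 10000000 \<le> pr X Y"
      using miss[OF XY mono'] eF mn2 by linarith
    hence sq: "(real (card X) - real (card Y)) ^ 2 \<le> 4 * (n ^ 2 / 10000000)"
      unfolding card by (simp add: pr_def power2_eq_square algebra_simps)
    have "(m / 500) ^ 2 = m ^ 2 / 250000" by (simp add: power_divide)
    hence "4 * (n ^ 2 / 10000000) \<le> (m / 500) ^ 2" using m_large zero_le_power2[of n] by linarith
    hence "(real (card X) - real (card Y)) ^ 2 \<le> (m / 500) ^ 2" using sq by linarith
    hence "\<bar>real (card X) - real (card Y)\<bar> \<le> m / 500" using m0 by (metis abs_le_square_iff abs_of_nonneg zero_le_divide_iff zero_le_numeral)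
    hence bal: "real (card X) \<le> (1 / 2 + 1 / 1000) * m" "real (card Y) \<le> (1 / 2 + 1 / 1000) * m"
      using card by (auto simp: field_simps abs_if split: if_splits)
    have small: "real x \<le> m / 1000" if x: "m / 1000 * real x \<le> n ^ 2 / 10000000" for x :: nat
    proof -
      have "m / 1000 * (m / 1000) = m ^ 2 / 1000000" by (simp add: power2_eq_square)
      hence "m / 1000 * real x \<le> m / 1000 * (m / 1000)"
        using x m_large zero_le_power2[of n] by linarith
      moreover have "0 < m / 1000" using mk by (smt (verit) divide_pos_pos of_nat_0_le_iff)
      ultimately show ?thesis by (rule mult_left_le_imp_le)
    qed
    show ?thesis
    proof
      show "real (card (X - {a \<in> X. real (card (Y - nbr F a)) \<le> m / 1000})) \<le> m / 1000"
      proof -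
        have "X - {a \<in> X. real (card (Y - nbr F a)) \<le> m / 1000} = {a \<in> X. m / 1000 < real (card (Y - nbr F a))}" by auto
        thus ?thesis using few_atypical[OF fin, of "m / 1000" F] ms by (intro small) simp
      qed
      show "real (card (Y - {b \<in> Y. real (card (X - nbr F b)) \<le> m / 1000})) \<le> m / 1000"
      proof -
        have "Y - {a \<in> Y. real (card (X - nbr F a)) \<le> m / 1000} = {a \<in> Y. m / 1000 < real (card (X - nbr F a))}" by auto
        thus ?thesis using few_atypical[OF fin(2,1), of "m / 1000" F] ms' by (intro small) simp
      qed
      show "(1 / 2 - 1 / 1000) * m \<le> real (card (nbr F v))" if "v \<in> U" for v
        using U(3)[OF that] mk unfolding F_def[symmetric] m_def[symmetric] by (simp add: algebra_simps)
      show "card (nbr F v \<inter> X) \<le> card (nbr F v \<inter> Y)" if v: "v \<in> X" for v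
      proof (rule min_cut_degree[OF grF XY v])
        have "\<exists>A'. A' \<subseteq> U \<and> inner_edges F (X - {v}) (insert v Y) = inner_edges F A' (U - A')"
        proof (rule exI[of _ "X - {v}"], intro conjI)
          have "U - (X - {v}) = insert v Y" using XY v by auto
          thus "inner_edges F (X - {v}) (insert v Y) = inner_edges F (X - {v}) (U - (X - {v}))" by simp
        qed (use XY in auto)
        thus "card (inner_edges F X Y) \<le> card (inner_edges F (X - {v}) (insert v Y))"
          using A(2) mono' by metis
      qed
    qed (use grF rbF k XY bal mk in \<open>auto simp: m_def\<close>)
  qed
  have "\<exists>X Y p q. X \<union> Y = U \<and> X \<inter> Y = {} \<and> (X = A \<and> Y = U - A \<or> X = U - A \<and> Y = A) \<and> {p, q} \<in> F \<and> p \<in> X \<and> q \<in> X"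
  proof -
    have "real (card (A \<times> (U - A))) < real (card F)"
    proof -
      have 1: "A \<union> (U - A) = U" "A \<inter> (U - A) = {}" using A(1) by auto
      have "real (card (A \<times> (U - A))) = pr A (U - A)" by (simp add: card_cartesian_product pr_def)
      thus ?thesis using prod[OF 1] eF mn2 by linarith
    qed
    hence "card A * card (U - A) < card F" unfolding card_cartesian_product by (simp only: of_nat_less_iff)
    moreover have "card {(a, b) \<in> A \<times> (U - A). {a, b} \<notin> F} + card F \<le> card A * card (U - A) + card (inner_edges F A (U - A))"
      using A(1) by (intro missing_pairs[OF grF]) auto
    ultimately have "card (inner_edges F A (U - A)) \<noteq> 0" by linarith
    then obtain f where f: "f \<in> F" "f \<subseteq> A \<or> f \<subseteq> U - A"
      unfolding inner_edges_def by (metis (mono_tags, lifting) card.empty equals0I mem_Collect_eq)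
    then obtain p q where pq: "f = {p, q}" using grD(4) by (meson card_2_iff)
    from f(2) show ?thesis
    proof
      assume "f \<subseteq> A"
      thus ?thesis using pq f(1) A(1) by (intro exI[of _ A] exI[of _ "U - A"] exI[of _ p] exI[of _ q]) auto
    next
      assume "f \<subseteq> U - A"
      thus ?thesis using pq f(1) A(1) by (intro exI[of _ "U - A"] exI[of _ A] exI[of _ p] exI[of _ q]) auto
    qed
  qed
  then obtain X Y p q where XY: "X \<union> Y = U" "X \<inter> Y = {}" "X = A \<and> Y = U - A \<or> X = U - A \<and> Y = A"
    and pq: "{p, q} \<in> F" "p \<in> X" "q \<in> X" by blast
  have "13 / 100 * m ^ 2 \<le> real (card (c ` F))"
    using near_bipartite.colours_inside_edge[OF nb[OF XY] pq] .
  also have "card (c ` F) \<le> card (c ` E)"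
    using FE finite_simple_graphD(2)[OF gr] by (intro card_mono image_mono) auto
  finally have "13 / 100 * m ^ 2 \<le> real (card (c ` E))" by simp
  thus ?thesis using m_large zero_le_power2[of n] unfolding n_def[symmetric] by linarith
qed

subsection \<open>The lower bound\<close>

text \<open>An edge inside \<open>I\<close> or inside \<open>U - I\<close> has an end outside of
  \<open>I \<union> J\<close>, because \<open>I\<close> and \<open>J\<close> are independent; so the
  outer degrees bound the number of such edges.\<close>

lemma bipartite_part_bound:
  assumes gr: "finite_simple_graph (U, E)" and "independent_pair U E I J"
  shows "card E \<le> card (E - inner_edges E I (U - I)) + (\<Sum>p\<in>U - (I \<union> J). card (nbr E p))"
    and "4 * card (E - inner_edges E I (U - I)) \<le> (card U) ^ 2"
proof -
  note grD = finite_simple_graphD[OF gr]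
  have IJ: "I \<subseteq> U" "J \<subseteq> U" "I \<inter> J = {}" "\<forall>p\<in>I. \<forall>q\<in>I. {p, q} \<notin> E" "\<forall>p\<in>J. \<forall>q\<in>J. {p, q} \<notin> E"
    using assms(2) by (auto simp: independent_pair_def)
  have fin: "finite (U - (I \<union> J))" "finite I" "finite (U - I)" using grD(1) IJ by (auto intro: finite_subset)
  have mono: "inner_edges E I (U - I) \<subseteq> (\<Union>p\<in>U - (I \<union> J). {f \<in> E. p \<in> f})"
  proof
    fix f assume f: "f \<in> inner_edges E I (U - I)"
    hence fE: "f \<in> E" by (simp add: inner_edges_def)
    then obtain x y where xy: "f = {x, y}" using grD(4) by (meson card_2_iff)
    have U: "x \<in> U" "y \<in> U" using grD(3)[OF fE] xy by auto
    have "\<not> (x \<in> I \<and> y \<in> I)" "\<not> (x \<in> J \<and> y \<in> J)" using IJ(4,5) fE xy by auto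
    hence "x \<notin> I \<and> y \<notin> I" "\<not> (x \<in> J \<and> y \<in> J)"
      using f xy U by (auto simp: inner_edges_def)
    thus "f \<in> (\<Union>p\<in>U - (I \<union> J). {f \<in> E. p \<in> f})" using U xy fE by auto
  qed
  have "card (inner_edges E I (U - I)) \<le> card (\<Union>p\<in>U - (I \<union> J). {f \<in> E. p \<in> f})"
    using mono fin(1) grD(2) by (intro card_mono) auto
  also have "\<dots> \<le> (\<Sum>p\<in>U - (I \<union> J). card {f \<in> E. p \<in> f})" by (rule card_UN_le[OF fin(1)])
  finally have 1: "card (inner_edges E I (U - I)) \<le> (\<Sum>p\<in>U - (I \<union> J). card (nbr E p))"
    by (simp add: card_incident[OF gr])
  have "card (E - inner_edges E I (U - I)) = card E - card (inner_edges E I (U - I))"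
    using grD(2) by (intro card_Diff_subset) (auto simp: inner_edges_def)
  thus "card E \<le> card (E - inner_edges E I (U - I)) + (\<Sum>p\<in>U - (I \<union> J). card (nbr E p))"
    using 1 by linarith
  have "E - inner_edges E I (U - I) \<subseteq> (\<lambda>(a, b). {a, b}) ` (I \<times> (U - I))"
  proof
    fix f assume f: "f \<in> E - inner_edges E I (U - I)"
    then obtain x y where xy: "f = {x, y}" using grD(4) by (meson DiffD1 card_2_iff)
    have "x \<in> U" "y \<in> U" using grD(3)[of f] f xy by auto
    hence "(x, y) \<in> I \<times> (U - I) \<or> (y, x) \<in> I \<times> (U - I)"
      using f xy by (auto simp: inner_edges_def)
    thus "f \<in> (\<lambda>(a, b). {a, b}) ` (I \<times> (U - I))" using xy by (auto simp: insert_commute intro: rev_image_eqI)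
  qed
  hence "card (E - inner_edges E I (U - I)) \<le> card ((\<lambda>(a, b). {a, b}) ` (I \<times> (U - I)))"
    using fin by (intro card_mono) auto
  also have "\<dots> \<le> card (I \<times> (U - I))" using fin by (intro card_image_le) auto
  also have "\<dots> = card I * card (U - I)" by (rule card_cartesian_product)
  finally have 2: "card (E - inner_edges E I (U - I)) \<le> card I * card (U - I)" .
  have "card U = card I + card (U - I)"
    using IJ(1) grD(1) by (metis card_Diff_subset card_mono finite_subset le_add_diff_inverse)
  moreover have "4 * (a * b) \<le> (a + b) ^ 2" for a b :: nat
  proof -
    have "4 * (int a * int b) \<le> (int a + int b) ^ 2"
      using zero_le_power2[of "int a - int b"] by (simp add: power2_eq_square algebra_simps)
    hence "int (4 * (a * b)) \<le> int ((a + b) ^ 2)" by simp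
    thus ?thesis by (simp only: of_nat_le_iff)
  qed
  ultimately have "4 * (card I * card (U - I)) \<le> (card U) ^ 2" by simp
  thus "4 * card (E - inner_edges E I (U - I)) \<le> (card U) ^ 2" using 2 by linarith
qed

lemma colours_lower_bound:
  fixes \<eta> :: real
  assumes k: "3 \<le> k" and \<eta>: "0 < \<eta>"
  shows "\<exists>n0. \<forall>(V :: 'a set) E c. finite_simple_graph (V, E) \<longrightarrow> n0 \<le> card V \<longrightarrow>
    copies_rainbow (cycle_graph (2 * k + 1)) (V, E) c \<longrightarrow>
    nat \<lfloor>real (card V) ^ 2 / 4\<rfloor> + 1 \<le> card E \<longrightarrow>
    (1 / 8 - \<eta>) * real (card V) ^ 2 \<le> real (card (c ` E))"
proof -
  \<comment> \<open>\<open>\<theta>\<close> is the error of the counting, small enough for at most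
    \<open>n^2 / 10^7\<close> inner edges in the bipartite branch. The choice of
    \<open>\<mu>\<close> gives \<open>\<theta>^2 / 2 = 8 \<mu>\<close>, which exceeds the loss
    \<open>16/3 \<mu>\<close> in the number of edges. The two cleanings lose
    \<open>8 \<epsilon> n^2\<close> edges of weight \<open>3/2\<close>, hence
    \<open>12 \<epsilon> = \<mu>\<close>.\<close>
  define \<theta> where "\<theta> = min (\<eta> / 2) (1 / 10 ^ 8)"
  define \<mu> where "\<mu> = \<theta> ^ 2 / 16"
  define \<epsilon> where "\<epsilon> = \<mu> / 12"
  have \<theta>: "0 < \<theta>" "\<theta> \<le> \<eta> / 2" "\<theta> \<le> 1 / 100000000" using \<eta> by (auto simp: \<theta>_def)
  have \<mu>: "0 < \<mu>" "16 * \<mu> = \<theta> ^ 2" using \<theta> by (auto simp: \<mu>_def)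
  have "\<theta> ^ 2 \<le> \<theta> * (1 / 100000000)" unfolding power2_eq_square using \<theta> by (intro mult_left_mono) auto
  hence \<mu>\<theta>: "1600000000 * \<mu> \<le> \<theta>" using \<mu> by linarith
  have \<epsilon>: "0 < \<epsilon>" "12 * \<epsilon> = \<mu>" using \<mu> by (auto simp: \<epsilon>_def)
  obtain \<kappa> where \<kappa>: "0 < \<kappa>" and clean: "\<And>(V :: 'a set) E. finite_simple_graph (V, E) \<Longrightarrow> (\<exists>E'\<subseteq>E.
     real (card (E - E')) \<le> 4 * \<epsilon> * real (card V) ^ 2 \<and>
     walk_rich (\<kappa> * real (card V) ^ 2) E' E)"
    using walk_cleaning[OF \<epsilon>(1), where 'a = 'a] by blast
  \<comment> \<open>\<open>q1\<close> makes room for the greedy paths. \<open>q2\<close> makes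
    \<open>m \<theta>^2\<close> large although \<open>m\<close> is only known to be at least
    \<open>n / 3\<close>, both for the counting and to gain the additive 6 in the degree
    condition.\<close>
  define q1 q2 where "q1 = (4 * real k + 20) / \<kappa>" and "q2 = 160 / \<theta> ^ 2"
  define a1 a2 where "a1 = nat \<lceil>q1\<rceil>" and "a2 = nat \<lceil>q2\<rceil>"
  define n0 where "n0 = a1 + a2 + 4000 * k + 120001"
  have exact: "(1 / 8 - \<eta>) * real (card V) ^ 2 \<le> real (card (c ` E))"
    if gr: "finite_simple_graph (V, E)" and n: "n0 \<le> card V" and rb: "copies_rainbow (cycle_graph (2 * k + 1)) (V, E) c"
      and e: "real (card V) ^ 2 < 4 * real (card E)" "4 * real (card E) \<le> real (card V) ^ 2 + 4" for V :: "'a set" and E c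
  proof -
    define n where "n = real (card V)"
    have "real a1 + real a2 + 4000 * real k + 120001 \<le> n" using n by (simp add: n_def n0_def)
    moreover have "q1 \<le> real a1" "q2 \<le> real a2" "0 \<le> real a1" "0 \<le> real a2" "0 \<le> real k"
      unfolding a1_def a2_def by linarith+
    ultimately have nn: "q1 < n" "q2 < n" "4000 * real k + 20000 \<le> n" "100000 \<le> n"
      by linarith+
    have nk: "4 * real k + 20 < \<kappa> * n" using nn(1) \<kappa> by (simp add: q1_def pos_divide_less_eq mult.commute)
    have nt: "160 < n * \<theta> ^ 2" using nn(2) \<theta> by (simp add: q2_def pos_divide_less_eq)
    obtain E' where E': "E' \<subseteq> E" "real (card (E - E')) \<le> 4 * \<epsilon> * n ^ 2" "walk_rich (\<kappa> * n ^ 2) E' E"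
      using clean[OF gr] unfolding n_def by blast
    have gr': "finite_simple_graph (V, E')" using gr E'(1) by (auto simp: finite_simple_graph_def)
    obtain E'' where E'': "E'' \<subseteq> E'" "real (card (E' - E'')) \<le> 4 * \<epsilon> * n ^ 2" "walk_rich (\<kappa> * n ^ 2) E'' E'"
      using clean[OF gr'] unfolding n_def by blast
    have gr'': "finite_simple_graph (V, E'')" using gr' E''(1) by (auto simp: finite_simple_graph_def)
    interpret cg: cleaned_graph V E E' E'' c k \<kappa>
      by standard (use gr rb k E' E'' nk in \<open>auto simp: n_def\<close>)
    have finE: "finite E" using finite_simple_graphD(2)[OF gr] .
    have eE'': "real (card E) - 8 * \<epsilon> * n ^ 2 \<le> real (card E'')"
    proof -
      have "card E = card (E - E') + card E'"
        using E'(1) finE by (metis add.commute card_Diff_subset card_mono finite_subset le_add_diff_inverse)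
      moreover have "card E' = card (E' - E'') + card E''"
        using E'(1) E''(1) finE by (metis add.commute card_Diff_subset card_mono finite_subset le_add_diff_inverse)
      ultimately have "real (card E) = real (card (E - E')) + real (card (E' - E'')) + real (card E'')" by simp
      thus ?thesis using E'(2) E''(2) by linarith
    qed
    obtain U where U: "U \<subseteq> V" "3 / 2 * real (card E'') - (1 / 4 + \<mu>) * real (card V) ^ 2
        \<le> 3 / 2 * real (card (induced E'' U)) - (1 / 4 + \<mu>) * real (card U) ^ 2"
      "\<And>v. v \<in> U \<Longrightarrow> (1 / 4 + \<mu>) * (2 * real (card U) - 1) \<le> 3 / 2 * real (card (nbr (induced E'' U) v))"
      by (rule extremal_induced_subgraph[OF gr'', where \<alpha> = "3 / 2" and \<beta> = "1 / 4 + \<mu>"]) (rule that)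
    define H where "H = induced E'' U"
    define m where "m = real (card U)"
    have grH: "finite_simple_graph (U, H)" unfolding H_def by (rule induced_graph[OF gr'' U(1)])
    have HE'': "H \<subseteq> E''" by (auto simp: H_def induced_def)
    have HE: "H \<subseteq> E" using HE'' E'(1) E''(1) by blast
    have finV: "finite V" using finite_simple_graphD(1)[OF gr] .
    have mn: "m \<le> n" using U(1) finV by (simp add: m_def n_def card_mono)
    have m0: "0 \<le> m" by (simp add: m_def)
    have mn2: "m ^ 2 \<le> n ^ 2" using mn m0 by (intro power_mono)
    have n2: "10000000000 \<le> n ^ 2"
    proof -
      have "100000 ^ 2 \<le> n ^ 2" using nn(4) by (intro power_mono) auto
      thus ?thesis by simp
    qed
    \<comment> \<open>The main term is \<open>3/2 * 1/4 - 1/4 = 1/8\<close>; cleaning costs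
      \<open>12 \<epsilon> = \<mu>\<close>, and the raised weight costs another
      \<open>\<mu>\<close>.\<close>
    have T: "3 / 2 * real (card H) - m ^ 2 / 4 \<ge> n ^ 2 / 8 - 2 * \<mu> * n ^ 2"
    proof -
      have "3 / 2 * real (card E'') - n ^ 2 / 4 - \<mu> * n ^ 2 \<le> 3 / 2 * real (card H) - m ^ 2 / 4 - \<mu> * m ^ 2"
        using U(2) unfolding H_def[symmetric] m_def[symmetric] n_def[symmetric] by (simp add: algebra_simps)
      moreover have "0 \<le> \<mu> * m ^ 2" using \<mu> by simp
      moreover have "8 * \<epsilon> * n ^ 2 = 2 / 3 * (\<mu> * n ^ 2)" using \<epsilon>(2) by simp
      moreover have "n ^ 2 < 4 * real (card E)" using e(1) by (simp add: n_def)
      ultimately show ?thesis using eE'' by linarith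
    qed
    have lam_n: "0 \<le> \<mu> * n ^ 2" "1600000000 * (\<mu> * n ^ 2) \<le> \<theta> * n ^ 2"
      using \<mu> mult_right_mono[OF \<mu>\<theta>, of "n ^ 2"] by auto
    have th_n: "0 \<le> \<theta> * n ^ 2" "\<theta> * n ^ 2 \<le> n ^ 2 / 100000000"
      using \<theta> mult_right_mono[OF \<theta>(3), of "n ^ 2"] by auto
    have th_mn: "\<theta> * m ^ 2 \<le> \<theta> * n ^ 2" using mn2 \<theta> by (intro mult_left_mono) auto
    have eH2: "2 * real (card H) \<le> m ^ 2"
    proof -
      have "2 * card H = (\<Sum>x\<in>U. card {f \<in> H. x \<in> f})" by (rule handshake[OF grH order.refl, symmetric])
      also have "\<dots> = (\<Sum>x\<in>U. card (nbr H x))" by (simp add: card_incident[OF grH])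
      also have "\<dots> \<le> (\<Sum>x\<in>U. card U)"
        using finite_simple_graphD[OF grH] by (intro sum_mono card_mono) auto
      finally have "2 * card H \<le> card U * card U" by simp
      hence "real (2 * card H) \<le> real (card U * card U)" by (simp only: of_nat_le_iff)
      thus ?thesis by (simp add: m_def power2_eq_square)
    qed
    have m_third: "n / 3 \<le> m"
    proof (rule ccontr)
      assume "\<not> ?thesis"
      hence "m ^ 2 \<le> (n / 3) ^ 2" using m0 by (intro power_mono) auto
      hence "m ^ 2 \<le> n ^ 2 / 9" by (simp add: power_divide)
      thus False using T eH2 lam_n th_n n2 by linarith
    qed
    have mt: "17 < m * \<theta> ^ 2"
    proof -
      have "n / 3 * \<theta> ^ 2 \<le> m * \<theta> ^ 2" using m_third by (intro mult_right_mono) auto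
      thus ?thesis using nt by simp
    qed
    have conf: "conflict_graph U H c"
    proof
      show "finite_simple_graph (U, H)" by (rule grH)
      show "card U + 6 < 3 * card (nbr H v)" if "v \<in> U" for v
      proof -
        have "(1 / 4 + \<mu>) * (2 * m - 1) = m / 2 + 2 * (\<mu> * m) - 1 / 4 - \<mu>" by (simp add: algebra_simps)
        moreover have "\<mu> * m = m * \<theta> ^ 2 / 16" by (simp add: \<mu>_def)
        moreover have "160 / 3 < m * \<theta> ^ 2"
        proof -
          have "n / 3 * \<theta> ^ 2 \<le> m * \<theta> ^ 2" using m_third by (intro mult_right_mono) auto
          thus ?thesis using nt by simp
        qed
        ultimately have "m + 6 < 3 * real (card (nbr H v))"
          using U(3)[OF that] \<mu>\<theta> \<theta> unfolding H_def[symmetric] m_def[symmetric] by linarith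
        hence "real (card U + 6) < real (3 * card (nbr H v))" by (simp add: m_def)
        thus ?thesis by (simp only: of_nat_less_iff)
      qed
      show "{p, q} \<notin> H" if "{a, b} \<in> H" "{x, y} \<in> H" "{a, b} \<noteq> {x, y}" "c {a, b} = c {x, y}" "{a, u} \<in> H" "{x, u} \<in> H"
          "u \<noteq> b" "u \<noteq> y" "{b, p} \<in> H" "{y, q} \<in> H" for a b x y u p q
        using cg.conflicting_edges[of a b x y u p q] that HE'' by blast
    qed
    have "(1 - \<theta> ^ 2 / 2) * m ^ 2 \<le> 4 * real (card H)"
    proof -
      have "(1 / 8 - 2 * \<mu>) * m ^ 2 \<le> (1 / 8 - 2 * \<mu>) * n ^ 2"
        using mn2 \<mu>\<theta> \<theta> by (intro mult_left_mono) auto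
      hence "(1 / 8 - 2 * \<mu>) * m ^ 2 \<le> n ^ 2 / 8 - 2 * \<mu> * n ^ 2" by (simp add: algebra_simps)
      hence "m ^ 2 - 16 / 3 * (\<mu> * m ^ 2) \<le> 4 * real (card H)" using T by (simp add: algebra_simps)
      moreover have "\<theta> ^ 2 / 2 * m ^ 2 = 8 * (\<mu> * m ^ 2)" using \<mu>(2) by (simp add: \<mu>_def)
      moreover have "0 \<le> \<mu> * m ^ 2" using \<mu> by simp
      moreover have "(1 - \<theta> ^ 2 / 2) * m ^ 2 = m ^ 2 - \<theta> ^ 2 / 2 * m ^ 2" by (simp add: left_diff_distrib)
      ultimately show ?thesis by linarith
    qed
    from conflict_graph.many_colours_or_bipartite[OF conf \<theta>(1) _ _ this[unfolded m_def]]
    have alt: "3 / 2 * real (card H) - m ^ 2 / 4 - \<theta> * m ^ 2 \<le> real (card (c ` H)) \<or>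
      (\<exists>I J. independent_pair U H I J \<and>
      (\<Sum>p\<in>U - (I \<union> J). real (card (nbr H p))) \<le> \<theta> * m ^ 2)"
      using mt \<theta>(3) by (simp add: m_def)
    from alt show ?thesis
    proof
      assume a: "3 / 2 * real (card H) - m ^ 2 / 4 - \<theta> * m ^ 2 \<le> real (card (c ` H))"
      have "card (c ` H) \<le> card (c ` E)" using HE finE by (intro card_mono image_mono) auto
      moreover have "2 * (\<theta> * n ^ 2) \<le> \<eta> * n ^ 2"
        using mult_right_mono[of "2 * \<theta>" \<eta> "n ^ 2"] \<theta>(2) by simp
      ultimately have "n ^ 2 / 8 - \<eta> * n ^ 2 \<le> real (card (c ` E))" using a T th_mn lam_n by linarith
      thus ?thesis by (simp add: n_def algebra_simps)
    next
      assume "\<exists>I J. independent_pair U H I J \<and>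
        (\<Sum>p\<in>U - (I \<union> J). real (card (nbr H p))) \<le> \<theta> * m ^ 2"
      then obtain I J where IJ: "independent_pair U H I J" "(\<Sum>p\<in>U - (I \<union> J). real (card (nbr H p))) \<le> \<theta> * m ^ 2"
        by blast
      define C where "C = H - inner_edges H I (U - I)"
      have "real (card H) \<le> real (card C + (\<Sum>p\<in>U - (I \<union> J). card (nbr H p)))"
        unfolding C_def by (intro of_nat_mono bipartite_part_bound(1)[OF grH IJ(1)])
      hence b1: "real (card H) \<le> real (card C) + \<theta> * m ^ 2" using IJ(2) by simp
      have "real (4 * card C) \<le> real ((card U) ^ 2)"
        unfolding C_def by (intro of_nat_mono bipartite_part_bound(2)[OF grH IJ(1)])
      hence b2: "4 * real (card C) \<le> m ^ 2" by (simp add: m_def)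
      \<comment> \<open>Since \<open>C\<close> alone has almost \<open>n^2 / 4\<close> edges, the
        upper bound on \<open>card E\<close> leaves few inner edges, also among those that cleaning
        or the passage to \<open>U\<close> had removed.\<close>
      have "card C + card (inner_edges E I (V - I)) \<le> card E"
      proof -
        have "C \<inter> inner_edges E I (V - I) = {}"
        proof -
          have "f \<in> inner_edges H I (U - I)" if "f \<in> H" "f \<subseteq> I \<or> f \<subseteq> V - I" for f
            using that finite_simple_graphD(3)[OF grH that(1)] by (auto simp: inner_edges_def)
          thus ?thesis by (auto simp: C_def inner_edges_def[of E])
        qed
        hence "card C + card (inner_edges E I (V - I)) = card (C \<union> inner_edges E I (V - I))"
          using finE HE by (intro card_Un_disjoint[symmetric]) (auto simp: C_def inner_edges_def intro: finite_subset)
        also have "\<dots> \<le> card E" using finE HE by (intro card_mono) (auto simp: C_def inner_edges_def)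
        finally show ?thesis .
      qed
      hence "real (card C) + real (card (inner_edges E I (V - I))) \<le> real (card E)"
        by (simp only: of_nat_add[symmetric] of_nat_le_iff)
      moreover have "4 * real (card E) \<le> n ^ 2 + 4" using e(2) by (simp add: n_def)
      moreover have "n ^ 2 - 16 * (\<mu> * n ^ 2) - 12 * (\<theta> * n ^ 2) \<le> m ^ 2"
        using T b1 b2 th_mn by linarith
      ultimately have "real (card (inner_edges E I (V - I))) \<le> n ^ 2 / 10000000"
        using T b1 th_mn lam_n th_n n2 by linarith
      hence "real (card V) ^ 2 / 8 \<le> real (card (c ` E))"
        using IJ(1)[unfolded independent_pair_def] U(1) nn(3) by (intro near_bipartite_colours[OF gr rb k _ _ e(1)]) (auto simp: n_def)
      moreover have "0 \<le> \<eta> * n ^ 2" using \<eta> by simp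
      ultimately show ?thesis by (simp add: n_def algebra_simps)
    qed
  qed
  have "(1 / 8 - \<eta>) * real (card V) ^ 2 \<le> real (card (c ` E))"
    if gr: "finite_simple_graph (V, E)" and n: "n0 \<le> card V" and rb: "copies_rainbow (cycle_graph (2 * k + 1)) (V, E) c"
      and e: "nat \<lfloor>real (card V) ^ 2 / 4\<rfloor> + 1 \<le> card E" for V :: "'a set" and E c
  proof -
    \<comment> \<open>The bipartite branch requires an upper bound on the number of edges too.
      Discarding the excess keeps all copies rainbow and cannot increase the number of
      colours.\<close>
    obtain E1 where E1: "E1 \<subseteq> E" "card E1 = nat \<lfloor>real (card V) ^ 2 / 4\<rfloor> + 1"
      by (rule obtain_subset_with_card_n[OF e]) (rule that)
    have gr1: "finite_simple_graph (V, E1)" using gr E1(1) by (auto simp: finite_simple_graph_def)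
    have "real (card E1) = real_of_int \<lfloor>real (card V) ^ 2 / 4\<rfloor> + 1" using E1(2) by simp
    hence "real (card V) ^ 2 < 4 * real (card E1)" "4 * real (card E1) \<le> real (card V) ^ 2 + 4" by linarith+
    from exact[OF gr1 n copies_rainbow_subgraph[OF rb order.refl E1(1)] this]
    have "(1 / 8 - \<eta>) * real (card V) ^ 2 \<le> real (card (c ` E1))" .
    also have "card (c ` E1) \<le> card (c ` E)"
      using E1(1) finite_simple_graphD(2)[OF gr] by (intro card_mono image_mono) auto
    finally show ?thesis by simp
  qed
  thus ?thesis by (intro exI[of _ n0]) blast
qed

subsection \<open>The upper bound\<close>

definition two_cliques :: "nat \<Rightarrow> nat \<Rightarrow> nat graph" where
  "two_cliques a n = ({..<n}, {f. card f = 2 \<and> (f \<subseteq> {..<a} \<or> f \<subseteq> {a..<n})})"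

text \<open>An edge is its own colour, encoded as a number; edges of the second clique are first
  shifted onto the initial vertices, so that they reuse the colours of the first.\<close>

definition clique_colour :: "nat \<Rightarrow> nat set \<Rightarrow> nat" where
  "clique_colour a f = (if f \<subseteq> {..<a} then set_encode f else set_encode ((\<lambda>x. x - a) ` f))"

lemma two_cliques_simple: "a \<le> n \<Longrightarrow> finite_simple_graph (two_cliques a n)"
  by (auto simp: finite_simple_graph_def two_cliques_def)

lemma card_edges_two_cliques:
  assumes "a \<le> n"
  shows "card (edges (two_cliques a n)) = (a choose 2) + ((n - a) choose 2)"
proof -
  have fin: "finite {f. f \<subseteq> S \<and> card f = 2}" if "finite S" for S :: "nat set"
    by (rule finite_subset[of _ "Pow S"]) (use that in auto)
  have "edges (two_cliques a n) = {f. f \<subseteq> {..<a} \<and> card f = 2} \<union> {f. f \<subseteq> {a..<n} \<and> card f = 2}"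
    by (auto simp: two_cliques_def)
  also have "card \<dots> = card {f. f \<subseteq> {..<a} \<and> card f = 2} + card {f. f \<subseteq> {a..<n} \<and> card f = 2}"
  proof (rule card_Un_disjoint)
    have False if "f \<subseteq> {..<a}" "f \<subseteq> {a..<n}" "card f = 2" for f
    proof -
      have "f \<subseteq> {..<a} \<inter> {a..<n}" using that by blast
      also have "\<dots> = {}" by auto
      finally show False using that(3) by simp
    qed
    thus "{f. f \<subseteq> {..<a} \<and> card f = 2} \<inter> {f. f \<subseteq> {a..<n} \<and> card f = 2} = {}" by blast
  qed (rule fin, simp)+
  finally show ?thesis using n_subsets[of "{..<a}" 2] n_subsets[of "{a..<n}" 2] by simp
qed

lemma card_clique_colours:
  assumes "a \<le> n" "n - a \<le> a"
  shows "card (clique_colour a ` edges (two_cliques a n)) \<le> a choose 2"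
proof -
  have "clique_colour a ` edges (two_cliques a n) \<subseteq> set_encode ` {f. f \<subseteq> {..<a} \<and> card f = 2}"
  proof
    fix x assume "x \<in> clique_colour a ` edges (two_cliques a n)"
    then obtain f where f: "card f = 2" "f \<subseteq> {..<a} \<or> f \<subseteq> {a..<n}" "x = clique_colour a f"
      by (auto simp: two_cliques_def)
    show "x \<in> set_encode ` {f. f \<subseteq> {..<a} \<and> card f = 2}"
    proof (cases "f \<subseteq> {..<a}")
      case True
      thus ?thesis using f by (auto simp: clique_colour_def)
    next
      case False
      hence fB: "f \<subseteq> {a..<n}" using f by blast
      have "inj_on (\<lambda>x. x - a) {a..<n}" by (auto simp: inj_on_def)
      hence "inj_on (\<lambda>x. x - a) f" using fB by (rule inj_on_subset)
      hence "card ((\<lambda>x. x - a) ` f) = 2" using f(1) by (simp add: card_image)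
      moreover have "(\<lambda>x. x - a) ` f \<subseteq> {..<a}" using fB assms by fastforce
      ultimately show ?thesis using False f(3) by (auto simp: clique_colour_def)
    qed
  qed
  moreover have fin: "finite {f. f \<subseteq> {..<a} \<and> card f = 2}" by (rule finite_subset[of _ "Pow {..<a}"]) auto
  ultimately have "card (clique_colour a ` edges (two_cliques a n)) \<le> card (set_encode ` {f. f \<subseteq> {..<a} \<and> card f = 2})"
    by (intro card_mono) auto
  also have "\<dots> \<le> card {f. f \<subseteq> {..<a} \<and> card f = 2}" by (rule card_image_le[OF fin])
  also have "\<dots> = a choose 2" using n_subsets[of "{..<a}" 2] by simp
  finally show ?thesis .
qed

text \<open>A cycle is connected, so it stays within one of the cliques, and on each clique the
  colouring is injective.\<close>

lemma two_cliques_rainbow: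
  assumes "0 < m"
  shows "copies_rainbow (cycle_graph m) (two_cliques a n) (clique_colour a)"
  unfolding copies_rainbow_def
proof (intro allI impI)
  fix K assume "is_copy (cycle_graph m) (two_cliques a n) K"
  then obtain \<phi> where sub: "edges K \<subseteq> edges (two_cliques a n)" and K: "edges K = (\<lambda>e. \<phi> ` e) ` edges (cycle_graph m)"
    by (auto simp: is_copy_def subgraph_def graph_iso_def)
  have EK: "edges K = (\<lambda>i. {\<phi> i, \<phi> (Suc i mod m)}) ` {..<m}" unfolding K cycle_graph_def by (auto simp: image_image)
  have side: "\<phi> i < a \<longleftrightarrow> \<phi> 0 < a" if "i < m" for i
    using that
  proof (induction i)
    case (Suc i)
    hence "{\<phi> i, \<phi> (Suc i)} \<in> edges K" unfolding EK by (intro image_eqI[of _ _ i]) auto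
    hence "{\<phi> i, \<phi> (Suc i)} \<in> edges (two_cliques a n)" using sub by blast
    thus ?case using Suc by (auto simp: two_cliques_def)
  qed simp
  have edge: "f \<subseteq> {..<a} \<longleftrightarrow> \<phi> 0 < a" "f \<subseteq> {..<a} \<or> f \<subseteq> {a..<n}" "finite f" if "f \<in> edges K" for f
  proof -
    obtain i where i: "i < m" "f = {\<phi> i, \<phi> (Suc i mod m)}" using \<open>f \<in> edges K\<close> unfolding EK by auto
    have "Suc i mod m < m" using assms by simp
    thus "f \<subseteq> {..<a} \<longleftrightarrow> \<phi> 0 < a" using side[OF i(1)] side[of "Suc i mod m"] by (simp add: i(2))
    show "f \<subseteq> {..<a} \<or> f \<subseteq> {a..<n}" using \<open>f \<in> edges K\<close> sub by (auto simp: two_cliques_def)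
    show "finite f" using i by simp
  qed
  show "rainbow (clique_colour a) K"
    unfolding rainbow_def
  proof (rule inj_onI)
    fix f g assume fg: "f \<in> edges K" "g \<in> edges K" and eq: "clique_colour a f = clique_colour a g"
    show "f = g"
    proof (cases "\<phi> 0 < a")
      case True
      thus ?thesis using eq edge fg by (simp add: clique_colour_def set_encode_eq)
    next
      case False
      hence ab: "f \<subseteq> {a..<n}" "g \<subseteq> {a..<n}" using edge fg by blast+
      have "(\<lambda>x. x - a) ` f = (\<lambda>x. x - a) ` g"
        using eq edge fg False by (simp add: clique_colour_def set_encode_eq)
      moreover have "inj_on (\<lambda>x. x - a) {a..<n}" by (auto simp: inj_on_def)
      ultimately show ?thesis using ab by (simp add: inj_on_image_eq_iff)
    qed
  qed
qed

lemma few_colours_construction: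
  fixes \<eta> :: real
  assumes \<eta>: "0 < \<eta>" "\<eta> \<le> 1" and n: "96 < \<eta> ^ 2 * real n"
  shows "\<exists>a. a \<le> n \<and> nat \<lfloor>(real n) ^ 2 / 4\<rfloor> + 1 \<le> card (edges (two_cliques a n)) \<and>
    real (card (clique_colour a ` edges (two_cliques a n))) \<le> (1 / 8 + \<eta>) * (real n) ^ 2"
proof -
  \<comment> \<open>The graph has \<open>(n^2 + (2 a - n)^2) / 4 - n / 2\<close> edges, so the
    imbalance only has to exceed the order of \<open>sqrt n\<close>. A linear imbalance is
    convenient and keeps \<open>a^2 / 2\<close> within \<open>\<eta> n^2\<close> of
    \<open>n^2 / 8\<close>; the bound \<open>96 = 6 * 16\<close> gives
    \<open>6 n \<le> x^2\<close>.\<close>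
  define x where "x = \<eta> / 4 * real n"
  define t where "t = nat \<lceil>x\<rceil>"
  define a where "a = n div 2 + t"
  have npos: "0 < real n" using n by (cases "n = 0") auto
  have "\<eta> ^ 2 * real n \<le> \<eta> * real n" using \<eta> npos by (simp add: power2_eq_square mult_left_le)
  hence x24: "24 < x" using n by (simp add: x_def)
  have t: "x \<le> real t" "real t \<le> x + 1" using x24 by (auto simp: t_def)
  have xn: "x \<le> real n / 4" using \<eta> npos by (simp add: x_def)
  have half: "real n / 2 - 1 / 2 \<le> real (n div 2)" "real (n div 2) \<le> real n / 2" by linarith+
  have a: "real n / 2 + x - 1 / 2 \<le> real a" "real a \<le> real n / 2 + x + 1"
    using half t by (auto simp: a_def)
  have an: "a \<le> n"
  proof -
    have "real a \<le> real n" using a xn x24 by linarith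
    thus ?thesis by simp
  qed
  have na: "n - a \<le> a" using half t x24 by (simp add: a_def)
  have sq: "2 * real n + 4 \<le> (2 * real a - real n) ^ 2"
  proof -
    have "6 \<le> (\<eta> / 4) ^ 2 * real n" using n by (simp add: power_divide)
    hence "6 * real n \<le> (\<eta> / 4) ^ 2 * real n * real n" using npos by (intro mult_right_mono) auto
    hence "6 * real n \<le> x ^ 2" by (simp add: x_def power2_eq_square mult_ac)
    also have "x ^ 2 \<le> (2 * real a - real n) ^ 2" using a x24 by (intro power_mono) linarith+
    finally show ?thesis using xn x24 by linarith
  qed
  have ch: "real (j choose 2) = (real j ^ 2 - real j) / 2" for j
    by (induction j) (auto simp: numeral_2_eq_2 power2_eq_square field_simps)
  have "real (card (edges (two_cliques a n))) = (real n ^ 2 + (2 * real a - real n) ^ 2) / 4 - real n / 2"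
    using an by (simp add: card_edges_two_cliques ch of_nat_diff power2_eq_square field_simps)
  hence "real n ^ 2 / 4 + 1 \<le> real (card (edges (two_cliques a n)))" using sq by (simp add: field_simps)
  moreover have "real (nat \<lfloor>(real n) ^ 2 / 4\<rfloor>) \<le> (real n) ^ 2 / 4" by (rule of_nat_floor) simp
  ultimately have "real (nat \<lfloor>(real n) ^ 2 / 4\<rfloor> + 1) \<le> real (card (edges (two_cliques a n)))" by simp
  hence "nat \<lfloor>(real n) ^ 2 / 4\<rfloor> + 1 \<le> card (edges (two_cliques a n))" by (simp only: of_nat_le_iff)
  moreover have "real (card (clique_colour a ` edges (two_cliques a n))) \<le> (1 / 8 + \<eta>) * (real n) ^ 2"
  proof -
    have "real (card (clique_colour a ` edges (two_cliques a n))) \<le> real (a choose 2)"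
      using card_clique_colours[OF an na] by simp
    also have "\<dots> \<le> real a ^ 2 / 2" by (simp add: ch)
    also have "real a ^ 2 \<le> (real n / 2 + 2 * x) ^ 2" using a x24 by (intro power_mono) linarith+
    also have "(real n / 2 + 2 * x) ^ 2 = (1 / 4 + \<eta> / 2 + \<eta> ^ 2 / 4) * real n ^ 2"
      by (simp add: x_def power2_eq_square algebra_simps)
    also have "\<dots> \<le> (1 / 4 + 2 * \<eta>) * real n ^ 2"
    proof (rule mult_right_mono)
      have "\<eta> ^ 2 \<le> \<eta>" using \<eta> by (simp add: power2_eq_square mult_left_le)
      thus "1 / 4 + \<eta> / 2 + \<eta> ^ 2 / 4 \<le> 1 / 4 + 2 * \<eta>" using \<eta> by linarith
    qed simp
    finally show ?thesis by (simp add: field_simps)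
  qed
  ultimately show ?thesis using an by blast
qed

section \<open>From colourings to the extremal function\<close>

lemma rainbow_number_le: "copies_rainbow H G c \<Longrightarrow> rainbow_number H G \<le> card (c ` edges G)"
  unfolding rainbow_number_def by (rule Least_le) blast

lemma rainbow_number_attained:
  assumes "finite_simple_graph G"
  obtains c where "copies_rainbow H G c" "card (c ` edges G) = rainbow_number H G"
proof -
  have "\<exists>m c. copies_rainbow H G c \<and> card (c ` edges G) = m" using ex_copies_rainbow[OF assms] by blast
  from LeastI_ex[OF this] show ?thesis using that unfolding rainbow_number_def by blast
qed

lemma f_min_le:
  fixes G :: "nat graph"
  assumes "finite_simple_graph G" "card (verts G) = n" "e \<le> card (edges G)"
  shows "f_min n e H \<le> rainbow_number H G"
  unfolding f_min_def by (rule Least_le) (use assms in blast)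

lemma f_min_attained:
  assumes "\<exists>G :: nat graph. finite_simple_graph G \<and> card (verts G) = n \<and> e \<le> card (edges G)"
  obtains G :: "nat graph" where "finite_simple_graph G" "card (verts G) = n" "e \<le> card (edges G)"
    "rainbow_number H G = f_min n e H"
proof -
  have "\<exists>m. \<exists>G :: nat graph. finite_simple_graph G \<and> card (verts G) = n \<and> card (edges G) \<ge> e \<and> rainbow_number H G = m"
    using assms by blast
  from LeastI_ex[OF this] show ?thesis using that unfolding f_min_def by blast
qed

lemma f_min_asymptotics:
  fixes \<eta> :: real
  assumes k: "3 \<le> k" and \<eta>: "0 < \<eta>" "\<eta> \<le> 1"
  shows "\<forall>\<^sub>F n in sequentially.
    \<bar>real (f_min n (nat \<lfloor>(real n)\<^sup>2 / 4\<rfloor> + 1) (cycle_graph (2 * k + 1))) - (real n)\<^sup>2 / 8\<bar> \<le> \<eta> * (real n)\<^sup>2"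
proof -
  obtain n0 where n0: "\<forall>(V :: nat set) E c. finite_simple_graph (V, E) \<longrightarrow> n0 \<le> card V \<longrightarrow>
    copies_rainbow (cycle_graph (2 * k + 1)) (V, E) c \<longrightarrow>
    nat \<lfloor>real (card V) ^ 2 / 4\<rfloor> + 1 \<le> card E \<longrightarrow>
    (1 / 8 - \<eta>) * real (card V) ^ 2 \<le> real (card (c ` E))"
    using colours_lower_bound[OF k \<eta>(1), where 'a = nat] by blast
  have "\<bar>real (f_min n (nat \<lfloor>(real n)\<^sup>2 / 4\<rfloor> + 1) (cycle_graph (2 * k + 1))) - (real n)\<^sup>2 / 8\<bar> \<le> \<eta> * (real n)\<^sup>2"
    if n: "n0 \<le> n" "nat \<lceil>97 / \<eta> ^ 2\<rceil> \<le> n" for n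
  proof -
    define e where "e = nat \<lfloor>(real n)\<^sup>2 / 4\<rfloor> + 1"
    define H where "H = cycle_graph (2 * k + 1)"
    have "97 / \<eta> ^ 2 \<le> real n" using n(2) by linarith
    hence "97 \<le> \<eta> ^ 2 * real n" using \<eta> by (simp add: pos_divide_le_eq mult.commute)
    then obtain a where a: "a \<le> n" "e \<le> card (edges (two_cliques a n))"
      "real (card (clique_colour a ` edges (two_cliques a n))) \<le> (1 / 8 + \<eta>) * (real n) ^ 2"
      using few_colours_construction[OF \<eta>, of n] unfolding e_def by auto
    have G: "finite_simple_graph (two_cliques a n)" "card (verts (two_cliques a n)) = n"
      using two_cliques_simple[OF a(1)] by (auto simp: two_cliques_def)
    have "f_min n e H \<le> rainbow_number H (two_cliques a n)" by (rule f_min_le[OF G a(2)])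
    also have "\<dots> \<le> card (clique_colour a ` edges (two_cliques a n))"
      unfolding H_def by (rule rainbow_number_le[OF two_cliques_rainbow]) simp
    finally have up: "real (f_min n e H) \<le> (1 / 8 + \<eta>) * (real n) ^ 2" using a(3) by linarith
    obtain G' :: "nat graph" where G': "finite_simple_graph G'" "card (verts G') = n" "e \<le> card (edges G')"
      "rainbow_number H G' = f_min n e H"
      using f_min_attained[of n e H] G a(2) by blast
    obtain c where c: "copies_rainbow H G' c" "card (c ` edges G') = rainbow_number H G'"
      using rainbow_number_attained[OF G'(1)] .
    have "(1 / 8 - \<eta>) * (real n) ^ 2 \<le> real (card (c ` edges G'))"
      using n0[rule_format, of "verts G'" "edges G'" c] G' c(1) n(1) by (simp add: H_def e_def)
    hence "(1 / 8 - \<eta>) * (real n) ^ 2 \<le> real (f_min n e H)" using c(2) G'(4) by simp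
    thus ?thesis using up by (simp add: e_def H_def abs_le_iff algebra_simps)
  qed
  thus ?thesis
    by (intro eventually_sequentiallyI[of "max n0 (nat \<lceil>97 / \<eta> ^ 2\<rceil>)"]) auto
qed

theorem corollary1p2:
  fixes k :: nat
  assumes "k \<ge> 3"
  shows "\<exists>\<epsilon> :: nat \<Rightarrow> real. \<epsilon> \<in> o(\<lambda>_. 1) \<and>
    (\<forall>\<^sub>F n in sequentially.
      real (f_min n (nat \<lfloor>(real n)\<^sup>2 / 4\<rfloor> + 1) (cycle_graph (2 * k + 1))) = (1/8 + \<epsilon> n) * (real n)\<^sup>2)"
proof -
  define F where "F = (\<lambda>n. real (f_min n (nat \<lfloor>(real n)\<^sup>2 / 4\<rfloor> + 1) (cycle_graph (2 * k + 1))))"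
  define \<epsilon> where "\<epsilon> = (\<lambda>n. F n / (real n)\<^sup>2 - 1 / 8)"
  have pos: "\<forall>\<^sub>F n in sequentially. 0 < (n :: nat)" by (rule eventually_gt_at_top)
  have "\<epsilon> \<in> o(\<lambda>_. 1)"
  proof (rule landau_o.smallI)
    fix r :: real assume r: "0 < r"
    define \<eta> where "\<eta> = min r 1"
    have \<eta>: "0 < \<eta>" "\<eta> \<le> 1" "\<eta> \<le> r" using r by (auto simp: \<eta>_def)
    show "\<forall>\<^sub>F n in sequentially. norm (\<epsilon> n) \<le> r * norm (1 :: real)"
      using f_min_asymptotics[OF assms \<eta>(1,2)] pos
    proof eventually_elim
      case (elim n)
      have n2: "0 < (real n)\<^sup>2" using elim(2) by simp
      have "\<epsilon> n = (F n - (real n)\<^sup>2 / 8) / (real n)\<^sup>2" using n2 by (simp add: \<epsilon>_def diff_divide_distrib)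
      hence "\<bar>\<epsilon> n\<bar> = \<bar>F n - (real n)\<^sup>2 / 8\<bar> / (real n)\<^sup>2" by (simp add: abs_divide)
      also have "\<dots> \<le> \<eta>" using elim(1) n2 by (simp add: pos_divide_le_eq F_def)
      finally show ?case using \<eta>(3) by simp
    qed
  qed
  moreover have "\<forall>\<^sub>F n in sequentially. F n = (1/8 + \<epsilon> n) * (real n)\<^sup>2"
    using pos by eventually_elim (simp add: \<epsilon>_def)
  ultimately show ?thesis unfolding F_def by blast
qed

end
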